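(* Let $V\in L^\infty_{\mathrm{loc}}(\mathbb{R}^d)$ and $V\ge0$. For $y\in\mathbb{R}^d$ and $R>0$ put $C_R(y)=y+(0,R)^d$. Then $$\inf\sigma(-\Delta+V)\ge\sup_{R>0}\ \inf_{y\in R\mathbb{Z}^d}\ \frac{\pi^2}{\pi^2+2R^2\|V\|_{L^\infty(C_R(y))}}\,\frac{1}{R^d}\int_{C_R(y)}V(x)\,\mathrm{d}x.$$ In particular, if $R,\varrho>0$ and $V$ is $(R,\varrho)$-thick, then $$\inf\sigma(-\Delta+V)\ge\frac{\pi^2\varrho}{\pi^2+2R^2\|V\|_{L^\infty(\mathbb{R}^d)}}.$$
   Context: $-\Delta+V$ is the selfadjoint operator in $L^2(\mathbb{R}^d)$ associated with the closed quadratic form $u\mapsto\int_{\mathbb{R}^d}|\nabla u|^2\,\mathrm{d}x+\int_{\mathbb{R}^d}V|u|^2\,\mathrm{d}x$ with domain $\{u\in W^{1,2}(\mathbb{R}^d): V|u|^2\in L^1(\mathbb{R}^d)\}$. The function $V\ge 0$ is $(R,\varrho)$-thick if $\frac{1}{R^d}\int_{C_R(y)}V(x)\,\mathrm{d}x\ge\varrho$ for all $y\in\mathbb{R}^d$. If $\|V\|_{L^\infty(\mathbb{R}^d)}=\infty$, the right-hand side of the last inequality is read as $0$. *)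

theory Defs
  imports "HOL-Analysis.Analysis" "HOL-Probability.Essential_Supremum"
begin

section \<open>\<open>L\<^sup>2(\<real>\<^sup>d)\<close> and \<open>L\<^sup>\<infinity>\<close>\<close>

text \<open>
  The space \<open>\<real>\<^sup>d\<close> is \<open>real ^ 'n\<close> with \<open>d = CARD('n)\<close>. Elements of the complex Hilbert space
  \<open>L\<^sup>2(\<real>\<^sup>d)\<close> are represented by functions; equality in \<open>L\<^sup>2\<close> is equality almost everywhere.
\<close>

definition L2 :: "(real ^ 'n \<Rightarrow> complex) set" where
  "L2 = {f. f \<in> borel_measurable lebesgue \<and> integrable lebesgue (\<lambda>x. (norm (f x))\<^sup>2)}"

definition L2_inner :: "(real ^ 'n \<Rightarrow> complex) \<Rightarrow> (real ^ 'n \<Rightarrow> complex) \<Rightarrow> complex" where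
  "L2_inner f g = (LINT x|lebesgue. f x * cnj (g x))"

definition L2_norm :: "(real ^ 'n \<Rightarrow> complex) \<Rightarrow> real" where
  "L2_norm f = sqrt (LINT x|lebesgue. (norm (f x))\<^sup>2)"

text \<open>The essential supremum is taken in \<open>ennreal\<close>, so that the norm over a null set is \<open>0\<close>.
  The norm is \<open>ereal\<close>-valued: \<open>ereal a / \<infinity> = 0\<close> gives the usual reading of a quotient whose
  denominator contains an infinite norm.\<close>

definition Linf_norm :: "(real ^ 'n) set \<Rightarrow> (real ^ 'n \<Rightarrow> real) \<Rightarrow> ereal" where
  "Linf_norm S V = enn2ereal (esssup (restrict_space lebesgue S) (\<lambda>x. ennreal \<bar>V x\<bar>))"

definition Linf_loc :: "(real ^ 'n \<Rightarrow> real) set" where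
  "Linf_loc = {V. V \<in> borel_measurable lebesgue \<and> (\<forall>K. compact K \<longrightarrow> Linf_norm K V < \<infinity>)}"

section \<open>The Sobolev space \<open>W\<^sup>1\<^sup>,\<^sup>2(\<real>\<^sup>d)\<close>\<close>

definition partial :: "'n \<Rightarrow> (real ^ 'n \<Rightarrow> real) \<Rightarrow> real ^ 'n \<Rightarrow> real" where
  "partial i \<phi> x = frechet_derivative \<phi> (at x) (axis i 1)"

primrec Ck :: "nat \<Rightarrow> (real ^ 'n \<Rightarrow> real) \<Rightarrow> bool" where
  "Ck 0 \<phi> \<longleftrightarrow> continuous_on UNIV \<phi>"
| "Ck (Suc k) \<phi> \<longleftrightarrow> (\<forall>x. \<phi> differentiable (at x)) \<and> (\<forall>i. Ck k (partial i \<phi>))"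

definition test_function :: "(real ^ 'n \<Rightarrow> real) \<Rightarrow> bool" where
  "test_function \<phi> \<longleftrightarrow> (\<forall>k. Ck k \<phi>) \<and> compact (closure {x. \<phi> x \<noteq> 0})"

definition has_weak_partial ::
  "'n \<Rightarrow> (real ^ 'n \<Rightarrow> complex) \<Rightarrow> (real ^ 'n \<Rightarrow> complex) \<Rightarrow> bool" where
  "has_weak_partial i u g \<longleftrightarrow>
     (\<forall>\<phi>. test_function \<phi> \<longrightarrow>
        (LINT x|lebesgue. partial i \<phi> x *\<^sub>R u x) = - (LINT x|lebesgue. \<phi> x *\<^sub>R g x))"

definition W12 :: "(real ^ 'n \<Rightarrow> complex) set" where
  "W12 = {u \<in> L2. \<forall>i. \<exists>g\<in>L2. has_weak_partial i u g}"

text \<open>For \<open>u \<in> W12\<close> the weak partial derivative is unique up to null sets.\<close>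

definition weak_partial :: "'n \<Rightarrow> (real ^ 'n \<Rightarrow> complex) \<Rightarrow> real ^ 'n \<Rightarrow> complex" where
  "weak_partial i u = (SOME g. g \<in> L2 \<and> has_weak_partial i u g)"

section \<open>The operator \<open>-\<Delta> + V\<close>\<close>

definition form_domain :: "(real ^ 'n \<Rightarrow> real) \<Rightarrow> (real ^ 'n \<Rightarrow> complex) set" where
  "form_domain V = {u \<in> W12. integrable lebesgue (\<lambda>x. V x * (norm (u x))\<^sup>2)}"

text \<open>
  The sesquilinear form, linear in the first argument, whose quadratic form is
  \<open>u \<mapsto> \<integral> |\<nabla>u|\<^sup>2 dx + \<integral> V |u|\<^sup>2 dx\<close>.
\<close>

definition schroedinger_form ::
  "(real ^ 'n \<Rightarrow> real) \<Rightarrow> (real ^ 'n \<Rightarrow> complex) \<Rightarrow> (real ^ 'n \<Rightarrow> complex) \<Rightarrow> complex" where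
  "schroedinger_form V u v =
     (\<Sum>i\<in>UNIV. L2_inner (weak_partial i u) (weak_partial i v))
     + (LINT x|lebesgue. complex_of_real (V x) * (u x * cnj (v x)))"

lemma weak_partial_in_L2: "u \<in> W12 \<Longrightarrow> weak_partial i u \<in> L2"
  unfolding weak_partial_def W12_def
  by (metis (mono_tags, lifting) mem_Collect_eq someI_ex)

lemma schroedinger_form_diag:
  fixes u :: "real ^ 'n \<Rightarrow> complex"
  assumes "u \<in> form_domain V"
  shows "schroedinger_form V u u = complex_of_real (
    (LINT x|lebesgue. (\<Sum>i\<in>UNIV. (norm (weak_partial i u x))\<^sup>2)) + (LINT x|lebesgue. V x * (norm (u x))\<^sup>2))"
proof -
  have "u \<in> W12"
    using assms by (simp add: form_domain_def)
  then have "integrable lebesgue (\<lambda>x. (norm (weak_partial i u x))\<^sup>2)" for i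
    using weak_partial_in_L2[of u i] by (simp add: L2_def)
  then have "(LINT x|lebesgue. (\<Sum>i\<in>UNIV. (norm (weak_partial i u x))\<^sup>2))
      = (\<Sum>i\<in>UNIV. LINT x|lebesgue. (norm (weak_partial i u x))\<^sup>2)"
    by (intro Bochner_Integration.integral_sum) auto
  moreover have "z * cnj z = complex_of_real ((norm z)\<^sup>2)" for z
    by (rule complex_norm_square[symmetric])
  ultimately show ?thesis
    unfolding schroedinger_form_def L2_inner_def
    by (simp del: of_real_power of_real_mult add: of_real_mult[symmetric])
qed

text \<open>
  The graph of the operator associated with the form: \<open>u\<close> is in its domain, with image \<open>f\<close>, iff
  \<open>u\<close> is in the form domain and \<open>a(u, v) = \<langle>f, v\<rangle>\<close> for all \<open>v\<close> in the form domain.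
\<close>

definition schroedinger_op ::
  "(real ^ 'n \<Rightarrow> real) \<Rightarrow> ((real ^ 'n \<Rightarrow> complex) \<times> (real ^ 'n \<Rightarrow> complex)) set" where
  "schroedinger_op V = {(u, f). u \<in> form_domain V \<and> f \<in> L2 \<and>
     (\<forall>v\<in>form_domain V. schroedinger_form V u v = L2_inner f v)}"

text \<open>
  For an operator given by its graph \<open>A\<close> (on representatives), the resolvent set consists of the
  \<open>z\<close> for which \<open>A - z\<close> is injective and onto \<open>L\<^sup>2\<close> with bounded inverse.
\<close>

definition resolvent_set ::
  "((real ^ 'n \<Rightarrow> complex) \<times> (real ^ 'n \<Rightarrow> complex)) set \<Rightarrow> complex set" where
  "resolvent_set A = {z.
     (\<forall>(u, f)\<in>A. (AE x in lebesgue. f x - z * u x = 0) \<longrightarrow> (AE x in lebesgue. u x = 0)) \<and>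
     (\<forall>g\<in>L2. \<exists>(u, f)\<in>A. AE x in lebesgue. f x - z * u x = g x) \<and>
     (\<exists>C. \<forall>(u, f)\<in>A. L2_norm u \<le> C * L2_norm (\<lambda>x. f x - z * u x))}"

definition spectrum ::
  "((real ^ 'n \<Rightarrow> complex) \<times> (real ^ 'n \<Rightarrow> complex)) set \<Rightarrow> complex set" where
  "spectrum A = - resolvent_set A"

text \<open>
  The spectrum of a selfadjoint operator is real, so taking real parts only changes the type.
\<close>

definition inf_spectrum ::
  "((real ^ 'n \<Rightarrow> complex) \<times> (real ^ 'n \<Rightarrow> complex)) set \<Rightarrow> ereal" where
  "inf_spectrum A = (INF z\<in>spectrum A. ereal (Re z))"

section \<open>Cubes and thickness\<close>

definition cube :: "real \<Rightarrow> real ^ 'n \<Rightarrow> (real ^ 'n) set" where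
  "cube R y = (+) y ` {x. \<forall>i. 0 < x $ i \<and> x $ i < R}"

definition scaled_lattice :: "real \<Rightarrow> (real ^ 'n) set" where
  "scaled_lattice R = (*\<^sub>R) R ` {k. \<forall>i. k $ i \<in> \<int>}"

definition cube_average :: "real \<Rightarrow> (real ^ 'n \<Rightarrow> real) \<Rightarrow> real ^ 'n \<Rightarrow> real" where
  "cube_average R V y = 1 / R ^ CARD('n) * (LINT x:cube R y|lebesgue. V x)"

definition thick :: "real \<Rightarrow> real \<Rightarrow> (real ^ 'n \<Rightarrow> real) \<Rightarrow> bool" where
  "thick R \<rho> V \<longleftrightarrow> (\<forall>y. cube_average R V y \<ge> \<rho>)"

end

theory Submission
  imports Defs
begin

text \<open>
  If the quadratic form of \<open>-\<Delta> + V\<close> is bounded below by \<open>\<kappa>\<close>, that is \<open>\<kappa> \<parallel>u\<parallel>\<^sup>2 \<le> \<integral> |\<nabla>u|\<^sup>2 + \<integral> V |u|\<^sup>2\<close> on the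
  form domain, then every \<open>z\<close> with \<open>Re z < \<kappa>\<close> lies in the resolvent set. So it suffices to bound the form
  below, for each \<open>R > 0\<close>, by the infimum of the stated terms over the cubes \<open>C_R(y)\<close>, \<open>y \<in> R \<int>\<^sup>d\<close>. These
  cubes tile the space up to a null set, hence it suffices to prove on a single cube \<open>Q\<close> of side \<open>R\<close>,
  where \<open>V \<le> m\<close> has mean \<open>\<rho>\<close>, that \<open>\<pi>\<^sup>2 \<rho> / (\<pi>\<^sup>2 + 2 R\<^sup>2 m) \<integral>\<^sub>Q |u|\<^sup>2 \<le> \<integral>\<^sub>Q |\<nabla>u|\<^sup>2 + \<integral>\<^sub>Q V |u|\<^sup>2\<close>.

  On the cube, \<open>u\<close> is split into its mean \<open>c\<close> and the rest. The constant part is controlled by the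
  potential, and the rest by a Poincare inequality. The estimate of the potential term in
  \<open>weighted_mean_bound\<close> uses the variance of \<open>V\<close> instead of its supremum and needs only
  \<open>(\<pi>\<^sup>2 / (2 R\<^sup>2)) \<integral>\<^sub>Q |u - c|\<^sup>2 \<le> \<integral>\<^sub>Q |\<nabla>u|\<^sup>2\<close>. This is half of what the optimal Poincare constant would
  give, so the elementary inequality \<open>poincare_box\<close> with \<open>6 / R\<^sup>2\<close> is enough, because \<open>\<pi>\<^sup>2 \<le> 12\<close>.

  The Poincare inequality is obtained for weak derivatives without smoothing. Testing shows that
  differences of \<open>u\<close> along a coordinate direction are integrals of the weak derivative
  (\<open>weak_partial_difference\<close>), which bounds the effect of resampling one coordinate
  (\<open>coordinate_variation\<close>). The passage to all coordinates is the Efron--Stein inequality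
  (\<open>efron_stein\<close>); it rests on the invariance of Lebesgue measure under exchanging coordinates of two
  points.

  The statement on the resolvent set (\<open>resolvent_below_bound\<close>) combines the completeness of the form
  domain (\<open>complete_schroedinger\<close>) with the representation theorem of Riesz, applied twice in order to reach
  nonreal \<open>z\<close> (\<open>weak_resolvent\<close>). The bound for thick potentials follows from the first one, as the norm on a
  cube is at most the norm on the whole space.
\<close>

section \<open>Smooth test functions\<close>

lemma partial_eq:
  assumes "(f has_derivative f') (at x)"
  shows "partial i f x = f' (axis i 1)"
  unfolding partial_def using frechet_derivative_at[OF assms] by simp

lemma Ck_cont: "Ck k f \<Longrightarrow> continuous_on UNIV f"
  by (cases k) (auto simp: continuous_on_eq_continuous_at differentiable_imp_continuous_within)

lemma Ck_Suc_imp: "Ck (Suc k) f \<Longrightarrow> Ck k f"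
proof (induction k arbitrary: f)
  case 0
  then show ?case using Ck_cont[OF 0] by (simp only: Ck.simps)
next
  case (Suc k)
  then show ?case by (metis Ck.simps(2))
qed

lemma Ck_const: "Ck k (\<lambda>x::real^'n. c)"
proof (induction k arbitrary: c)
  case (Suc k)
  have "partial i (\<lambda>x::real^'n. c) = (\<lambda>x. 0)" for i
    by (rule ext, subst partial_eq[where f'="\<lambda>_. 0"]) auto
  with Suc show ?case by auto
qed auto

lemma Ck_add: "Ck k f \<Longrightarrow> Ck k g \<Longrightarrow> Ck k (\<lambda>x. f x + g x)"
proof (induction k arbitrary: f g)
  case 0
  then show ?case by (auto intro: continuous_intros)
next
  case (Suc k)
  have d: "\<And>x. f differentiable (at x)" "\<And>x. g differentiable (at x)" using Suc.prems by auto
  have "partial i (\<lambda>x. f x + g x) = (\<lambda>x. partial i f x + partial i g x)" for i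
  proof
    fix x
    have "((\<lambda>x. f x + g x) has_derivative (\<lambda>h. frechet_derivative f (at x) h
        + frechet_derivative g (at x) h)) (at x)"
      using d[of x] by (intro has_derivative_add) (simp_all add: frechet_derivative_works)
    from partial_eq[OF this] show "partial i (\<lambda>x. f x + g x) x = partial i f x + partial i g x"
      by (simp add: partial_def)
  qed
  with Suc d show ?case by auto
qed

lemma partial_mult:
  assumes "f differentiable (at x)" "g differentiable (at x)"
  shows "partial i (\<lambda>x. f x * g x) x = f x * partial i g x + partial i f x * g x"
proof -
  have "((\<lambda>x. f x * g x) has_derivative (\<lambda>h. f x * frechet_derivative g (at x) h
      + frechet_derivative f (at x) h * g x)) (at x)"
    using assms by (intro has_derivative_mult) (simp_all add: frechet_derivative_works)
  from partial_eq[OF this] show ?thesis by (simp add: partial_def)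
qed

lemma Ck_mult: "Ck k f \<Longrightarrow> Ck k g \<Longrightarrow> Ck k (\<lambda>x. f x * g x)"
proof (induction k arbitrary: f g)
  case 0
  then show ?case by (auto intro: continuous_intros)
next
  case (Suc k)
  have d: "\<And>x. f differentiable (at x)" "\<And>x. g differentiable (at x)" using Suc.prems by auto
  have "partial i (\<lambda>x. f x * g x) = (\<lambda>x. f x * partial i g x + partial i f x * g x)" for i
    using partial_mult[OF d] by auto
  moreover have "Ck k f" "Ck k g" using Suc.prems Ck_Suc_imp by auto
  ultimately show ?case using Suc d by (auto intro!: Ck_add Suc.IH)
qed

lemma Ck_prod: "finite I \<Longrightarrow> (\<And>i. i \<in> I \<Longrightarrow> Ck k (f i)) \<Longrightarrow> Ck k (\<lambda>x. \<Prod>i\<in>I. f i x)"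
  by (induction I rule: finite_induct) (auto intro: Ck_const Ck_mult)

lemma partial_translate: "partial i (\<lambda>x. f (x + a)) x = partial i f (x + a)"
proof -
  have "((\<lambda>x. f (x + a)) has_derivative D) (at x) \<longleftrightarrow> (f has_derivative D) (at (x + a))" for D
  proof
    assume "((\<lambda>x. f (x + a)) has_derivative D) (at x)"
    then have "((\<lambda>x. f (x + a)) has_derivative D) (at ((x + a) - a))" by simp
    moreover have "((\<lambda>x. x - a) has_derivative (\<lambda>h. h)) (at (x + a))"
      by (auto intro!: derivative_eq_intros)
    ultimately show "(f has_derivative D) (at (x + a))"
      using has_derivative_compose[of "\<lambda>x. x - a" "\<lambda>h. h" "x + a" UNIV "\<lambda>x. f (x + a)" D] by simp
  next
    assume "(f has_derivative D) (at (x + a))"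
    moreover have "((\<lambda>x. x + a) has_derivative (\<lambda>h. h)) (at x)"
      by (auto intro!: derivative_eq_intros)
    ultimately show "((\<lambda>x. f (x + a)) has_derivative D) (at x)"
      using has_derivative_compose[of "\<lambda>x. x + a" "\<lambda>h. h" x UNIV f D] by simp
  qed
  then show ?thesis by (simp add: partial_def frechet_derivative_def)
qed

lemma Ck_translate: "Ck k f \<Longrightarrow> Ck k (\<lambda>x. f (x + a))"
proof (induction k arbitrary: f)
  case 0
  then show ?case by (auto intro!: continuous_on_compose2[of UNIV f] continuous_intros)
next
  case (Suc k)
  have "(\<lambda>x. f (x + a)) differentiable (at x)" for x
    using Suc.prems differentiable_chain_at[of "\<lambda>x. x + a" x f] by (auto simp: o_def)
  moreover have "partial i (\<lambda>x. f (x + a)) = (\<lambda>x. partial i f (x + a))" for i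
    by (rule ext) (rule partial_translate)
  ultimately show ?case using Suc by auto
qed

lemma test_function_translate:
  assumes "test_function \<phi>"
  shows "test_function (\<lambda>x. \<phi> (x + a))"
proof -
  have "{x. \<phi> (x + a) \<noteq> 0} = (+) (- a) ` {x. \<phi> x \<noteq> 0}"
    by (auto intro!: image_eqI[of _ _ "_ + a"])
  then have "compact (closure {x. \<phi> (x + a) \<noteq> 0})"
    using assms unfolding test_function_def by (simp add: bounded_translation_minus)
  with assms show ?thesis unfolding test_function_def using Ck_translate by blast
qed

text \<open>
  The functions \<open>p(1/t) exp(-1/t)\<close> for \<open>t > 0\<close>, extended by \<open>0\<close>, with a polynomial \<open>p\<close>. This class
  is closed under differentiation (\<open>expinv_deriv\<close>), so all its members are smooth; \<open>p = 1\<close> is the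
  usual smooth step, which tends to \<open>1\<close> at infinity.
\<close>

definition expinv :: "real poly \<Rightarrow> real \<Rightarrow> real" where
  "expinv p t = (if t > 0 then poly p (1 / t) * exp (- (1 / t)) else 0)"

lemma poly_exp_tendsto_0: "((\<lambda>s::real. poly p s * exp (- s)) \<longlongrightarrow> 0) at_top"
proof -
  have 1: "((\<lambda>s::real. coeff p i * (s ^ i / exp s)) \<longlongrightarrow> coeff p i * 0) at_top" for i
    by (intro tendsto_intros tendsto_power_div_exp_0)
  have "((\<lambda>s::real. \<Sum>i\<le>degree p. coeff p i * (s ^ i / exp s)) \<longlongrightarrow> (\<Sum>i\<le>degree p. coeff p i * 0)) at_top"
    by (intro tendsto_sum 1)
  moreover have "(\<Sum>i\<le>degree p. coeff p i * (s ^ i / exp s)) = poly p s * exp (- s)" for s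
    by (simp add: poly_altdef sum_distrib_right exp_minus divide_inverse mult.assoc)
  ultimately show ?thesis by simp
qed

lemma expinv_deriv:
  "(expinv p has_real_derivative expinv ([:0, 0, 1:] * (p - pderiv p)) t) (at t)"
proof -
  consider "t > 0" | "t < 0" | "t = 0" by linarith
  then show ?thesis
  proof cases
    case 1
    have "((\<lambda>s. poly p s * exp (- s)) has_real_derivative
        (poly (pderiv p) (1 / t) - poly p (1 / t)) * exp (- (1 / t))) (at (1 / t))"
      by (auto intro!: derivative_eq_intros poly_DERIV simp: algebra_simps)
    moreover have "((\<lambda>t. 1 / t) has_real_derivative - (1 / t * (1 / t))) (at t)"
      using 1 by (auto intro!: derivative_eq_intros)
    ultimately have "((\<lambda>t. poly p (1 / t) * exp (- (1 / t))) has_real_derivative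
        (poly (pderiv p) (1 / t) - poly p (1 / t)) * exp (- (1 / t)) * - (1 / t * (1 / t))) (at t)"
      using DERIV_chain2 by fast
    also have "(poly (pderiv p) (1 / t) - poly p (1 / t)) * exp (- (1 / t)) * - (1 / t * (1 / t))
        = expinv ([:0, 0, 1:] * (p - pderiv p)) t"
      using 1 by (simp add: expinv_def algebra_simps)
    finally show ?thesis
      by (rule has_field_derivative_transform_within_open[of _ _ _ "{0<..}"])
        (use 1 in \<open>auto simp: expinv_def\<close>)
  next
    case 2
    have "((\<lambda>t. 0) has_real_derivative expinv ([:0, 0, 1:] * (p - pderiv p)) t) (at t)"
      using 2 by (auto simp: expinv_def)
    then show ?thesis
      by (rule has_field_derivative_transform_within_open[of _ _ _ "{..<0}"])
        (use 2 in \<open>auto simp: expinv_def\<close>)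
  next
    case 3
    have r: "((\<lambda>h. expinv p h / h) \<longlongrightarrow> 0) (at_right 0)"
    proof -
      have "((\<lambda>h. poly (pCons 0 p) (inverse h) * exp (- inverse h)) \<longlongrightarrow> 0) (at_right 0)"
        by (rule filterlim_compose[OF poly_exp_tendsto_0 filterlim_inverse_at_top_right])
      then show ?thesis
        by (rule Lim_transform_eventually)
          (auto simp: eventually_at_filter expinv_def field_simps)
    qed
    have l: "((\<lambda>h. expinv p h / h) \<longlongrightarrow> 0) (at_left 0)"
      by (rule Lim_transform_eventually[OF tendsto_const])
          (auto simp: eventually_at_filter expinv_def)
    show ?thesis using filterlim_split_at[OF l r] 3
      by (simp add: DERIV_def expinv_def)
  qed
qed

text \<open>
  The additional factor \<open>c\<close> absorbs the inner derivative, so that the induction goes through.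
\<close>

lemma Ck_expinv: "Ck k (\<lambda>x::real^'n. c * expinv p (\<alpha> * x $ i + \<beta>))"
proof (induction k arbitrary: c p)
  case 0
  have "isCont (expinv p) t" for t using expinv_deriv DERIV_isCont by blast
  then have "continuous_on UNIV (expinv p)" by (simp add: continuous_on_eq_continuous_at)
  then show ?case
    by (auto intro!: continuous_intros continuous_on_compose2[of UNIV "expinv p"])
next
  case (Suc k)
  let ?q = "[:0, 0, 1:] * (p - pderiv p)"
  have d: "((\<lambda>x::real^'n. c * expinv p (\<alpha> * x $ i + \<beta>)) has_derivative
     (\<lambda>h. c * (expinv ?q (\<alpha> * x $ i + \<beta>) * (\<alpha> * h $ i)))) (at x)" for x
  proof -
    have "((\<lambda>x::real^'n. \<alpha> * x $ i + \<beta>) has_derivative (\<lambda>h. \<alpha> * h $ i)) (at x)"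
      by (auto intro!: derivative_eq_intros bounded_linear_imp_has_derivative bounded_linear_vec_nth)
    from has_derivative_compose[OF this, of "expinv p" "(*) (expinv ?q (\<alpha> * x $ i + \<beta>))"]
    show ?thesis using expinv_deriv[of p "\<alpha> * x $ i + \<beta>"]
      by (intro has_derivative_mult_right) (simp add: has_field_derivative_def)
  qed
  have "partial j (\<lambda>x::real^'n. c * expinv p (\<alpha> * x $ i + \<beta>)) =
      (\<lambda>x. (c * \<alpha> * axis j 1 $ i) * expinv ?q (\<alpha> * x $ i + \<beta>))" for j
    by (rule ext, subst partial_eq[OF d]) (auto simp: mult_ac)
  with Suc d show ?case by (auto simp: differentiable_def)
qed

text \<open>
  A product of smooth steps: a test function with values in \<open>[0, 1]\<close>, zero outside the box, and
  increasing to the indicator function of the box as \<open>m\<close> tends to infinity.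
\<close>

definition box_bump :: "real ^ 'n \<Rightarrow> real ^ 'n \<Rightarrow> nat \<Rightarrow> real ^ 'n \<Rightarrow> real" where
  "box_bump a b m x =
    (\<Prod>i\<in>UNIV. expinv 1 (real m * (x $ i - a $ i)) * expinv 1 (real m * (b $ i - x $ i)))"

lemma expinv_1_bounds: "0 \<le> expinv 1 t" "expinv 1 t \<le> 1"
  by (auto simp: expinv_def)

lemma box_bump_bounds: "0 \<le> box_bump a b m x" "box_bump a b m x \<le> 1"
  unfolding box_bump_def
  by (auto intro!: prod_nonneg prod_le_1 mult_nonneg_nonneg mult_le_one expinv_1_bounds)

lemma box_bump_outside: "x \<notin> box a b \<Longrightarrow> box_bump a b m x = 0"
proof -
  assume "x \<notin> box a b"
  then obtain i where "\<not> (a $ i < x $ i \<and> x $ i < b $ i)" by (auto simp: mem_box_cart)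
  then have "expinv 1 (real m * (x $ i - a $ i)) * expinv 1 (real m * (b $ i - x $ i)) = 0"
    by (auto simp: expinv_def zero_less_mult_iff)
  then show ?thesis unfolding box_bump_def
    by (metis (no_types, lifting) UNIV_I finite_class.finite_UNIV prod_zero)
qed

lemma test_function_box_bump: "test_function (box_bump a b m :: real^'n \<Rightarrow> real)"
proof -
  have 1: "Ck k (\<lambda>x::real^'n. expinv 1 (real m * (x $ i - a $ i)))" for k i
    using Ck_expinv[of k 1 1 "real m" i "- real m * a $ i"] by (simp add: algebra_simps)
  have 2: "Ck k (\<lambda>x::real^'n. expinv 1 (real m * (b $ i - x $ i)))" for k i
    using Ck_expinv[of k 1 1 "- real m" i "real m * b $ i"] by (simp add: algebra_simps)
  have "Ck k (box_bump a b m)" for k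
    unfolding box_bump_def[abs_def] by (intro Ck_prod Ck_mult 1 2) auto
  moreover have "{x. box_bump a b m x \<noteq> 0} \<subseteq> cbox a b"
    using box_bump_outside box_subset_cbox by blast
  then have "bounded {x. box_bump a b m x \<noteq> 0}" using bounded_cbox bounded_subset by blast
  ultimately show ?thesis by (auto simp: test_function_def)
qed

lemma expinv_1_tendsto: "t > 0 \<Longrightarrow> (\<lambda>m. expinv 1 (real m * t)) \<longlonglongrightarrow> 1"
proof -
  assume t: "t > 0"
  have "(\<lambda>m. exp (- (inverse (real m) * (1 / t)))) \<longlonglongrightarrow> exp (- (0 * (1 / t)))"
    by (intro tendsto_intros lim_inverse_n)
  then have "(\<lambda>m. exp (- (inverse (real m) * (1 / t)))) \<longlonglongrightarrow> 1" by simp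
  then show ?thesis
    by (rule Lim_transform_eventually)
      (use t in \<open>auto simp: expinv_def field_simps intro!: eventually_mono[OF eventually_gt_at_top[of 0]]\<close>)
qed

lemma box_bump_tendsto:
  fixes x :: "real ^ 'n"
  shows "(\<lambda>m. box_bump a b m x) \<longlonglongrightarrow> indicator (box a b) x"
proof (cases "x \<in> box a b")
  case True
  then have "(\<lambda>m. box_bump a b m x) \<longlonglongrightarrow> (\<Prod>i\<in>(UNIV::'n set). 1 * 1)"
    unfolding box_bump_def by (intro tendsto_prod tendsto_mult expinv_1_tendsto)
      (auto simp: mem_box_cart)
  with True show ?thesis by simp
next
  case False
  then show ?thesis by (simp add: box_bump_outside)
qed

lemma Ck_bounded:
  assumes "compact (closure {x. f x \<noteq> (0::real)})" "continuous_on UNIV f"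
  obtains C where "C > 0" "\<And>x. \<bar>f x\<bar> \<le> C"
proof -
  have "compact (f ` closure {x. f x \<noteq> 0})"
    using assms by (intro compact_continuous_image) (auto intro: continuous_on_subset)
  then obtain B where B: "B > 0" "\<And>y. y \<in> f ` closure {x. f x \<noteq> 0} \<Longrightarrow> norm y \<le> B"
    using compact_imp_bounded bounded_pos by metis
  have "\<bar>f x\<bar> \<le> B" for x
    using B closure_subset[of "{x. f x \<noteq> 0}"] by (cases "f x = 0") auto
  with B that show ?thesis by auto
qed

lemma test_function_cont:
  assumes "test_function \<phi>"
  shows "continuous_on UNIV \<phi>" "continuous_on UNIV (partial i \<phi>)"
    "\<phi> \<in> borel_measurable borel" "partial i \<phi> \<in> borel_measurable borel" "\<phi> differentiable (at x)"
proof -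
  show 1: "continuous_on UNIV \<phi>" using assms unfolding test_function_def using Ck_cont by blast
  have k: "Ck (Suc 0) \<phi>" using assms unfolding test_function_def by blast
  then show 2: "continuous_on UNIV (partial i \<phi>)" "\<phi> differentiable (at x)" by auto
  show "\<phi> \<in> borel_measurable borel" "partial i \<phi> \<in> borel_measurable borel"
    using 1 2 by (auto intro: borel_measurable_continuous_onI)
qed

lemma test_function_partial_supp:
  assumes "test_function \<phi>"
  shows "{x. partial i \<phi> x \<noteq> 0} \<subseteq> closure {x. \<phi> x \<noteq> 0}"
proof
  fix x assume x: "x \<in> {x. partial i \<phi> x \<noteq> 0}"
  show "x \<in> closure {x. \<phi> x \<noteq> 0}"
  proof (rule ccontr)
    assume n: "x \<notin> closure {x. \<phi> x \<noteq> 0}"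
    have "((\<lambda>x. 0) has_derivative (\<lambda>_. 0)) (at x)" by simp
    then have "(\<phi> has_derivative (\<lambda>_. 0)) (at x)"
      by (rule has_derivative_transform_within_open[of _ _ _ _ "- closure {x. \<phi> x \<noteq> 0}"])
        (use n closure_subset[of "{x. \<phi> x \<noteq> 0}"] in auto)
    from partial_eq[OF this] x show False by simp
  qed
qed

lemma test_function_bound:
  assumes "test_function (\<phi> :: real^'n \<Rightarrow> real)"
  obtains C a b where "C > 0" "\<And>x. \<bar>\<phi> x\<bar> \<le> C * indicator (cbox a b) x"
    "\<And>x i. \<bar>partial i \<phi> x\<bar> \<le> C * indicator (cbox a b) x"
proof -
  let ?S = "closure {x. \<phi> x \<noteq> 0}"
  have c: "compact ?S" using assms by (simp add: test_function_def)
  obtain a b where ab: "?S \<subseteq> cbox a b"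
    using c bounded_subset_cbox_symmetric compact_imp_bounded by metis
  obtain C where C: "C > 0" "\<And>x. \<bar>\<phi> x\<bar> \<le> C" using Ck_bounded[OF c] test_function_cont[OF assms] by auto
  have "\<exists>D>0. \<forall>x. \<bar>partial i \<phi> x\<bar> \<le> D" for i
  proof -
    have "closure {x. partial i \<phi> x \<noteq> 0} \<subseteq> ?S"
      using test_function_partial_supp[OF assms] by (simp add: closure_minimal)
    then have "compact (closure {x. partial i \<phi> x \<noteq> 0})"
      using c by (meson closed_closure compact_closure compact_imp_bounded bounded_subset closure_subset)
    from Ck_bounded[OF this] test_function_cont[OF assms] show ?thesis by metis
  qed
  then obtain D where D: "\<And>i. D i > 0" "\<And>i x. \<bar>partial i \<phi> x\<bar> \<le> D i" by metis
  define E where "E = C + (\<Sum>i\<in>UNIV. D i)"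
  have DE: "D i \<le> E" for i
    using member_le_sum[of i UNIV D] C D unfolding E_def
        by (smt (verit, best) UNIV_I finite_class.finite_UNIV)
  have CE: "C \<le> E" unfolding E_def using D by (simp add: sum_nonneg less_imp_le)
  show ?thesis
  proof (rule that[of E a b])
    show "E > 0" using C CE by simp
    show "\<bar>\<phi> x\<bar> \<le> E * indicator (cbox a b) x" for x
    proof (cases "\<phi> x = 0")
      case True
      then show ?thesis using C CE by (auto split: split_indicator)
    next
      case False
      then have "x \<in> cbox a b" using closure_subset[of "{x. \<phi> x \<noteq> 0}"] ab by blast
      then show ?thesis using C(2)[of x] CE by simp
    qed
    show "\<bar>partial i \<phi> x\<bar> \<le> E * indicator (cbox a b) x" for x i
    proof (cases "partial i \<phi> x = 0")
      case True
      then show ?thesis using C CE by (auto split: split_indicator)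
    next
      case False
      then have "x \<in> cbox a b" using test_function_partial_supp[OF assms] ab by blast
      then show ?thesis using D(2)[of i x] DE[of i] by simp
    qed
  qed
qed

section \<open>Weak derivatives and translations\<close>

lemma norm_le_one_plus_sq: "norm z \<le> 1 + (norm z)\<^sup>2"
proof -
  have "2 * norm z \<le> (norm z)\<^sup>2 + 1" using zero_le_power2[of "norm z - 1"] by (simp add: power2_diff)
  with norm_ge_zero[of z] show ?thesis by linarith
qed

lemma AE_zero_boxes:
  fixes f :: "'a::euclidean_space \<Rightarrow> 'b::{second_countable_topology, banach}"
  assumes int: "\<And>a b. integrable lborel (\<lambda>x. indicator (box a b) x *\<^sub>R f x)"
    and zero: "\<And>a b. (LINT x|lborel. indicator (box a b) x *\<^sub>R f x) = 0"
  shows "AE x in lborel. f x = 0"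
proof -
  let ?B = "\<lambda>n::nat. box (- (real n *\<^sub>R One)) (real n *\<^sub>R One) :: 'a set"
  let ?E = "range (\<lambda>(a, b). box a b :: 'a set)"
  have "AE x in lborel. indicator (?B n) x *\<^sub>R f x = 0" for n
  proof (rule sigma_finite_measure.density_zero[OF sigma_finite_lborel])
    let ?g = "\<lambda>x. indicator (?B n) x *\<^sub>R f x"
    show gi: "integrable lborel ?g" by (rule int)
    have gs: "set_integrable lborel A ?g" if "A \<in> sets lborel" for A
      unfolding set_integrable_def using gi that by (rule integrable_mult_indicator[rotated])
    have gb: "(LINT x:box a b|lborel. ?g x) = 0" for a b
    proof -
      obtain c d where "box a b \<inter> ?B n = box c d" by (simp add: box_Int_box)
      then have "(LINT x:box a b|lborel. ?g x) = (LINT x|lborel. indicator (box c d) x *\<^sub>R f x)"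
        unfolding set_lebesgue_integral_def by (metis (no_types) indicator_inter_arith scaleR_scaleR)
      with zero show ?thesis by simp
    qed
    fix A :: "'a set" assume "A \<in> sets lborel"
    then have A: "A \<in> sigma_sets UNIV ?E" by (simp add: borel_eq_box)
    have "Int_stable ?E" by (auto simp: Int_stable_def box_Int_box)
    moreover have "?E \<subseteq> Pow UNIV" by simp
    ultimately show "(LINT x:A|lborel. ?g x) = 0"
      using A
    proof (induction rule: sigma_sets_induct_disjoint)
      case (compl A)
      then have A: "A \<in> sets lborel" by (simp add: borel_eq_box)
      have "(LINT x:UNIV|lborel. ?g x) = (LINT x:(UNIV - A) \<union> A|lborel. ?g x)" by simp
      also have "\<dots> = (LINT x:UNIV - A|lborel. ?g x) + (LINT x:A|lborel. ?g x)"
        using A gs by (intro set_integral_Un) auto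
      finally show ?case using compl zero by (simp add: set_lebesgue_integral_def)
    next
      case (union A)
      have A: "A i \<in> sets lborel" for i
        using subsetD[OF union(2) rangeI[of A i]] by (simp add: borel_eq_box)
      have "(LINT x:(\<Union>i. A i)|lborel. ?g x) = (\<Sum>i. LINT x:A i|lborel. ?g x)"
        using A union(1) by (intro lebesgue_integral_countable_add gs) (auto simp: disjoint_family_on_def)
      with union(3) show ?case by simp
    qed (use gb in \<open>auto simp: set_lebesgue_integral_def\<close>)
  qed
  then have "AE x in lborel. \<forall>n. indicator (?B n) x *\<^sub>R f x = 0" unfolding AE_all_countable by blast
  then show ?thesis
  proof eventually_elim
    case (elim x)
    have "x \<in> (\<Union>n. ?B n)" by (simp add: UN_box_eq_UNIV)
    with elim show ?case by (auto simp: indicator_def split: if_splits)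
  qed
qed

text \<open>
  The fundamental lemma of the calculus of variations, for functions that are integrable on boxes.
\<close>

lemma fundamental_lemma:
  fixes f :: "real ^ 'n \<Rightarrow> complex"
  assumes int: "\<And>a b. integrable lborel (\<lambda>x. indicator (box a b) x *\<^sub>R f x)"
    and zero: "\<And>\<phi>. test_function \<phi> \<Longrightarrow> (LINT x|lborel. \<phi> x *\<^sub>R f x) = 0"
  shows "AE x in lborel. f x = 0"
proof (rule AE_zero_boxes[OF int])
  fix a b :: "real ^ 'n"
  have eq: "box_bump a b m x *\<^sub>R f x = box_bump a b m x *\<^sub>R (indicator (box a b) x *\<^sub>R f x)" for m x
    using box_bump_outside[of x a b m] by (cases "x \<in> box a b") auto
  have "(\<lambda>m. LINT x|lborel. box_bump a b m x *\<^sub>R f x) \<longlonglongrightarrow> (LINT x|lborel. indicator (box a b) x *\<^sub>R f x)"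
  proof (rule integral_dominated_convergence[where w="\<lambda>x. norm (indicator (box a b) x *\<^sub>R f x)"])
    show "(\<lambda>x. indicator (box a b) x *\<^sub>R f x) \<in> borel_measurable lborel"
      using int[of a b] by (rule borel_measurable_integrable)
    show "(\<lambda>x. box_bump a b m x *\<^sub>R f x) \<in> borel_measurable lborel" for m
      unfolding eq using borel_measurable_integrable[OF int[of a b]]
        test_function_cont(3)[OF test_function_box_bump[of a b m]]
      by (intro borel_measurable_scaleR[of "box_bump a b m"]) simp_all
    show "AE x in lborel. (\<lambda>m. box_bump a b m x *\<^sub>R f x) \<longlonglongrightarrow> indicator (box a b) x *\<^sub>R f x"
      by (auto intro!: tendsto_scaleR box_bump_tendsto)
    show "AE x in lborel. norm (box_bump a b m x *\<^sub>R f x) \<le> norm (indicator (box a b) x *\<^sub>R f x)" for m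
      unfolding eq norm_scaleR[of "box_bump a b m _"]
      using box_bump_bounds[of a b m] by (intro always_eventually allI mult_left_le_one_le) auto
  qed (use integrable_norm[OF int[of a b]] in auto)
  moreover have "(LINT x|lborel. box_bump a b m x *\<^sub>R f x) = 0" for m
    by (rule zero[OF test_function_box_bump])
  ultimately show "(LINT x|lborel. indicator (box a b) x *\<^sub>R f x) = 0"
    by (simp add: LIMSEQ_const_iff)
qed

lemma lborel_integral_translate:
  fixes f :: "'a::euclidean_space \<Rightarrow> 'b::{second_countable_topology, banach}"
  assumes [measurable]: "f \<in> borel_measurable borel"
  shows "(LINT x|lborel. f (x + c)) = (LINT x|lborel. f x)"
  by (subst (2) lborel_distr_plus[of c, symmetric], subst integral_distr) (auto simp: add.commute)

lemma lborel_integrable_translate: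
  fixes f :: "'a::euclidean_space \<Rightarrow> 'b::{second_countable_topology, banach}"
  assumes [measurable]: "f \<in> borel_measurable borel"
  shows "integrable lborel (\<lambda>x. f (x + c)) \<longleftrightarrow> integrable lborel f"
  by (subst (2) lborel_distr_plus[of c, symmetric], subst integrable_distr_eq) (auto simp: add.commute)

lemma lborel_nn_integral_translate:
  fixes f :: "'a::euclidean_space \<Rightarrow> ennreal"
  assumes [measurable]: "f \<in> borel_measurable borel"
  shows "(\<integral>\<^sup>+x. f (x + c) \<partial>lborel) = (\<integral>\<^sup>+x. f x \<partial>lborel)"
  by (subst (2) lborel_distr_plus[of c, symmetric], subst nn_integral_distr) (auto simp: add.commute)

lemma AE_lborel_translate:
  fixes c :: "'a::euclidean_space"
  assumes "AE x in lborel. P x"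
  shows "AE x in lborel. P (x + c)"
proof -
  have "AE x in distr lborel borel ((+) c). P x" using assms by (subst lborel_distr_plus)
  then have "AE x in lborel. P (c + x)" by (rule AE_distrD[rotated]) auto
  then show ?thesis by (simp add: add.commute)
qed

lemma L2_loc_integrable:
  fixes f :: "'a::euclidean_space \<Rightarrow> complex"
  assumes [measurable]: "f \<in> borel_measurable borel" and f: "integrable lborel (\<lambda>x. (norm (f x))\<^sup>2)"
    and S: "S \<in> sets borel" "bounded S"
  shows "integrable lborel (\<lambda>x. indicator S x *\<^sub>R f x)"
proof (rule Bochner_Integration.integrable_bound)
  show "integrable lborel (\<lambda>x. indicator S x + (norm (f x))\<^sup>2 :: real)"
    using S emeasure_bounded_finite[OF S(2)]
    by (intro Bochner_Integration.integrable_add f) (auto simp: integrable_indicator_iff)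
  show "AE x in lborel. norm (indicator S x *\<^sub>R f x) \<le> norm (indicator S x + (norm (f x))\<^sup>2 :: real)"
    using norm_le_one_plus_sq by (auto split: split_indicator)
qed (use S in auto)

lemma integrable_pair_shift:
  fixes g :: "'a::euclidean_space \<Rightarrow> complex"
  assumes [measurable]: "g \<in> borel_measurable borel" "\<psi> \<in> borel_measurable borel"
    and g: "integrable lborel (\<lambda>x. (norm (g x))\<^sup>2)"
    and \<psi>: "\<And>x. \<bar>\<psi> x\<bar> \<le> C * indicator (cbox a b) x" and C: "C \<ge> 0"
  shows "integrable (lborel \<Otimes>\<^sub>M lborel) (\<lambda>(x, r). (indicator {0..h} r * \<psi> x) *\<^sub>R g (x + r *\<^sub>R e))"
proof (rule integrableI_bounded)
  show "(\<lambda>(x, r). (indicator {0..h} r * \<psi> x) *\<^sub>R g (x + r *\<^sub>R e)) \<in> borel_measurable (lborel \<Otimes>\<^sub>M lborel)"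
    by measurable
  let ?N = "\<integral>\<^sup>+x. indicator (cbox a b) x + ennreal ((norm (g x))\<^sup>2) \<partial>lborel"
  have fin: "?N < \<infinity>"
  proof -
    have "(\<integral>\<^sup>+x. ennreal ((norm (g x))\<^sup>2) \<partial>lborel) < \<infinity>"
      using g unfolding integrable_iff_bounded by simp
    then show ?thesis
      using emeasure_lborel_cbox_finite[of a b] by (subst nn_integral_add) (auto simp: nn_integral_cmult)
  qed
  have 1: "(\<integral>\<^sup>+x. ennreal (norm ((indicator {0..h} r * \<psi> x) *\<^sub>R g (x + r *\<^sub>R e))) \<partial>lborel)
      \<le> indicator {0..h} r * (ennreal C * ?N)" for r
  proof -
    have "(\<integral>\<^sup>+x. ennreal (norm ((indicator {0..h} r * \<psi> x) *\<^sub>R g (x + r *\<^sub>R e))) \<partial>lborel)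
        \<le> (\<integral>\<^sup>+x. indicator {0..h} r * (ennreal C * (indicator (cbox a b) x + ennreal ((norm (g (x
            + r *\<^sub>R e)))\<^sup>2))) \<partial>lborel)"
    proof (rule nn_integral_mono)
      fix x
      have "norm (\<psi> x *\<^sub>R g (x + r *\<^sub>R e)) \<le> C * (indicator (cbox a b) x + (norm (g (x + r *\<^sub>R e)))\<^sup>2)"
      proof (cases "x \<in> cbox a b")
        case True
        have "norm (\<psi> x *\<^sub>R g (x + r *\<^sub>R e)) \<le> C * norm (g (x + r *\<^sub>R e))"
          using \<psi>[of x] True by (auto intro!: mult_right_mono)
        also have "\<dots> \<le> C * (1 + (norm (g (x + r *\<^sub>R e)))\<^sup>2)" using norm_le_one_plus_sq C
            by (intro mult_left_mono)
        finally show ?thesis using True by simp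
      next
        case False
        then have "\<psi> x = 0" using \<psi>[of x] by simp
        then show ?thesis using C by simp
      qed
      then have "ennreal (norm (\<psi> x *\<^sub>R g (x + r *\<^sub>R e)))
          \<le> ennreal (C * (indicator (cbox a b) x + (norm (g (x + r *\<^sub>R e)))\<^sup>2))"
        by (rule ennreal_leI)
      also have "\<dots> = ennreal C * (indicator (cbox a b) x + ennreal ((norm (g (x + r *\<^sub>R e)))\<^sup>2))"
        using C by (simp add: ennreal_mult ennreal_plus ennreal_indicator)
      finally show "ennreal (norm ((indicator {0..h} r * \<psi> x) *\<^sub>R g (x + r *\<^sub>R e)))
         \<le> indicator {0..h} r * (ennreal C * (indicator (cbox a b) x + ennreal ((norm (g (x + r *\<^sub>R e)))\<^sup>2)))"
        by (auto split: split_indicator)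
    qed
    also have "\<dots> = indicator {0..h} r * (ennreal C * (emeasure lborel (cbox a b)
        + (\<integral>\<^sup>+x. ennreal ((norm (g (x + r *\<^sub>R e)))\<^sup>2) \<partial>lborel)))"
      by (simp add: nn_integral_cmult nn_integral_add)
    also have "(\<integral>\<^sup>+x. ennreal ((norm (g (x + r *\<^sub>R e)))\<^sup>2) \<partial>lborel)
        = (\<integral>\<^sup>+x. ennreal ((norm (g x))\<^sup>2) \<partial>lborel)"
      by (rule lborel_nn_integral_translate) measurable
    finally show ?thesis by (simp add: nn_integral_add)
  qed
  have "(\<integral>\<^sup>+ z. ennreal (norm (case z of (x, r) \<Rightarrow> (indicator {0..h} r * \<psi> x) *\<^sub>R g (x
      + r *\<^sub>R e))) \<partial>(lborel \<Otimes>\<^sub>M lborel))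
    = (\<integral>\<^sup>+ r. \<integral>\<^sup>+x. ennreal (norm ((indicator {0..h} r * \<psi> x) *\<^sub>R g (x + r *\<^sub>R e))) \<partial>lborel \<partial>lborel)"
    by (subst lborel_pair.nn_integral_snd[symmetric]) (simp_all, measurable)
  also have "\<dots> \<le> (\<integral>\<^sup>+ r. indicator {0..h} r * (ennreal C * ?N) \<partial>lborel)"
    by (intro nn_integral_mono 1)
  also have "\<dots> = emeasure lborel {0..h} * (ennreal C * ?N)"
    by (subst nn_integral_multc) auto
  also have "\<dots> < \<infinity>" using fin by (simp add: ennreal_mult_less_top emeasure_lborel_Icc_eq)
  finally show "(\<integral>\<^sup>+ z. ennreal (norm (case z of (x, r) \<Rightarrow> (indicator {0..h} r * \<psi> x) *\<^sub>R g (x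
      + r *\<^sub>R e))) \<partial>(lborel \<Otimes>\<^sub>M lborel)) < \<infinity>" .
qed

text \<open>
  The fundamental theorem of calculus for a weak derivative: for each fixed step \<open>h \<ge> 0\<close>, the difference
  of \<open>u\<close> along a coordinate direction is the integral of the weak derivative, for almost every starting
  point. The exceptional null set depends on \<open>h\<close>. Both sides are compared by testing: the difference
  is moved to the test function, written as an integral of its derivative, and moved back.
\<close>

lemma weak_partial_difference:
  fixes u g :: "real ^ 'n \<Rightarrow> complex"
  assumes [measurable]: "u \<in> borel_measurable borel" "g \<in> borel_measurable borel"
    and u: "integrable lborel (\<lambda>x. (norm (u x))\<^sup>2)" and g: "integrable lborel (\<lambda>x. (norm (g x))\<^sup>2)"
    and wp: "\<And>\<phi>. test_function \<phi> \<Longrightarrow> (LINT x|lborel. partial i \<phi> x *\<^sub>R u x) = - (LINT x|lborel. \<phi> x *\<^sub>R g x)"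
    and h: "0 \<le> h"
  shows "AE x in lborel. u (x + h *\<^sub>R axis i 1) - u x
    = (LINT r|lborel. indicator {0..h} r *\<^sub>R g (x + r *\<^sub>R axis i 1))"
proof -
  let ?e = "axis i 1 :: real ^ 'n"
  let ?G = "\<lambda>x. LINT r|lborel. indicator {0..h} r *\<^sub>R g (x + r *\<^sub>R ?e)"
  let ?f = "\<lambda>x. u (x + h *\<^sub>R ?e) - u x - ?G x"
  have ush: "integrable lborel (\<lambda>x. (norm (u (x + c)))\<^sup>2)" for c
    using u by (subst lborel_integrable_translate[of "\<lambda>x. (norm (u x))\<^sup>2"]) simp_all
  have iu: "integrable lborel (\<lambda>x. \<psi> x *\<^sub>R v x)"
    if v: "v \<in> borel_measurable borel" "integrable lborel (\<lambda>x. (norm (v x))\<^sup>2)"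
      and \<psi>[measurable]: "\<psi> \<in> borel_measurable borel" "\<And>x. \<bar>\<psi> x\<bar> \<le> C * indicator (cbox a b) x" 
    for \<psi> :: "real ^ 'n \<Rightarrow> real" and v :: "real ^ 'n \<Rightarrow> complex" and C a b
  proof (rule Bochner_Integration.integrable_bound)
    show "integrable lborel (\<lambda>x. C *\<^sub>R (indicator (cbox a b) x *\<^sub>R v x))"
      using v by (intro integrable_scaleR_right L2_loc_integrable) auto
    show "AE x in lborel. norm (\<psi> x *\<^sub>R v x) \<le> norm (C *\<^sub>R (indicator (cbox a b) x *\<^sub>R v x))"
    proof (intro always_eventually allI)
      fix x
      have "\<bar>\<psi> x\<bar> * norm (v x) \<le> \<bar>C * indicator (cbox a b) x\<bar> * norm (v x)"
        using \<psi>(2)[of x] by (intro mult_right_mono) auto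
      then show "norm (\<psi> x *\<^sub>R v x) \<le> norm (C *\<^sub>R (indicator (cbox a b) x *\<^sub>R v x))"
        by (simp add: abs_mult mult.assoc)
    qed
  qed (use v in measurable)
  have iG: "integrable lborel (\<lambda>x. \<psi> x *\<^sub>R ?G x)"
    if \<psi>[measurable]: "\<psi> \<in> borel_measurable borel" "\<And>x. \<bar>\<psi> x\<bar> \<le> C * indicator (cbox a b) x" "C \<ge> 0"
    for \<psi> :: "real ^ 'n \<Rightarrow> real" and C a b
  proof -
    have "integrable lborel (\<lambda>x. LINT r|lborel. (indicator {0..h} r * \<psi> x) *\<^sub>R g (x + r *\<^sub>R ?e))"
      using lborel_pair.integrable_fst[OF integrable_pair_shift[OF assms(2) \<psi>(1) g \<psi>(2,3)]] by simp
    moreover have "(LINT r|lborel. (indicator {0..h} r * \<psi> x) *\<^sub>R g (x + r *\<^sub>R ?e)) = \<psi> x *\<^sub>R ?G x" for x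
      by (subst integral_scaleR_right[symmetric]) (simp add: mult.commute)
    ultimately show ?thesis by simp
  qed
  have "AE x in lborel. ?f x = 0"
  proof (rule fundamental_lemma)
    fix a b :: "real ^ 'n"
    have ib: "\<bar>indicator (box a b) x :: real\<bar> \<le> 1 * indicator (cbox a b) x" for x
      using box_subset_cbox[of a b] by (auto split: split_indicator)
    show "integrable lborel (\<lambda>x. indicator (box a b) x *\<^sub>R ?f x)"
      unfolding scaleR_diff_right
      by (intro Bochner_Integration.integrable_diff iu[OF _ _ _ ib] iG[OF _ ib] ush u) auto
  next
    fix \<phi> :: "real ^ 'n \<Rightarrow> real" assume \<phi>: "test_function \<phi>"
    note [measurable] = test_function_cont(3,4)[OF \<phi>]
    obtain C a b where C: "C > 0" and b0: "\<And>x. \<bar>\<phi> x\<bar> \<le> C * indicator (cbox a b) x"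
      and b1: "\<And>x i. \<bar>partial i \<phi> x\<bar> \<le> C * indicator (cbox a b) x"
      using test_function_bound[OF \<phi>] by metis
    have C0: "0 \<le> C" using C by simp
    have i1: "integrable lborel (\<lambda>x. \<phi> x *\<^sub>R u (x + h *\<^sub>R ?e))" by (rule iu[OF _ ush _ b0]) auto
    have i2: "integrable lborel (\<lambda>x. \<phi> x *\<^sub>R u x)" by (rule iu[OF _ u _ b0]) auto
    have i3: "integrable lborel (\<lambda>x. \<phi> x *\<^sub>R ?G x)" by (rule iG[OF _ b0 C0]) auto
    \<comment> \<open>The weak derivative of a translate is the translate of the weak derivative.\<close>
    have wpr: "(LINT x|lborel. partial i \<phi> x *\<^sub>R u (x + r *\<^sub>R ?e))
        = - (LINT x|lborel. \<phi> x *\<^sub>R g (x + r *\<^sub>R ?e))" for r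
    proof -
      have "(LINT x|lborel. partial i \<phi> x *\<^sub>R u (x + r *\<^sub>R ?e)) =
        (LINT x|lborel. partial i \<phi> (x - r *\<^sub>R ?e) *\<^sub>R u x)"
        by (subst lborel_integral_translate[of _ "r *\<^sub>R ?e", symmetric]) simp_all
      also have "\<dots> = (LINT x|lborel. partial i (\<lambda>x. \<phi> (x + - (r *\<^sub>R ?e))) x *\<^sub>R u x)"
        by (simp only: partial_translate) simp
      also have "\<dots> = - (LINT x|lborel. \<phi> (x + - (r *\<^sub>R ?e)) *\<^sub>R g x)"
        by (rule wp[OF test_function_translate[OF \<phi>]])
      also have "(LINT x|lborel. \<phi> (x + - (r *\<^sub>R ?e)) *\<^sub>R g x) = (LINT x|lborel. \<phi> x *\<^sub>R g (x + r *\<^sub>R ?e))"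
        by (subst lborel_integral_translate[of _ "r *\<^sub>R ?e", symmetric]) simp_all
      finally show ?thesis .
    qed
    have ftc: "(LINT r|lborel. indicator {0..h} r *\<^sub>R partial i \<phi> (x - r *\<^sub>R ?e)) = \<phi> x - \<phi> (x - h *\<^sub>R ?e)"
        for x
    proof -
      have d: "((\<lambda>r. - \<phi> (x - r *\<^sub>R ?e)) has_vector_derivative partial i \<phi> (x
          - r *\<^sub>R ?e)) (at r within {0..h})" for r
      proof -
        have "((\<lambda>r. x - r *\<^sub>R ?e) has_derivative (\<lambda>s. - (s *\<^sub>R ?e))) (at r within {0..h})"
          by (auto intro!: derivative_eq_intros)
        moreover have D: "(\<phi> has_derivative frechet_derivative \<phi> (at (x - r *\<^sub>R ?e))) (at (x - r *\<^sub>R ?e))"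
          using test_function_cont(5)[OF \<phi>] frechet_derivative_works by blast
        ultimately have "((\<lambda>r. \<phi> (x - r *\<^sub>R ?e))
            has_derivative (\<lambda>s. frechet_derivative \<phi> (at (x
            - r *\<^sub>R ?e)) (- (s *\<^sub>R ?e)))) (at r within {0..h})"
          by (rule has_derivative_compose)
        moreover have "frechet_derivative \<phi> (at (x - r *\<^sub>R ?e)) (- (s *\<^sub>R ?e))
            = - (s * partial i \<phi> (x - r *\<^sub>R ?e))" for s
          using linear_frechet_derivative[OF test_function_cont(5)[OF \<phi>]]
          by (simp add: partial_def linear_neg linear_scale)
        ultimately have "((\<lambda>r. - \<phi> (x - r *\<^sub>R ?e))
            has_derivative (\<lambda>s. - (- (s * partial i \<phi> (x - r *\<^sub>R ?e))))) (at r within {0..h})"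
          by (intro has_derivative_minus) simp
        then show ?thesis by (simp add: has_vector_derivative_def)
      qed
      have "continuous_on {0..h} (\<lambda>r. partial i \<phi> (x - r *\<^sub>R ?e))"
        by (rule continuous_on_compose2[OF test_function_cont(2)[OF \<phi>]]) (auto intro!: continuous_intros)
      from integral_FTC_Icc[OF h d this] show ?thesis by simp
    qed
    have "(LINT x|lborel. \<phi> x *\<^sub>R ?G x)
       = (LINT x|lborel. LINT r|lborel. (indicator {0..h} r * \<phi> x) *\<^sub>R g (x + r *\<^sub>R ?e))"
      by (intro Bochner_Integration.integral_cong refl, subst integral_scaleR_right[symmetric]) (simp add:
          mult.commute)
    also have "\<dots> = (LINT r|lborel. LINT x|lborel. (indicator {0..h} r * \<phi> x) *\<^sub>R g (x + r *\<^sub>R ?e))"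
      by (rule lborel_pair.Fubini_integral[symmetric], rule integrable_pair_shift[OF assms(2) _ g b0 C0]) simp
    also have "\<dots> = (LINT r|lborel. - (LINT x|lborel. (indicator {0..h} r * partial i \<phi> x) *\<^sub>R u (x
        + r *\<^sub>R ?e)))"
    proof -
      have "(LINT x|lborel. (indicator {0..h} r * \<phi> x) *\<^sub>R g (x + r *\<^sub>R ?e)) =
          - (LINT x|lborel. (indicator {0..h} r * partial i \<phi> x) *\<^sub>R u (x + r *\<^sub>R ?e))" for r
        using wpr[of r] by (simp flip: scaleR_scaleR)
      then show ?thesis by simp
    qed
    also have "\<dots> = - (LINT r|lborel. LINT x|lborel. (indicator {0..h} r * partial i \<phi> (x
        - r *\<^sub>R ?e)) *\<^sub>R u x)"
    proof -
      have "(LINT x|lborel. (indicator {0..h} r * partial i \<phi> x) *\<^sub>R u (x + r *\<^sub>R ?e)) =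
          (LINT x|lborel. (indicator {0..h} r * partial i \<phi> (x - r *\<^sub>R ?e)) *\<^sub>R u x)" for r
        by (subst lborel_integral_translate[of _ "r *\<^sub>R ?e", symmetric]) simp_all
      then show ?thesis by simp
    qed
    also have "\<dots> = - (LINT x|lborel. LINT r|lborel. (indicator {0..h} r * partial i \<phi> (x
        - r *\<^sub>R ?e)) *\<^sub>R u x)"
    proof -
      let ?b = "b + h *\<^sub>R ?e"
      \<comment> \<open>For \<open>r \<in> [0, h]\<close> the translated support stays in the enlarged box \<open>[a, b + h e]\<close>.\<close>
      let ?F = "\<lambda>(x, r). (indicator {0..h} r * (C * indicator (cbox a ?b) x)) *\<^sub>R u (x + r *\<^sub>R 0)"
      have "integrable (lborel \<Otimes>\<^sub>M lborel) (\<lambda>(x, r). (indicator {0..h} r * partial i \<phi> (x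
          - r *\<^sub>R ?e)) *\<^sub>R u x)"
      proof (rule Bochner_Integration.integrable_bound)
        show "integrable (lborel \<Otimes>\<^sub>M lborel) ?F"
          by (rule integrable_pair_shift[OF assms(1) _ u, of _ C a ?b]) (use C in auto)
        show "(\<lambda>(x, r). (indicator {0..h} r * partial i \<phi> (x
            - r *\<^sub>R ?e)) *\<^sub>R u x) \<in> borel_measurable (lborel \<Otimes>\<^sub>M lborel)"
          by measurable
        have "norm ((indicator {0..h} r * partial i \<phi> (x - r *\<^sub>R ?e)) *\<^sub>R u x) \<le> norm (?F (x, r))" for x r
        proof (cases "r \<in> {0..h} \<and> x - r *\<^sub>R ?e \<in> cbox a b")
          case True
          then have "x \<in> cbox a ?b"
            unfolding mem_box_cart
          proof (intro allI)
            fix j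
            have "a $ j \<le> x $ j - r * axis i 1 $ j" "x $ j - r * axis i 1 $ j \<le> b $ j" "0 \<le> r" "r \<le> h"
              using True by (auto simp: mem_box_cart)
            then show "a $ j \<le> x $ j \<and> x $ j \<le> (b + h *\<^sub>R ?e) $ j"
              by (cases "j = i") (auto simp: axis_def)
          qed
          then show ?thesis using True b1[of i "x - r *\<^sub>R ?e"] C by (auto intro!: mult_right_mono)
        next
          case False
          then have *: "indicator {0..h} r * partial i \<phi> (x - r *\<^sub>R ?e) = 0"
            using b1[of i "x - r *\<^sub>R ?e"] by (auto split: split_indicator)
          show ?thesis by (subst *) simp
        qed
        then show "AE z in lborel \<Otimes>\<^sub>M lborel. norm (case z of (x, r) \<Rightarrow> (indicator {0..h} r * partial i \<phi> (x
            - r *\<^sub>R ?e)) *\<^sub>R u x) \<le> norm (?F z)"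
          by (intro always_eventually allI) (metis (no_types, lifting) case_prod_conv surj_pair)
      qed
      from lborel_pair.Fubini_integral[OF this] show ?thesis by simp
    qed
    also have "\<dots> = - (LINT x|lborel. (\<phi> x - \<phi> (x - h *\<^sub>R ?e)) *\<^sub>R u x)"
    proof -
      have "(LINT r|lborel. (indicator {0..h} r * partial i \<phi> (x - r *\<^sub>R ?e)) *\<^sub>R u x)
          = (\<phi> x - \<phi> (x - h *\<^sub>R ?e)) *\<^sub>R u x" for x
      proof -
        have "integrable lborel (\<lambda>r. indicator {0..h} r *\<^sub>R partial i \<phi> (x - r *\<^sub>R ?e))"
          by (intro borel_integrable_compact continuous_on_compose2[OF test_function_cont(2)[OF \<phi>]])
            (auto intro!: continuous_intros)
        then show ?thesis using ftc[of x] by (subst integral_scaleR_left) simp_all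
      qed
      then show ?thesis by simp
    qed
    also have "\<dots> = (LINT x|lborel. \<phi> (x - h *\<^sub>R ?e) *\<^sub>R u x) - (LINT x|lborel. \<phi> x *\<^sub>R u x)"
    proof -
      have "integrable lborel (\<lambda>x. \<phi> (x - h *\<^sub>R ?e) *\<^sub>R u x)"
        using i1 by (subst (asm) lborel_integrable_translate[of _ "- h *\<^sub>R ?e", symmetric]) simp_all
      then show ?thesis using i2 by (simp add: scaleR_diff_left)
    qed
    also have "(LINT x|lborel. \<phi> (x - h *\<^sub>R ?e) *\<^sub>R u x) = (LINT x|lborel. \<phi> x *\<^sub>R u (x + h *\<^sub>R ?e))"
      by (subst lborel_integral_translate[of _ "h *\<^sub>R ?e", symmetric]) simp_all
    finally have "(LINT x|lborel. \<phi> x *\<^sub>R ?G x) =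
      (LINT x|lborel. \<phi> x *\<^sub>R u (x + h *\<^sub>R ?e)) - (LINT x|lborel. \<phi> x *\<^sub>R u x)" .
    then show "(LINT x|lborel. \<phi> x *\<^sub>R ?f x) = 0"
      using i1 i2 i3 by (simp add: scaleR_diff_right)
  qed
  then show ?thesis by eventually_elim simp
qed

section \<open>Exchanging coordinates\<close>

text \<open>
  The assumption \<open>inner\<close> says that \<open>T\<close> is its own adjoint on the basis. Together with \<open>bij\<close> it makes \<open>T\<close>
  an involution permuting the coordinates, which is all that the exchange maps below need.
\<close>

lemma lborel_distr_basis_permutation:
  fixes T :: "'a::euclidean_space \<Rightarrow> 'a"
  assumes [measurable]: "T \<in> borel_measurable borel"
    and inner: "\<And>x b. b \<in> Basis \<Longrightarrow> T x \<bullet> b = x \<bullet> T b"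
    and bij: "bij_betw T Basis Basis"
  shows "distr lborel borel T = lborel"
proof (rule lborel_eqI[symmetric])
  fix l u :: 'a assume lu: "\<And>b. b \<in> Basis \<Longrightarrow> l \<bullet> b \<le> u \<bullet> b"
  define P where "P v = (\<Sum>b\<in>Basis. (v \<bullet> b) *\<^sub>R T b)" for v :: 'a
  have TB: "T b \<in> Basis" if "b \<in> Basis" for b using bij that by (auto simp: bij_betw_def)
  have P: "P v \<bullet> T b = v \<bullet> b" if b: "b \<in> Basis" for v b
  proof -
    have "P v \<bullet> T b = (\<Sum>c\<in>Basis. (v \<bullet> c) * (if c = b then 1 else 0))"
      unfolding P_def inner_sum_left inner_scaleR_left
      using b TB bij by (intro sum.cong refl) (auto simp: inner_Basis bij_betw_def inj_on_def)
    also have "\<dots> = (\<Sum>c\<in>Basis. if c = b then v \<bullet> c else 0)" by (intro sum.cong) auto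
    finally show ?thesis using b by simp
  qed
  have "T -` box l u = box (P l) (P u)"
  proof -
    have "x \<in> T -` box l u \<longleftrightarrow> (\<forall>b\<in>T ` Basis. P l \<bullet> b < x \<bullet> b \<and> x \<bullet> b < P u \<bullet> b)" for x
      by (simp add: mem_box inner P)
    moreover have "T ` Basis = Basis" using bij by (simp add: bij_betw_def)
    ultimately show ?thesis by (auto simp: mem_box)
  qed
  then have "emeasure (distr lborel borel T) (box l u) = emeasure lborel (box (P l) (P u))"
    by (simp add: emeasure_distr)
  also have "\<dots> = (\<Prod>b\<in>Basis. (P u - P l) \<bullet> b)"
  proof (rule emeasure_lborel_box)
    fix b :: 'a assume "b \<in> Basis"
    then obtain c where "c \<in> Basis" "b = T c" using bij by (auto simp: bij_betw_def)
    then show "P l \<bullet> b \<le> P u \<bullet> b" using lu by (simp add: P)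
  qed
  also have "(\<Prod>b\<in>Basis. (P u - P l) \<bullet> b) = (\<Prod>b\<in>Basis. (P u - P l) \<bullet> T b)"
    by (rule prod.reindex_bij_betw[OF bij, symmetric])
  also have "\<dots> = (\<Prod>b\<in>Basis. (u - l) \<bullet> b)" by (simp add: inner_diff_left P)
  finally show "emeasure (distr lborel borel T) (box l u) = (\<Prod>b\<in>Basis. (u - l) \<bullet> b)" .
qed simp

text \<open>
  The vector \<open>mix J x y\<close> has the coordinates of \<open>y\<close> at the indices in \<open>J\<close> and those of \<open>x\<close> elsewhere;
  \<open>upd x i t\<close> is \<open>x\<close> with its \<open>i\<close>-th coordinate replaced by \<open>t\<close>.
\<close>

definition mix :: "'n set \<Rightarrow> real ^ 'n \<Rightarrow> real ^ 'n \<Rightarrow> real ^ 'n" where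
  "mix J x y = (\<chi> j. if j \<in> J then y $ j else x $ j)"

definition upd :: "real ^ 'n \<Rightarrow> 'n \<Rightarrow> real \<Rightarrow> real ^ 'n" where
  "upd x i t = (\<chi> j. if j = i then t else x $ j)"

lemma mix_nth [simp]: "mix J x y $ j = (if j \<in> J then y $ j else x $ j)"
  by (simp add: mix_def)

lemma upd_nth [simp]: "upd x i t $ j = (if j = i then t else x $ j)"
  by (simp add: upd_def)

lemma mix_singleton: "mix {i} x y = upd x i (y $ i)"
  by (simp add: vec_eq_iff)

lemma upd_eq_add: "upd x i t = x + (t - x $ i) *\<^sub>R axis i 1"
  by (simp add: vec_eq_iff axis_def)


lemma measurable_vec_nth [measurable]: "(\<lambda>x::real ^ 'n. x $ i) \<in> borel_measurable borel"
  by (intro borel_measurable_continuous_onI continuous_intros)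

lemma measurable_mix [measurable (raw)]:
  assumes [measurable]: "f \<in> borel_measurable M" "g \<in> borel_measurable M"
  shows "(\<lambda>z. mix J (f z) (g z) :: real ^ 'n) \<in> borel_measurable M"
proof -
  have "mix J x y = x + (\<Sum>j\<in>J. (y $ j - x $ j) *\<^sub>R axis j 1)" for x y :: "real ^ 'n"
    by (simp add: vec_eq_iff axis_def if_distrib sum.delta cong: if_cong)
  then show ?thesis by simp
qed

lemma measurable_upd [measurable (raw)]:
  assumes [measurable]: "f \<in> borel_measurable M" "g \<in> borel_measurable M"
  shows "(\<lambda>z. upd (f z) i (g z) :: real ^ 'n) \<in> borel_measurable M"
  unfolding upd_eq_add by measurable

text \<open>
  Two involutions that preserve Lebesgue measure: \<open>swap_coords J\<close> exchanges the coordinates in \<open>J\<close> of two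
  vectors, and \<open>swap_coord i\<close> exchanges the \<open>i\<close>-th coordinate of a vector with a real number. They
  replace the decomposition of the Lebesgue integral into iterated one-dimensional integrals.
\<close>

definition swap_coords :: "'n set \<Rightarrow> (real ^ 'n) \<times> (real ^ 'n) \<Rightarrow> (real ^ 'n) \<times> (real ^ 'n)" where
  "swap_coords J z = (mix J (fst z) (snd z), mix J (snd z) (fst z))"

definition swap_coord :: "'n \<Rightarrow> (real ^ 'n) \<times> real \<Rightarrow> (real ^ 'n) \<times> real" where
  "swap_coord i z = (upd (fst z) i (snd z), fst z $ i)"

lemma Basis_vec_real: "Basis = range (\<lambda>i. axis i 1 :: real ^ 'n)"
  by (auto simp: Basis_vec_def)

lemma measurable_swap_coords: "swap_coords J \<in> borel_measurable borel"
proof -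
  have "swap_coords J \<in> borel \<Otimes>\<^sub>M borel \<rightarrow>\<^sub>M borel \<Otimes>\<^sub>M borel"
    unfolding swap_coords_def[abs_def] by measurable
  then show ?thesis by (simp only: borel_prod)
qed

lemma measurable_swap_coord: "swap_coord i \<in> borel_measurable borel"
proof -
  have "swap_coord i \<in> borel \<Otimes>\<^sub>M borel \<rightarrow>\<^sub>M borel \<Otimes>\<^sub>M borel"
    unfolding swap_coord_def[abs_def] by measurable
  then show ?thesis by (simp only: borel_prod)
qed

lemma lborel_distr_swap_coords:
  "distr lborel borel (swap_coords J) = (lborel :: ((real ^ 'n) \<times> (real ^ 'n)) measure)"
proof (rule lborel_distr_basis_permutation)
  show "swap_coords J \<in> borel_measurable borel" by (rule measurable_swap_coords)
  have T1: "swap_coords J (axis j 1, 0) = (if j \<in> J then (0, axis j 1) else (axis j 1, 0))"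
    and T2: "swap_coords J (0, axis j 1) = (if j \<in> J then (axis j 1, 0) else (0, axis j 1))" for j
    by (auto simp: swap_coords_def vec_eq_iff axis_def)
  have invol: "swap_coords J (swap_coords J z) = z" for z
    by (auto simp: swap_coords_def vec_eq_iff prod_eq_iff)
  have maps: "swap_coords J b \<in> Basis" if "b \<in> Basis" for b
    using that by (auto simp: Basis_prod_def Basis_vec_real T1 T2)
  show "bij_betw (swap_coords J) Basis Basis"
    by (rule bij_betw_byWitness[where f'="swap_coords J"]) (auto simp: invol maps)
  show "swap_coords J x \<bullet> b = x \<bullet> swap_coords J b" if "b \<in> Basis" for x b
  proof -
    from that consider j where "b = (axis j 1, 0)" | j where "b = (0, axis j 1)"
      by (auto simp: Basis_prod_def Basis_vec_real)
    then show ?thesis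
      by cases (simp_all add: T1 T2, simp_all add: swap_coords_def inner_axis inner_prod_def)
  qed
qed

lemma lborel_distr_swap_coord:
  "distr lborel borel (swap_coord i) = (lborel :: ((real ^ 'n) \<times> real) measure)"
proof (rule lborel_distr_basis_permutation)
  show "swap_coord i \<in> borel_measurable borel" by (rule measurable_swap_coord)
  have T1: "swap_coord i (axis j 1, 0) = (if j = i then (0, 1) else (axis j 1, 0))"
    and T2: "swap_coord i (0, 1) = (axis i 1, 0)" for j
    by (auto simp: swap_coord_def vec_eq_iff axis_def)
  have invol: "swap_coord i (swap_coord i z) = z" for z
    by (auto simp: swap_coord_def vec_eq_iff prod_eq_iff)
  have maps: "swap_coord i b \<in> Basis" if "b \<in> Basis" for b
    using that by (auto simp: Basis_prod_def Basis_vec_real T1 T2 split: if_splits)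
  show "bij_betw (swap_coord i) Basis Basis"
    by (rule bij_betw_byWitness[where f'="swap_coord i"]) (auto simp: invol maps)
  show "swap_coord i x \<bullet> b = x \<bullet> swap_coord i b" if "b \<in> Basis" for x b
  proof -
    from that consider j where "b = (axis j 1, 0)" | "b = (0, 1)"
      by (auto simp: Basis_prod_def Basis_vec_real)
    then show ?thesis
      by cases (simp_all add: T1 T2, simp_all add: swap_coord_def inner_axis inner_prod_def)
  qed
qed

lemma nn_integral_swap_coord:
  fixes F :: "real ^ 'n \<Rightarrow> real \<Rightarrow> ennreal"
  assumes [measurable]: "case_prod F \<in> borel_measurable (lborel \<Otimes>\<^sub>M lborel)"
  shows "(\<integral>\<^sup>+x. \<integral>\<^sup>+t. F (upd x i t) (x $ i) \<partial>lborel \<partial>lborel) = (\<integral>\<^sup>+x. \<integral>\<^sup>+t. F x t \<partial>lborel \<partial>lborel)"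
proof -
  have F: "case_prod F \<in> borel_measurable borel"
    using assms by (simp add: lborel_prod)
  note T = measurable_swap_coord[of i]
  have "(\<integral>\<^sup>+x. \<integral>\<^sup>+t. F x t \<partial>lborel \<partial>lborel) = (\<integral>\<^sup>+z. case_prod F z \<partial>lborel)"
    by (subst lborel.nn_integral_fst[of "case_prod F", simplified, OF assms]) (simp add: lborel_prod)
  also have "\<dots> = (\<integral>\<^sup>+z. case_prod F (swap_coord i z) \<partial>lborel)"
    by (subst lborel_distr_swap_coord[of i, symmetric], subst nn_integral_distr) (use F T in auto)
  also have "\<dots> = (\<integral>\<^sup>+x. \<integral>\<^sup>+t. case_prod F (swap_coord i (x, t)) \<partial>lborel \<partial>lborel)"
  proof -
    have "(\<lambda>z. case_prod F (swap_coord i z)) \<in> borel_measurable (lborel \<Otimes>\<^sub>M lborel)"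
      using measurable_compose[OF T F] by (simp add: lborel_prod)
    from lborel.nn_integral_fst[OF this] show ?thesis by (simp add: lborel_prod)
  qed
  finally show ?thesis by (simp add: swap_coord_def)
qed

section \<open>Variation of a function in one coordinate\<close>

lemma upd_in_box_iff: "upd x i t \<in> box a b \<and> x $ i \<in> {a $ i<..<b $ i} \<longleftrightarrow> x \<in> box a b \<and> t \<in> {a $ i<..<b $ i}"
  by (auto simp: mem_box_cart split: if_splits)

text \<open>
  The marginal of Lebesgue measure on a box, with the volumes multiplied out so that nothing is divided.
\<close>

lemma nn_integral_box_coord:
  fixes a b :: "real ^ 'n"
  assumes [measurable]: "\<phi> \<in> borel_measurable borel"
  shows "emeasure lborel {a $ i<..<b $ i} * (\<integral>\<^sup>+y. indicator (box a b) y * \<phi> (y $ i) \<partial>lborel)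
    = emeasure lborel (box a b) * (\<integral>\<^sup>+t. indicator {a $ i<..<b $ i} t * \<phi> t \<partial>lborel)"
proof -
  let ?I = "{a $ i<..<b $ i}"
  let ?F = "\<lambda>y t. indicator ?I t * (indicator (box a b) y * \<phi> (y $ i)) :: ennreal"
  have "(\<integral>\<^sup>+y. \<integral>\<^sup>+t. ?F (upd y i t) (y $ i) \<partial>lborel \<partial>lborel) = (\<integral>\<^sup>+y. \<integral>\<^sup>+t. ?F y t \<partial>lborel \<partial>lborel)"
    by (rule nn_integral_swap_coord) measurable
  moreover have "?F (upd y i t) (y $ i) = indicator (box a b) y * (indicator ?I t * \<phi> t)" for y t
    using upd_in_box_iff[of y i t a b] by (auto split: split_indicator)
  ultimately have "(\<integral>\<^sup>+y. \<integral>\<^sup>+t. indicator (box a b) y * (indicator ?I t * \<phi> t) \<partial>lborel \<partial>lborel)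
      = (\<integral>\<^sup>+y. \<integral>\<^sup>+t. ?F y t \<partial>lborel \<partial>lborel)"
    by (simp only:)
  then show ?thesis
    by (simp add: nn_integral_cmult nn_integral_multc)
qed

lemma Cauchy_Schwarz_interval:
  fixes G :: "real \<Rightarrow> complex"
  assumes [measurable]: "G \<in> borel_measurable borel" and h: "0 \<le> h"
  shows "ennreal ((norm (LINT r|lborel. indicator {0..h} r *\<^sub>R G r))\<^sup>2)
    \<le> ennreal h * (\<integral>\<^sup>+r. indicator {0..h} r * ennreal ((norm (G r))\<^sup>2) \<partial>lborel)"
proof (cases "integrable lborel (\<lambda>r. indicator {0..h} r *\<^sub>R G r)")
  case True
  have "ennreal (norm (LINT r|lborel. indicator {0..h} r *\<^sub>R G r))
      \<le> (\<integral>\<^sup>+r. ennreal (norm (indicator {0..h} r *\<^sub>R G r)) \<partial>lborel)"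
    by (rule integral_norm_bound_ennreal[OF True])
  also have "\<dots> = (\<integral>\<^sup>+r. indicator {0..h} r * (indicator {0..h} r * ennreal (norm (G r))) \<partial>lborel)"
    by (intro nn_integral_cong) (auto split: split_indicator)
  finally have "(ennreal (norm (LINT r|lborel. indicator {0..h} r *\<^sub>R G r)))\<^sup>2
      \<le> (\<integral>\<^sup>+r. indicator {0..h} r * (indicator {0..h} r * ennreal (norm (G r))) \<partial>lborel)\<^sup>2"
    by (rule power_mono) simp
  also have "\<dots> \<le> (\<integral>\<^sup>+r. (indicator {0..h} r)\<^sup>2 \<partial>lborel) * (\<integral>\<^sup>+r. (indicator {0..h} r * ennreal (norm (G r)))\<^sup>2
      \<partial>lborel)"
    by (rule Cauchy_Schwarz_nn_integral) measurable
  also have "(\<lambda>r. (indicator {0..h} r)\<^sup>2 :: ennreal) = indicator {0..h}"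
    by (auto split: split_indicator)
  also have "(\<lambda>r. (indicator {0..h} r * ennreal (norm (G r)))\<^sup>2)
      = (\<lambda>r. indicator {0..h} r * ennreal ((norm (G r))\<^sup>2))"
    by (auto split: split_indicator simp: ennreal_power)
  finally show ?thesis using h by (simp add: ennreal_power)
next
  case False
  then show ?thesis by (simp add: not_integrable_integral_eq)
qed

lemma nn_integral_abs_diff:
  fixes a b r :: real
  assumes "a \<le> r" "r \<le> b"
  shows "(\<integral>\<^sup>+t. indicator {a<..<b} t * ennreal \<bar>t - r\<bar> \<partial>lborel) \<le> ennreal (((r - a)\<^sup>2 + (b - r)\<^sup>2) / 2)"
proof -
  have 1: "(\<integral>\<^sup>+t. ennreal (r - t) * indicator {a..r} t \<partial>lborel) = ennreal (- (r - r)\<^sup>2 / 2 - - (r - a)\<^sup>2 / 2)"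
    by (rule nn_integral_FTC_Icc) (use assms in \<open>auto intro!: derivative_eq_intros simp: field_simps\<close>)
  have 2: "(\<integral>\<^sup>+t. ennreal (t - r) * indicator {r..b} t \<partial>lborel) = ennreal ((b - r)\<^sup>2 / 2 - (r - r)\<^sup>2 / 2)"
    by (rule nn_integral_FTC_Icc) (use assms in \<open>auto intro!: derivative_eq_intros\<close>)
  have "(\<integral>\<^sup>+t. indicator {a<..<b} t * ennreal \<bar>t - r\<bar> \<partial>lborel)
      \<le> (\<integral>\<^sup>+t. ennreal (r - t) * indicator {a..r} t + ennreal (t - r) * indicator {r..b} t \<partial>lborel)"
    by (intro nn_integral_mono) (auto split: split_indicator simp: abs_if)
  also have "\<dots> = ennreal ((r - a)\<^sup>2 / 2) + ennreal ((b - r)\<^sup>2 / 2)"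
    by (subst nn_integral_add) (simp_all add: 1 2)
  also have "\<dots> = ennreal (((r - a)\<^sup>2 + (b - r)\<^sup>2) / 2)"
    by (subst ennreal_plus[symmetric]) (simp_all add: add_divide_distrib)
  finally show ?thesis .
qed

lemma nn_integral_abs_diff2:
  fixes a b :: real
  assumes "a \<le> b"
  shows "(\<integral>\<^sup>+r. indicator {a<..<b} r * (\<integral>\<^sup>+t. indicator {a<..<b} t * ennreal \<bar>t - r\<bar> \<partial>lborel) \<partial>lborel)
    \<le> ennreal ((b - a) ^ 3 / 3)"
proof -
  have "(\<integral>\<^sup>+r. indicator {a<..<b} r * (\<integral>\<^sup>+t. indicator {a<..<b} t * ennreal \<bar>t - r\<bar> \<partial>lborel) \<partial>lborel)
      \<le> (\<integral>\<^sup>+r. ennreal (((r - a)\<^sup>2 + (b - r)\<^sup>2) / 2) * indicator {a..b} r \<partial>lborel)"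
    using nn_integral_abs_diff[of a _ b] by (intro nn_integral_mono) (auto split: split_indicator)
  also have "\<dots> = ennreal (((b - a) ^ 3 - (b - b) ^ 3) / 6 - ((a - a) ^ 3 - (b - a) ^ 3) / 6)"
    by (rule nn_integral_FTC_Icc) (use assms in \<open>auto intro!: derivative_eq_intros simp: field_simps\<close>)
  finally show ?thesis by (simp add: field_simps)
qed

text \<open>
  Resampling one coordinate: on a box, the mean square change of \<open>u\<close> when its \<open>i\<close>-th coordinate is replaced
  by an independent one is at most a third of the squared side length times the mean of the squared
  weak derivative. By Cauchy--Schwarz the squared difference between two points on a line in
  direction \<open>i\<close> is at most their distance times the integral \<open>\<Gamma>\<close> of the squared derivative over the segment of
  this line in the box; the factor \<open>1/3\<close> is the mean distance of two uniform points of \<open>[0, 1]\<close>.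
\<close>

lemma coordinate_variation:
  fixes u g :: "real ^ 'n \<Rightarrow> complex"
  assumes [measurable]: "u \<in> borel_measurable borel" "g \<in> borel_measurable borel"
    and u: "integrable lborel (\<lambda>x. (norm (u x))\<^sup>2)" and g: "integrable lborel (\<lambda>x. (norm (g x))\<^sup>2)"
    and wp: "\<And>\<phi>. test_function \<phi> \<Longrightarrow> (LINT x|lborel. partial i \<phi> x *\<^sub>R u x) = - (LINT x|lborel. \<phi> x *\<^sub>R g x)"
    and ab: "a $ i < b $ i"
  shows "(\<integral>\<^sup>+x. \<integral>\<^sup>+y. indicator (box a b) x * indicator (box a b) y * ennreal ((norm (u x
      - u (upd x i (y $ i))))\<^sup>2) \<partial>lborel \<partial>lborel)
     \<le> ennreal ((b $ i - a $ i)\<^sup>2 / 3) * emeasure lborel (box a b)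
        * (\<integral>\<^sup>+x. indicator (box a b) x * ennreal ((norm (g x))\<^sup>2) \<partial>lborel)"
proof -
  let ?e = "axis i 1 :: real ^ 'n" and ?Q = "box a b" and ?I = "{a $ i<..<b $ i}"
  let ?L = "b $ i - a $ i"
  define \<Gamma> where "\<Gamma> x = (\<integral>\<^sup>+r. indicator ?I r * ennreal ((norm (g (upd x i r)))\<^sup>2) \<partial>lborel)" for x
  define K where "K s = (\<integral>\<^sup>+t. indicator ?I t * ennreal \<bar>t - s\<bar> \<partial>lborel)" for s
  have [measurable]: "\<Gamma> \<in> borel_measurable borel" unfolding \<Gamma>_def[abs_def] by measurable
  have [measurable]: "K \<in> borel_measurable borel" unfolding K_def[abs_def] by measurable
  have \<Gamma>_upd: "\<Gamma> (upd x i t) = \<Gamma> x" for x t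
  proof -
    have "upd (upd x i t) i r = upd x i r" for r by (simp add: vec_eq_iff)
    then show ?thesis by (simp add: \<Gamma>_def)
  qed
  \<comment> \<open>\<open>\<Gamma> x\<close> depends only on the line through \<open>x\<close> in direction \<open>i\<close>, not on \<open>x $ i\<close>;
      this also gives the case \<open>h < 0\<close> below.\<close>
  have pos: "ennreal ((norm (u (x + h *\<^sub>R ?e) - u x))\<^sup>2) \<le> ennreal h * \<Gamma> x"
    if eq: "u (x + h *\<^sub>R ?e) - u x = (LINT r|lborel. indicator {0..h} r *\<^sub>R g (x + r *\<^sub>R ?e))"
      and h: "0 \<le> h" and x: "x \<in> ?Q" "x + h *\<^sub>R ?e \<in> ?Q" for x h
  proof -
    have "ennreal ((norm (u (x + h *\<^sub>R ?e) - u x))\<^sup>2)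
        \<le> ennreal h * (\<integral>\<^sup>+r. indicator {0..h} r * ennreal ((norm (g (x + r *\<^sub>R ?e)))\<^sup>2) \<partial>lborel)"
      unfolding eq by (rule Cauchy_Schwarz_interval[OF _ h]) measurable
    also have "(\<integral>\<^sup>+r. indicator {0..h} r * ennreal ((norm (g (x + r *\<^sub>R ?e)))\<^sup>2) \<partial>lborel)
        \<le> (\<integral>\<^sup>+r. indicator ?I (r + x $ i) * ennreal ((norm (g (upd x i (r + x $ i))))\<^sup>2) \<partial>lborel)"
    proof (intro nn_integral_mono)
      fix r
      have "a $ i < x $ i" "x $ i + h < b $ i" using x by (auto simp: mem_box_cart axis_def split: if_splits)
      then show "indicator {0..h} r * ennreal ((norm (g (x + r *\<^sub>R ?e)))\<^sup>2)
        \<le> indicator ?I (r + x $ i) * ennreal ((norm (g (upd x i (r + x $ i))))\<^sup>2)"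
        by (auto simp: upd_eq_add split: split_indicator)
    qed
    also have "\<dots> = \<Gamma> x" unfolding \<Gamma>_def
      by (rule lborel_nn_integral_translate) measurable
    finally show ?thesis by (simp add: mult_left_mono)
  qed
  let ?P = "\<lambda>x h. x \<in> ?Q \<and> x + h *\<^sub>R ?e \<in> ?Q \<longrightarrow>
      ennreal ((norm (u (x + h *\<^sub>R ?e) - u x))\<^sup>2) \<le> ennreal \<bar>h\<bar> * \<Gamma> x"
  have P: "AE x in lborel. ?P x h" for h
  proof (cases "0 \<le> h")
    case True
    have "AE x in lborel. u (x + h *\<^sub>R ?e) - u x
        = (LINT r|lborel. indicator {0..h} r *\<^sub>R g (x + r *\<^sub>R ?e))"
      by (rule weak_partial_difference[OF assms(1,2) u g wp True])
    then show ?thesis by eventually_elim (use pos True in auto)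
  next
    case False
    then have h: "0 \<le> - h" by simp
    have "AE x in lborel. u (x + (- h) *\<^sub>R ?e) - u x
        = (LINT r|lborel. indicator {0..- h} r *\<^sub>R g (x + r *\<^sub>R ?e))"
      by (rule weak_partial_difference[OF assms(1,2) u g wp h])
    from AE_lborel_translate[OF this, of "h *\<^sub>R ?e"] show ?thesis
    proof eventually_elim
      case (elim x)
      show ?case
      proof (intro impI)
        assume x: "x \<in> ?Q \<and> x + h *\<^sub>R ?e \<in> ?Q"
        have "x + h *\<^sub>R ?e = upd x i (x $ i + h)" by (simp add: upd_eq_add)
        then have "\<Gamma> (x + h *\<^sub>R ?e) = \<Gamma> x" by (simp add: \<Gamma>_upd)
        moreover have "ennreal ((norm (u (x + h *\<^sub>R ?e + (- h) *\<^sub>R ?e) - u (x + h *\<^sub>R ?e)))\<^sup>2)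
            \<le> ennreal (- h) * \<Gamma> (x + h *\<^sub>R ?e)"
          using x by (intro pos[OF elim h]) simp_all
        ultimately show "ennreal ((norm (u (x + h *\<^sub>R ?e) - u x))\<^sup>2) \<le> ennreal \<bar>h\<bar> * \<Gamma> x"
          using False by (simp add: norm_minus_commute)
      qed
    qed
  qed
  \<comment> \<open>Exchanging the quantifiers makes the exceptional null set of points independent of \<open>h\<close>.\<close>
  have "AE h in lborel. AE x in lborel. ?P x h" using P by simp
  then have "AE x in lborel. AE h in lborel. ?P x h"
    by (subst lborel_pair.AE_commute) measurable
  then have "AE x in lborel. AE t in lborel. ?P x (t - x $ i)"
  proof eventually_elim
    case (elim x)
    from AE_lborel_translate[OF this, of "- x $ i"] show ?case by simp
  qed
  then have ae: "AE x in lborel. AE t in lborel. indicator ?Q x * (indicator ?I t * ennreal ((norm (u x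
      - u (upd x i t)))\<^sup>2))
      \<le> indicator ?Q x * (indicator ?I t * (ennreal \<bar>t - x $ i\<bar> * \<Gamma> x))"
  proof eventually_elim
    case (elim x)
    then show ?case
    proof eventually_elim
      case (elim t)
      show ?case
      proof (cases "x \<in> ?Q \<and> t \<in> ?I")
        case True
        then have "x + (t - x $ i) *\<^sub>R ?e \<in> ?Q"
          using upd_in_box_iff[of x i t a b] by (simp add: upd_eq_add)
        with True elim show ?thesis by (simp add: upd_eq_add norm_minus_commute)
      qed auto
    qed
  qed
  let ?D = "\<integral>\<^sup>+x. \<integral>\<^sup>+y. indicator ?Q x * indicator ?Q y * ennreal ((norm (u x
      - u (upd x i (y $ i))))\<^sup>2) \<partial>lborel \<partial>lborel"
  let ?G = "\<integral>\<^sup>+x. indicator ?Q x * ennreal ((norm (g x))\<^sup>2) \<partial>lborel"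
  let ?N = "emeasure lborel ?Q"
  have "ennreal ?L * ?D
     = (\<integral>\<^sup>+x. indicator ?Q x * (emeasure lborel ?I * (\<integral>\<^sup>+y. indicator ?Q y * ennreal ((norm (u x
         - u (upd x i (y $ i))))\<^sup>2) \<partial>lborel)) \<partial>lborel)"
    using ab by (simp add: nn_integral_cmult[symmetric] mult_ac)
  also have "\<dots> = (\<integral>\<^sup>+x. indicator ?Q x * (?N * (\<integral>\<^sup>+t. indicator ?I t * ennreal ((norm (u x
      - u (upd x i t)))\<^sup>2) \<partial>lborel)) \<partial>lborel)"
    by (subst nn_integral_box_coord) simp_all
  also have "\<dots> = ?N * (\<integral>\<^sup>+x. \<integral>\<^sup>+t. indicator ?Q x * (indicator ?I t * ennreal ((norm (u x
      - u (upd x i t)))\<^sup>2)) \<partial>lborel \<partial>lborel)"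
    by (simp add: nn_integral_cmult[symmetric] mult_ac)
  also have "\<dots> \<le> ?N * (\<integral>\<^sup>+x. \<integral>\<^sup>+t. indicator ?Q x * (indicator ?I t * (ennreal \<bar>t
      - x $ i\<bar> * \<Gamma> x)) \<partial>lborel \<partial>lborel)"
  proof (intro mult_left_mono nn_integral_mono_AE)
    show "AE x in lborel. (\<integral>\<^sup>+t. indicator ?Q x * (indicator ?I t * ennreal ((norm (u x
        - u (upd x i t)))\<^sup>2)) \<partial>lborel)
       \<le> (\<integral>\<^sup>+t. indicator ?Q x * (indicator ?I t * (ennreal \<bar>t - x $ i\<bar> * \<Gamma> x)) \<partial>lborel)"
      using ae by eventually_elim (rule nn_integral_mono_AE)
  qed simp
  also have "(\<integral>\<^sup>+x. \<integral>\<^sup>+t. indicator ?Q x * (indicator ?I t * (ennreal \<bar>t - x $ i\<bar> * \<Gamma> x)) \<partial>lborel \<partial>lborel)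
      = (\<integral>\<^sup>+x. indicator ?Q x * (K (x $ i) * \<Gamma> x) \<partial>lborel)"
  proof (rule nn_integral_cong)
    fix x
    have "(\<integral>\<^sup>+t. indicator ?Q x * (indicator ?I t * (ennreal \<bar>t - x $ i\<bar> * \<Gamma> x)) \<partial>lborel)
        = indicator ?Q x * (\<integral>\<^sup>+t. indicator ?I t * (ennreal \<bar>t - x $ i\<bar> * \<Gamma> x) \<partial>lborel)"
      by (rule nn_integral_cmult) measurable
    also have "(\<integral>\<^sup>+t. indicator ?I t * (ennreal \<bar>t - x $ i\<bar> * \<Gamma> x) \<partial>lborel) = K (x $ i) * \<Gamma> x"
      unfolding K_def by (subst nn_integral_multc[symmetric]) (simp_all add: mult.assoc)
    finally show "(\<integral>\<^sup>+t. indicator ?Q x * (indicator ?I t * (ennreal \<bar>t - x $ i\<bar> * \<Gamma> x)) \<partial>lborel)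
        = indicator ?Q x * (K (x $ i) * \<Gamma> x)" .
  qed
  also have "\<dots> = (\<integral>\<^sup>+x. \<integral>\<^sup>+r. indicator ?Q x * (K (x $ i) * (indicator ?I r * ennreal ((norm (g (upd x i
      r)))\<^sup>2))) \<partial>lborel \<partial>lborel)"
    unfolding \<Gamma>_def by (simp add: nn_integral_cmult)
  also have "\<dots> = (\<integral>\<^sup>+x. \<integral>\<^sup>+r. indicator ?Q (upd x i r) * (indicator ?I (x $ i) * (K (x $ i) * ennreal ((norm
      (g (upd x i r)))\<^sup>2))) \<partial>lborel \<partial>lborel)"
    using upd_in_box_iff[of _ i _ a b] by (intro nn_integral_cong) (auto split: split_indicator)
  \<comment> \<open>Exchanging \<open>x $ i\<close> and \<open>r\<close> separates \<open>K\<close> from the squared derivative.\<close>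
  also have "\<dots> = (\<integral>\<^sup>+x. \<integral>\<^sup>+r. indicator ?Q x * (indicator ?I r * (K r * ennreal ((norm (g x))\<^sup>2))) \<partial>lborel
      \<partial>lborel)"
    by (rule nn_integral_swap_coord[where F="\<lambda>x r. indicator ?Q x * (indicator ?I r * (K r * ennreal ((norm (g
        x))\<^sup>2)))"]) measurable
  also have "\<dots> = (\<integral>\<^sup>+r. indicator ?I r * K r \<partial>lborel) * ?G"
    by (simp add: nn_integral_cmult nn_integral_multc mult.assoc[symmetric]) (simp add:
        nn_integral_cmult[symmetric] mult_ac)
  also have "?N * \<dots> \<le> ?N * (ennreal (?L ^ 3 / 3) * ?G)"
    unfolding K_def using nn_integral_abs_diff2[of "a $ i" "b $ i"] ab
        by (intro mult_left_mono mult_right_mono) auto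
  also have "\<dots> = ennreal ?L * (ennreal (?L\<^sup>2 / 3) * ?N * ?G)"
  proof -
    have "ennreal (?L ^ 3 / 3) = ennreal ?L * ennreal (?L\<^sup>2 / 3)"
      using ab by (subst ennreal_mult[symmetric]) (simp_all add: power2_eq_square power3_eq_cube)
    then show ?thesis by (simp add: mult_ac)
  qed
  finally have "ennreal ?L * ?D \<le> ennreal ?L * (ennreal (?L\<^sup>2 / 3) * ?N * ?G)" .
  then show ?thesis using ab by (subst (asm) ennreal_mult_le_mult_iff) (auto simp: ennreal_eq_0_iff)
qed

section \<open>The Efron--Stein and Poincare inequalities on a cube\<close>

lemma integrable_inner_L2:
  fixes f g :: "'a \<Rightarrow> 'b::{real_inner, banach, second_countable_topology}"
  assumes [measurable]: "f \<in> borel_measurable M" "g \<in> borel_measurable M"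
    and f: "integrable M (\<lambda>x. (norm (f x))\<^sup>2)" and g: "integrable M (\<lambda>x. (norm (g x))\<^sup>2)"
  shows "integrable M (\<lambda>x. f x \<bullet> g x)"
proof (rule Bochner_Integration.integrable_bound)
  show "integrable M (\<lambda>x. (norm (f x))\<^sup>2 + (norm (g x))\<^sup>2)"
    using f g by simp
  have "\<bar>x \<bullet> y\<bar> \<le> (norm x)\<^sup>2 + (norm y)\<^sup>2" for x y :: 'b
  proof -
    have "\<bar>x \<bullet> y\<bar> \<le> norm x * norm y" by (rule Cauchy_Schwarz_ineq2)
    also have "\<dots> \<le> (norm x)\<^sup>2 + (norm y)\<^sup>2"
      using sum_squares_bound[of "norm x" "norm y"] mult_nonneg_nonneg[OF norm_ge_zero[of x] norm_ge_zero[of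
          y]]
      by linarith
    finally show ?thesis .
  qed
  then show "AE x in M. norm (f x \<bullet> g x) \<le> norm ((norm (f x))\<^sup>2 + (norm (g x))\<^sup>2)"
    by simp
qed measurable

lemma integrable_norm_diff_sq:
  fixes f g :: "'a \<Rightarrow> 'b::{real_inner, banach, second_countable_topology}"
  assumes [measurable]: "f \<in> borel_measurable M" "g \<in> borel_measurable M"
    and f: "integrable M (\<lambda>x. (norm (f x))\<^sup>2)" and g: "integrable M (\<lambda>x. (norm (g x))\<^sup>2)"
  shows "integrable M (\<lambda>x. (norm (f x - g x))\<^sup>2)"
    and "(LINT x|M. (norm (f x - g x))\<^sup>2) = (LINT x|M. (norm (f x))\<^sup>2) - 2 * (LINT x|M. f x \<bullet> g x)
        + (LINT x|M. (norm (g x))\<^sup>2)"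
proof -
  have eq: "(norm (x - y))\<^sup>2 = (norm x)\<^sup>2 - 2 * (x \<bullet> y) + (norm y)\<^sup>2" for x y :: 'b
    by (simp add: power2_norm_eq_inner inner_diff_left inner_diff_right inner_commute)
  show "integrable M (\<lambda>x. (norm (f x - g x))\<^sup>2)"
    "(LINT x|M. (norm (f x - g x))\<^sup>2) = (LINT x|M. (norm (f x))\<^sup>2) - 2 * (LINT x|M. f x \<bullet> g x)
        + (LINT x|M. (norm (g x))\<^sup>2)"
    unfolding eq using f g integrable_inner_L2[OF assms] by simp_all
qed

lemma mix_in_box_iff: "mix J x y \<in> box a b \<and> mix J y x \<in> box a b \<longleftrightarrow> x \<in> box a b \<and> y \<in> box a b"
  by (auto simp: mem_box_cart split: if_splits)

lemma measurable_borel_pairI: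
  fixes f :: "'a::euclidean_space \<times> 'b::euclidean_space \<Rightarrow> 'c::topological_space"
  assumes "f \<in> borel_measurable (lborel \<Otimes>\<^sub>M lborel)"
  shows "f \<in> borel_measurable borel"
  using assms by (simp add: lborel_prod)

text \<open>
  The function \<open>(x, y) \<mapsto> u (mix J x y)\<close> on pairs of points of a box. Its inner products in
  \<open>L\<^sup>2\<close> of the pairs depend only on the symmetric difference of the index sets.
\<close>

definition mixed :: "real ^ 'n \<Rightarrow> real ^ 'n \<Rightarrow> (real ^ 'n \<Rightarrow> complex) \<Rightarrow> 'n set \<Rightarrow> (real ^ 'n) \<times> (real ^ 'n) \<Rightarrow>
    complex" where
  "mixed a b u J z = indicator (box a b \<times> box a b) z *\<^sub>R u (mix J (fst z) (snd z))"

lemma measurable_mixed [measurable]: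
  assumes [measurable]: "u \<in> borel_measurable borel"
  shows "mixed a b u J \<in> borel_measurable borel"
proof (rule measurable_borel_pairI)
  have "(\<lambda>z. (indicator (box a b) (fst z) * indicator (box a b) (snd z)) *\<^sub>R u (mix J (fst z) (snd z))) \<in>
      borel_measurable (lborel \<Otimes>\<^sub>M lborel)"
    by measurable
  then show "mixed a b u J \<in> borel_measurable (lborel \<Otimes>\<^sub>M lborel)"
    unfolding mixed_def[abs_def] indicator_times .
qed

lemma mixed_swap: "mixed a b u J (swap_coords K z) = mixed a b u ((J - K) \<union> (K - J)) z"
proof -
  have "mix J (mix K x y) (mix K y x) = mix ((J - K) \<union> (K - J)) x y" for x y :: "real ^ 'a"
    by (auto simp: vec_eq_iff)
  then show ?thesis using mix_in_box_iff[of K "fst z" "snd z" a b]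
    by (auto simp: mixed_def swap_coords_def indicator_times split: split_indicator)
qed

lemma integral_swap_coords:
  fixes F :: "(real ^ 'n) \<times> (real ^ 'n) \<Rightarrow> real"
  assumes F: "F \<in> borel_measurable borel"
  shows "(LINT z|lborel. F (swap_coords J z)) = (LINT z|lborel. F z)"
    and "integrable lborel (\<lambda>z. F (swap_coords J z)) \<longleftrightarrow> integrable lborel F"
proof -
  have T: "swap_coords J \<in> lborel \<rightarrow>\<^sub>M borel" using measurable_swap_coords by simp
  show "(LINT z|lborel. F (swap_coords J z)) = (LINT z|lborel. F z)"
    by (subst (2) lborel_distr_swap_coords[of J, symmetric], subst integral_distr[OF T]) (use F in auto)
  show "integrable lborel (\<lambda>z. F (swap_coords J z)) \<longleftrightarrow> integrable lborel F"
    by (subst (2) lborel_distr_swap_coords[of J, symmetric], subst integrable_distr_eq[OF T]) (use F in auto)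
qed

context
  fixes a b :: "real ^ 'n" and u :: "real ^ 'n \<Rightarrow> complex"
  assumes u_meas [measurable]: "u \<in> borel_measurable borel"
    and u_L2: "integrable lborel (\<lambda>x. (norm (u x))\<^sup>2)"
begin

lemma mixed_empty_L2:
  "integrable lborel (\<lambda>z. (norm (mixed a b u {} z))\<^sup>2)"
  "(LINT z|lborel. (norm (mixed a b u {} z))\<^sup>2)
    = measure lborel (box a b) * (LINT x|lborel. indicator (box a b) x * (norm (u x))\<^sup>2)"
proof -
  let ?Q = "box a b"
  have i1: "integrable lborel (\<lambda>x. indicator ?Q x * (norm (u x))\<^sup>2 :: real)"
    by (rule Bochner_Integration.integrable_bound[OF u_L2]) (auto split: split_indicator)
  have eq: "(norm (mixed a b u {} (x, y)))\<^sup>2 = (indicator ?Q x * (norm (u x))\<^sup>2) * indicator ?Q y" for x y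
    by (auto simp: mixed_def vec_eq_iff mix_def vec_lambda_eta split: split_indicator)
  have i2: "integrable (lborel \<Otimes>\<^sub>M lborel) (\<lambda>z. (norm (mixed a b u {} z))\<^sup>2)"
  proof (rule lborel_pair.Fubini_integrable)
    show "integrable lborel (\<lambda>x. LINT y|lborel. norm ((norm (mixed a b u {} (x, y)))\<^sup>2))"
      unfolding eq using i1 by (simp add: abs_mult)
  qed (use emeasure_lborel_box_finite[of a b] in \<open>auto simp: eq integrable_indicator_iff lborel_prod\<close>)
  then show "integrable lborel (\<lambda>z. (norm (mixed a b u {} z))\<^sup>2)" by (simp add: lborel_prod)
  have "(LINT z|lborel. (norm (mixed a b u {} z))\<^sup>2)
      = (LINT x|lborel. LINT y|lborel. (norm (mixed a b u {} (x, y)))\<^sup>2)"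
    using lborel_pair.integral_fst'[OF i2] by (simp add: lborel_prod)
  then show "(LINT z|lborel. (norm (mixed a b u {} z))\<^sup>2)
    = measure lborel ?Q * (LINT x|lborel. indicator ?Q x * (norm (u x))\<^sup>2)"
    unfolding eq by simp
qed

lemma mixed_inner_shift:
  "(LINT z|lborel. mixed a b u K z \<bullet> mixed a b u J z)
    = (LINT z|lborel. mixed a b u {} z \<bullet> mixed a b u ((J - K) \<union> (K - J)) z)"
proof -
  have "(LINT z|lborel. mixed a b u K z \<bullet> mixed a b u J z)
      = (LINT z|lborel. mixed a b u K (swap_coords K z) \<bullet> mixed a b u J (swap_coords K z))"
    by (rule integral_swap_coords(1)[symmetric, of "\<lambda>z. mixed a b u K z \<bullet> mixed a b u J z"]) measurable
  then show ?thesis unfolding mixed_swap by simp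
qed

lemma mixed_L2: "integrable lborel (\<lambda>z. (norm (mixed a b u J z))\<^sup>2)"
proof -
  have "integrable lborel (\<lambda>z. (norm (mixed a b u {} (swap_coords J z)))\<^sup>2)"
    by (subst integral_swap_coords(2)[of "\<lambda>z. (norm (mixed a b u {} z))\<^sup>2"]) (use mixed_empty_L2 in auto)
  then show ?thesis unfolding mixed_swap by simp
qed

text \<open>
  The Efron--Stein inequality: resampling all coordinates costs at most the sum of the costs of
  resampling single coordinates. With \<open>c J\<close> the inner product of the original and the \<open>J\<close>-resampled function,
  the step from \<open>J\<close> to \<open>insert i J\<close> is the nonnegativity of the squared norm of the mixed second difference
  in \<open>J\<close> and \<open>i\<close>.
\<close>

lemma efron_stein:
  "(LINT z|lborel. (norm (mixed a b u {} z - mixed a b u UNIV z))\<^sup>2)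
    \<le> (\<Sum>i\<in>UNIV. LINT z|lborel. (norm (mixed a b u {} z - mixed a b u {i} z))\<^sup>2)"
proof -
  let ?f = "mixed a b u"
  define c where "c J = (LINT z|lborel. ?f {} z \<bullet> ?f J z)" for J
  have meas: "?f J \<in> borel_measurable lborel" for J by simp
  have cc: "(LINT z|lborel. ?f K z \<bullet> ?f J z) = c ((J - K) \<union> (K - J))" for K J
    unfolding c_def by (rule mixed_inner_shift)
  have nn: "(LINT z|lborel. (norm (?f J z))\<^sup>2) = c {}" for J
    using cc[of J J] by (simp add: power2_norm_eq_inner)
  have D: "(LINT z|lborel. (norm (?f K z - ?f J z))\<^sup>2) = 2 * c {} - 2 * c ((J - K) \<union> (K - J))" for K J
    by (subst integrable_norm_diff_sq(2)) (simp_all add: meas mixed_L2 nn cc)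
  have step: "c J - c (insert i J) \<le> c {} - c {i}" if i: "i \<notin> J" for i J
  proof -
    let ?p = "\<lambda>z. ?f {} z - ?f {i} z" and ?q = "\<lambda>z. ?f J z - ?f (insert i J) z"
    have pm: "?p \<in> borel_measurable lborel" "?q \<in> borel_measurable lborel" by simp_all
    have p2: "integrable lborel (\<lambda>z. (norm (?p z))\<^sup>2)" "integrable lborel (\<lambda>z. (norm (?q z))\<^sup>2)"
      by (auto intro!: integrable_norm_diff_sq(1) mixed_L2)
    have "0 \<le> (LINT z|lborel. (norm (?p z - ?q z))\<^sup>2)" by simp
    also have "\<dots> = (LINT z|lborel. (norm (?p z))\<^sup>2) - 2 * (LINT z|lborel. ?p z \<bullet> ?q z)
        + (LINT z|lborel. (norm (?q z))\<^sup>2)"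
      by (rule integrable_norm_diff_sq(2)[OF pm p2])
    also have "(LINT z|lborel. ?p z \<bullet> ?q z) = c J - c (insert i J) - (c (insert i J) - c J)"
    proof -
      have int: "integrable lborel (\<lambda>z. ?f K z \<bullet> ?f L z)" for K L
        by (rule integrable_inner_L2[OF meas meas mixed_L2 mixed_L2])
      have "(J - {i}) \<union> ({i} - J) = insert i J" "(insert i J - {i}) \<union> ({i} - insert i J) = J"
        using i by auto
      then show ?thesis
        using cc[of "{}" J] cc[of "{}" "insert i J"] cc[of "{i}" J] cc[of "{i}" "insert i J"]
        by (simp add: inner_diff_left inner_diff_right int)
    qed
    also have "(LINT z|lborel. (norm (?p z))\<^sup>2) = 2 * c {} - 2 * c {i}" using D[of "{}" "{i}"] by simp
    also have "(LINT z|lborel. (norm (?q z))\<^sup>2) = 2 * c {} - 2 * c {i}"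
    proof -
      have "(insert i J - J) \<union> (J - insert i J) = {i}" using i by auto
      then show ?thesis using D[of J "insert i J"] by simp
    qed
    finally show ?thesis by simp
  qed
  have "c {} - c J \<le> (\<Sum>i\<in>J. c {} - c {i})" for J
  proof (induction J rule: finite_induct[OF finite])
    case (2 i J)
    then show ?case using step[of i J] by simp
  qed simp
  from this[of UNIV] show ?thesis using D[of "{}"] by (simp add: sum_subtractf sum_distrib_left[symmetric])
qed

lemma mixed_UNIV_inner:
  "(LINT z|lborel. mixed a b u {} z \<bullet> mixed a b u UNIV z)
      = (norm (LINT x|lborel. indicator (box a b) x *\<^sub>R u x))\<^sup>2"
proof -
  let ?v = "\<lambda>x. indicator (box a b) x *\<^sub>R u x"
  have v: "integrable lborel ?v" by (rule L2_loc_integrable[OF u_meas u_L2]) auto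
  have "integrable lborel (\<lambda>z. mixed a b u {} z \<bullet> mixed a b u UNIV z)"
    by (intro integrable_inner_L2 mixed_L2) simp_all
  then have i: "integrable (lborel \<Otimes>\<^sub>M lborel) (\<lambda>z. mixed a b u {} z \<bullet> mixed a b u UNIV z)"
    by (simp add: lborel_prod)
  have eq: "mixed a b u {} (x, y) \<bullet> mixed a b u UNIV (x, y) = ?v x \<bullet> ?v y" for x y
    by (auto simp: mixed_def mix_def vec_lambda_eta split: split_indicator)
  have "(LINT z|lborel. mixed a b u {} z \<bullet> mixed a b u UNIV z) = (LINT x|lborel. LINT y|lborel. ?v x \<bullet> ?v y)"
    using lborel_pair.integral_fst'[OF i] by (simp add: lborel_prod eq)
  also have "\<dots> = (LINT x|lborel. ?v x \<bullet> (LINT y|lborel. ?v y))"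
    using v by (subst integral_inner_right) auto
  also have "\<dots> = (LINT x|lborel. ?v x) \<bullet> (LINT y|lborel. ?v y)"
    using v by (intro integral_inner_left) auto
  finally show ?thesis by (simp add: power2_norm_eq_inner)
qed

end

text \<open>
  A Poincare inequality on a cube, with constant \<open>R\<^sup>2/6\<close> instead of the optimal \<open>R\<^sup>2/\<pi>\<^sup>2\<close>. The mean
  square deviation from the mean \<open>c\<close> is half the mean of \<open>(norm (u x - u y))\<^sup>2\<close> over pairs, to which
  \<open>efron_stein\<close> and \<open>coordinate_variation\<close> apply.
\<close>

lemma poincare_box:
  fixes u :: "real ^ 'n \<Rightarrow> complex" and g :: "'n \<Rightarrow> real ^ 'n \<Rightarrow> complex"
  assumes [measurable]: "u \<in> borel_measurable borel" "\<And>i. g i \<in> borel_measurable borel"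
    and u: "integrable lborel (\<lambda>x. (norm (u x))\<^sup>2)" and g: "\<And>i. integrable lborel (\<lambda>x. (norm (g i x))\<^sup>2)"
    and wp: "\<And>i \<phi>. test_function \<phi> \<Longrightarrow> (LINT x|lborel. partial i \<phi> x *\<^sub>R u x)
        = - (LINT x|lborel. \<phi> x *\<^sub>R g i x)"
    and R: "R > 0" and ab: "\<And>i. b $ i - a $ i = R"
  defines "c \<equiv> (LINT x|lborel. indicator (box a b) x *\<^sub>R u x) /\<^sub>R measure lborel (box a b)"
  shows "(LINT x|lborel. indicator (box a b) x * (norm (u x - c))\<^sup>2)
    \<le> R\<^sup>2 / 6 * (\<Sum>i\<in>UNIV. LINT x|lborel. indicator (box a b) x * (norm (g i x))\<^sup>2)"
proof -
  let ?Q = "box a b" and ?f = "mixed a b u"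
  define N where "N = measure lborel ?Q"
  have ab': "a $ i < b $ i" for i using ab[of i] R by simp
  have em: "emeasure lborel ?Q = ennreal N" unfolding N_def
    by (rule emeasure_eq_ennreal_measure) (use emeasure_lborel_box_finite[of a b] in auto)
  have N: "N > 0"
  proof -
    have "N = (\<Prod>b'\<in>Basis. (b - a) \<bullet> b')" unfolding N_def
      using ab' by (subst measure_lborel_box) (auto simp: Basis_vec_real inner_axis less_imp_le)
    then show ?thesis using ab' by (auto intro!: prod_pos simp: Basis_vec_real inner_axis inner_diff_left)
  qed
  have fi: "integrable lborel (\<lambda>x. indicator ?Q x * (norm (v x))\<^sup>2 :: real)"
    if "v \<in> borel_measurable borel" "integrable lborel (\<lambda>x. (norm (v x))\<^sup>2)" for v :: "real ^ 'n \<Rightarrow> complex"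
    by (rule Bochner_Integration.integrable_bound[OF that(2)]) (use that in \<open>auto split: split_indicator\<close>)
  have Di: "(LINT z|lborel. (norm (?f {} z - ?f {i} z))\<^sup>2)
      \<le> R\<^sup>2 / 3 * N * (LINT x|lborel. indicator ?Q x * (norm (g i x))\<^sup>2)" for i
  proof -
    have int: "integrable lborel (\<lambda>z. (norm (?f {} z - ?f {i} z))\<^sup>2)"
      by (intro integrable_norm_diff_sq mixed_L2 u) simp_all
    have meas: "(\<lambda>z. ennreal ((norm (?f {} z - ?f {i} z))\<^sup>2)) \<in> borel_measurable (lborel \<Otimes>\<^sub>M lborel)"
      by (simp add: lborel_prod)
    have "ennreal (LINT z|lborel. (norm (?f {} z - ?f {i} z))\<^sup>2)
        = (\<integral>\<^sup>+z. ennreal ((norm (?f {} z - ?f {i} z))\<^sup>2) \<partial>lborel)"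
      by (rule nn_integral_eq_integral[symmetric, OF int]) simp
    also have "\<dots> = (\<integral>\<^sup>+x. \<integral>\<^sup>+y. ennreal ((norm (?f {} (x, y) - ?f {i} (x, y)))\<^sup>2) \<partial>lborel \<partial>lborel)"
      using lborel.nn_integral_fst[OF meas] by (simp add: lborel_prod)
    also have "\<dots> = (\<integral>\<^sup>+x. \<integral>\<^sup>+y. indicator ?Q x * indicator ?Q y * ennreal ((norm (u x
        - u (upd x i (y $ i))))\<^sup>2) \<partial>lborel \<partial>lborel)"
      by (intro nn_integral_cong)
        (auto simp: mixed_def mix_singleton mix_def[of "{}"] vec_lambda_eta split: split_indicator)
    also have "\<dots> \<le> ennreal ((b $ i - a $ i)\<^sup>2 / 3) * emeasure lborel ?Q * (\<integral>\<^sup>+x. indicator ?Q x * ennreal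
        ((norm (g i x))\<^sup>2) \<partial>lborel)"
      by (rule coordinate_variation[OF _ _ u g wp ab']) simp_all
    also have "(\<integral>\<^sup>+x. indicator ?Q x * ennreal ((norm (g i x))\<^sup>2) \<partial>lborel)
        = (\<integral>\<^sup>+x. ennreal (indicator ?Q x * (norm (g i x))\<^sup>2) \<partial>lborel)"
      by (intro nn_integral_cong) (auto split: split_indicator)
    also have "\<dots> = ennreal (LINT x|lborel. indicator ?Q x * (norm (g i x))\<^sup>2)"
      by (rule nn_integral_eq_integral[OF fi[OF _ g]]) simp_all
    also have "ennreal ((b $ i - a $ i)\<^sup>2 / 3) * emeasure lborel ?Q * \<dots>
        = ennreal (R\<^sup>2 / 3 * N * (LINT x|lborel. indicator ?Q x * (norm (g i x))\<^sup>2))"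
      using N by (simp add: ab em flip: ennreal_mult')
    finally show ?thesis using N by (subst (asm) ennreal_le_iff) (auto intro!: mult_nonneg_nonneg)
  qed
  let ?A = "LINT x|lborel. indicator ?Q x * (norm (u x))\<^sup>2"
  let ?S = "LINT x|lborel. indicator ?Q x *\<^sub>R u x"
  have D: "(LINT z|lborel. (norm (?f {} z - ?f UNIV z))\<^sup>2) = 2 * N * ?A - 2 * (norm ?S)\<^sup>2"
  proof -
    have "(LINT z|lborel. (norm (?f UNIV z))\<^sup>2) = (LINT z|lborel. (norm (?f {} z))\<^sup>2)"
      using mixed_inner_shift[OF assms(1) u, of a b UNIV UNIV] by (simp add: power2_norm_eq_inner)
    then show ?thesis
      by (subst integrable_norm_diff_sq(2))
        (simp_all add: mixed_L2 u mixed_UNIV_inner mixed_empty_L2 N_def)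
  qed
  have var: "(LINT x|lborel. indicator ?Q x * (norm (u x - c))\<^sup>2) = ?A - (norm ?S)\<^sup>2 / N"
  proof -
    let ?v = "\<lambda>x. indicator ?Q x *\<^sub>R u x" and ?w = "\<lambda>x. indicator ?Q x *\<^sub>R c"
    have v: "integrable lborel ?v" by (rule L2_loc_integrable[OF _ u]) auto
    have sq: "(norm (indicator ?Q x *\<^sub>R z))\<^sup>2 = indicator ?Q x * (norm z)\<^sup>2" for x and z :: complex
      by (auto split: split_indicator)
    have v2: "integrable lborel (\<lambda>x. (norm (?v x))\<^sup>2)"
      unfolding sq by (rule fi[OF _ u]) simp
    have w2: "integrable lborel (\<lambda>x. (norm (?w x))\<^sup>2)"
      unfolding sq using emeasure_lborel_box_finite[of a b] by (simp add: integrable_indicator_iff)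
    have "(LINT x|lborel. (norm (?v x - ?w x))\<^sup>2) = (LINT x|lborel. (norm (?v x))\<^sup>2)
        - 2 * (LINT x|lborel. ?v x \<bullet> ?w x) + (LINT x|lborel. (norm (?w x))\<^sup>2)"
      by (rule integrable_norm_diff_sq(2)[OF _ _ v2 w2]) simp_all
    also have "(LINT x|lborel. ?v x \<bullet> ?w x) = (LINT x|lborel. ?v x \<bullet> c)"
      by (intro Bochner_Integration.integral_cong) (auto split: split_indicator)
    also have "\<dots> = ?S \<bullet> c" using v by (intro integral_inner_left) auto
    also have "(LINT x|lborel. (norm (?w x))\<^sup>2) = N * (norm c)\<^sup>2" unfolding sq by (simp add: N_def)
    finally have "(LINT x|lborel. indicator ?Q x * (norm (u x - c))\<^sup>2) = ?A - 2 * (?S \<bullet> c) + N * (norm c)\<^sup>2"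
      unfolding scaleR_diff_right[symmetric] sq .
    moreover have "?S \<bullet> c = (norm ?S)\<^sup>2 / N" "N * (norm c)\<^sup>2 = (norm ?S)\<^sup>2 / N"
      using N unfolding c_def N_def[symmetric]
      by (simp_all add: power2_norm_eq_inner[symmetric] power_mult_distrib power2_eq_square field_simps)
    ultimately show ?thesis by simp
  qed
  have "2 * N * (LINT x|lborel. indicator ?Q x * (norm (u x - c))\<^sup>2)
      = (LINT z|lborel. (norm (?f {} z - ?f UNIV z))\<^sup>2)"
    unfolding D var using N by (simp add: field_simps)
  also have "\<dots> \<le> (\<Sum>i\<in>UNIV. LINT z|lborel. (norm (?f {} z - ?f {i} z))\<^sup>2)"
    by (rule efron_stein[OF _ u]) simp
  also have "\<dots> \<le> (\<Sum>i\<in>UNIV. R\<^sup>2 / 3 * N * (LINT x|lborel. indicator ?Q x * (norm (g i x))\<^sup>2))"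
    by (intro sum_mono Di)
  also have "\<dots> = 2 * N * (R\<^sup>2 / 6 * (\<Sum>i\<in>UNIV. LINT x|lborel. indicator ?Q x * (norm (g i x))\<^sup>2))"
    by (subst sum_distrib_left[symmetric]) simp
  finally show ?thesis using N by simp
qed

section \<open>The lower bound of the form on cubes and on the whole space\<close>

text \<open>
  A weight \<open>V\<close> with \<open>0 \<le> V \<le> m\<close> and mean \<open>\<rho>\<close> controls a function up to its deviation from its mean
  \<open>c\<close>. Put \<open>u = c + w\<close>. As \<open>w\<close> has mean zero, only the deviation \<open>V - \<rho>\<close> enters the mixed term of
  \<open>V * (norm (c + w))\<^sup>2\<close>, and the mean of \<open>(V - \<rho>)\<^sup>2\<close> is at most \<open>\<rho> * (m - \<rho>)\<close>. The factor \<open>m - \<rho>\<close>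
  in place of \<open>m\<close> is the reason why only \<open>\<tau> / 2\<close> is needed in front of the variance.
\<close>

lemma (in finite_measure) weighted_mean_bound:
  fixes u :: "'a \<Rightarrow> complex" and V :: "'a \<Rightarrow> real"
  assumes [measurable]: "u \<in> borel_measurable M" "V \<in> borel_measurable M"
    and V: "AE x in M. 0 \<le> V x \<and> V x \<le> m"
    and u: "integrable M (\<lambda>x. (norm (u x))\<^sup>2)"
    and N: "measure M (space M) > 0" and \<tau>: "\<tau> > 0"
  defines "\<rho> \<equiv> (LINT x|M. V x) / measure M (space M)"
    and "c \<equiv> (LINT x|M. u x) /\<^sub>R measure M (space M)"
  shows "\<tau> * \<rho> / (\<tau> + 2 * m) * (LINT x|M. (norm (u x))\<^sup>2)
    \<le> (LINT x|M. V x * (norm (u x))\<^sup>2) + \<tau> / 2 * (LINT x|M. (norm (u x - c))\<^sup>2)"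
proof -
  define n where "n = measure M (space M)"
  have n: "n > 0" using N by (simp add: n_def)
  have "AE x in M. norm (V x) \<le> m" using V by eventually_elim simp
  then have Vi: "integrable M V" by (rule integrable_const_bound) simp
  have Vn: "(LINT x|M. V x) = \<rho> * n" using n by (simp add: \<rho>_def n_def)
  have "0 \<le> (LINT x|M. V x)" by (rule integral_nonneg_AE) (use V in auto)
  then have \<rho>0: "0 \<le> \<rho>" using n by (simp add: Vn zero_le_mult_iff)
  have "(LINT x|M. V x) \<le> (LINT x|M. m)" by (rule integral_mono_AE[OF Vi]) (use V in auto)
  then have \<rho>m: "\<rho> \<le> m" using n by (simp add: Vn n_def mult.commute)
  have ui: "integrable M u"
  proof (rule Bochner_Integration.integrable_bound)
    show "integrable M (\<lambda>x. 1 + (norm (u x))\<^sup>2)" using u by simp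
    show "AE x in M. norm (u x) \<le> norm (1 + (norm (u x))\<^sup>2)" using norm_le_one_plus_sq by auto
  qed simp
  have un: "(LINT x|M. u x) = n *\<^sub>R c" using n by (simp add: c_def n_def)
  let ?w = "\<lambda>x. u x - c"
  have wi: "integrable M ?w" using ui by simp
  have wz: "(LINT x|M. ?w x \<bullet> c) = 0"
    using ui by (simp add: integral_inner_left[OF wi] un n_def)
  have usq: "(norm (u x))\<^sup>2 = (norm (?w x))\<^sup>2 + 2 * (?w x \<bullet> c) + (norm c)\<^sup>2" for x
    by (simp add: power2_norm_eq_inner inner_diff_left inner_diff_right inner_commute)
  have wci: "integrable M (\<lambda>x. ?w x \<bullet> c)" using wi by simp
  have w2: "integrable M (\<lambda>x. (norm (?w x))\<^sup>2)"
  proof -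
    have "(norm (?w x))\<^sup>2 = (norm (u x))\<^sup>2 - 2 * (?w x \<bullet> c) - (norm c)\<^sup>2" for x
      using usq[of x] by simp
    then show ?thesis using u wci by simp
  qed
  define b2 where "b2 = (LINT x|M. (norm (?w x))\<^sup>2)"
  have A: "(LINT x|M. (norm (u x))\<^sup>2) = b2 + n * (norm c)\<^sup>2"
    unfolding usq using w2 wci wz by (simp add: b2_def n_def)
  define q where "q = (LINT x|M. V x * (norm (u x))\<^sup>2)"
  have qi: "integrable M (\<lambda>x. V x * (norm (u x))\<^sup>2)"
  proof (rule Bochner_Integration.integrable_bound)
    show "integrable M (\<lambda>x. m * (norm (u x))\<^sup>2)" using u by simp
    show "AE x in M. norm (V x * (norm (u x))\<^sup>2) \<le> norm (m * (norm (u x))\<^sup>2)"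
      using V by eventually_elim (auto simp: abs_mult intro!: mult_right_mono)
  qed simp
  define \<kappa> where "\<kappa> = \<tau> * \<rho> / (\<tau> + 2 * m)"
  \<comment> \<open>The parameters \<open>\<theta>\<close>, \<open>\<alpha>\<close> and \<open>\<beta>\<close> satisfy \<open>\<alpha> * \<beta> = \<theta>\<^sup>2\<close>. Of the
      coefficient \<open>\<tau> / 2\<close> of \<open>b2\<close>, the part \<open>\<beta>\<close> absorbs the mixed term and \<open>\<kappa>\<close> remains.\<close>
  define \<theta> where "\<theta> = \<tau> / (\<tau> + 2 * m)"
  define \<beta> where "\<beta> = \<tau> / 2 - \<kappa>"
  have m0: "0 \<le> m" using \<rho>0 \<rho>m by simp
  have \<beta>eq: "\<beta> = \<tau> * (\<tau> + 2 * (m - \<rho>)) / (2 * (\<tau> + 2 * m))"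
    using \<tau> m0 unfolding \<beta>_def \<kappa>_def by (simp add: field_simps)
  have \<beta>: "\<beta> > 0" unfolding \<beta>eq using \<tau> m0 \<rho>m by (intro divide_pos_pos mult_pos_pos) auto
  have \<theta>: "0 < \<theta>" using \<tau> m0 by (simp add: \<theta>_def)
  define \<alpha> where "\<alpha> = \<theta>\<^sup>2 / \<beta>"
  have \<alpha>0: "\<alpha> > 0" using \<theta> \<beta> by (simp add: \<alpha>_def)
  have \<alpha>: "\<alpha> * (m - \<rho>) \<le> \<theta> - \<theta>\<^sup>2"
  proof -
    have "\<theta>\<^sup>2 * (m - \<rho>) \<le> (\<theta> - \<theta>\<^sup>2) * \<beta>"
    proof -
      let ?s = "\<tau> + 2 * m"
      have s: "?s > 0" using \<tau> m0 by simp
      have "0 \<le> \<tau>\<^sup>2 * \<tau> * \<rho> / (?s\<^sup>2 * ?s)" using \<tau> \<rho>0 s by simp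
      also have "\<tau>\<^sup>2 * \<tau> * \<rho> / (?s\<^sup>2 * ?s) = (\<theta> - \<theta>\<^sup>2) * \<beta> - \<theta>\<^sup>2 * (m - \<rho>)"
        unfolding \<theta>_def \<beta>eq using s by (simp add: divide_simps power2_eq_square) (simp add: algebra_simps)
      finally show ?thesis by simp
    qed
    then show ?thesis using \<beta> by (simp add: \<alpha>_def field_simps)
  qed
  \<comment> \<open>The pointwise inequality, from two nonnegative squares and \<open>v\<^sup>2 \<le> m * v\<close>.\<close>
  have pt: "(2 * \<theta> - \<theta>\<^sup>2) * (norm c)\<^sup>2 * v + 2 * \<theta> * \<rho> * (w \<bullet> c) - \<alpha> * (norm c)\<^sup>2 * ((m - 2 * \<rho>) * v + \<rho>\<^sup>2)
      \<le> v * (norm (w + c))\<^sup>2 + \<beta> * (norm w)\<^sup>2" if v: "0 \<le> v" "v \<le> m" for v and w :: complex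
  proof -
    have 1: "0 \<le> v * (norm (w + c - \<theta> *\<^sub>R c))\<^sup>2" using v by simp
    have e1: "(norm (w + c - \<theta> *\<^sub>R c))\<^sup>2 = (norm (w + c))\<^sup>2 - 2 * \<theta> * (w \<bullet> c) - (2 * \<theta> - \<theta>\<^sup>2) * (norm c)\<^sup>2"
      by (simp add: power2_norm_eq_inner inner_add_left inner_add_right inner_diff_left inner_diff_right
          inner_commute[of c w])
        (simp add: algebra_simps power2_eq_square)
    have 2: "0 \<le> \<beta> * (norm (w + (\<theta> * (v - \<rho>) / \<beta>) *\<^sub>R c))\<^sup>2" using \<beta> by simp
    have e2: "\<beta> * (norm (w + (\<theta> * (v - \<rho>) / \<beta>) *\<^sub>R c))\<^sup>2
        = \<beta> * (norm w)\<^sup>2 + 2 * \<theta> * (v - \<rho>) * (w \<bullet> c) + \<alpha> * (v - \<rho>)\<^sup>2 * (norm c)\<^sup>2"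
      using \<beta> unfolding \<alpha>_def
      by (simp add: power2_norm_eq_inner inner_add_left inner_add_right inner_commute[of c w])
        (simp add: field_simps power2_eq_square)
    have "v * v \<le> m * v" using v by (intro mult_right_mono)
    then have 3: "\<alpha> * (v - \<rho>)\<^sup>2 * (norm c)\<^sup>2 \<le> \<alpha> * ((m - 2 * \<rho>) * v + \<rho>\<^sup>2) * (norm c)\<^sup>2"
      using \<alpha>0 by (intro mult_right_mono mult_left_mono) (auto simp: power2_eq_square algebra_simps)
    show ?thesis using 1 2 3 unfolding e1 e2 by (simp add: algebra_simps)
  qed
  have "(2 * \<theta> - \<theta>\<^sup>2) * (norm c)\<^sup>2 * (\<rho> * n) - \<alpha> * (norm c)\<^sup>2 * ((m - 2 * \<rho>) * (\<rho> * n) + \<rho>\<^sup>2 * n)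
    = (LINT x|M. (2 * \<theta> - \<theta>\<^sup>2) * (norm c)\<^sup>2 * V x + 2 * \<theta> * \<rho> * (?w x \<bullet> c) - \<alpha> * (norm c)\<^sup>2 * ((m
        - 2 * \<rho>) * V x + \<rho>\<^sup>2))"
    using Vi wci wz by (simp add: Vn n_def del: inner_diff_left)
  also have "\<dots> \<le> (LINT x|M. V x * (norm (?w x + c))\<^sup>2 + \<beta> * (norm (?w x))\<^sup>2)"
  proof (rule integral_mono_AE)
    show "AE x in M. (2 * \<theta> - \<theta>\<^sup>2) * (norm c)\<^sup>2 * V x + 2 * \<theta> * \<rho> * (?w x \<bullet> c) - \<alpha> * (norm c)\<^sup>2 * ((m
        - 2 * \<rho>) * V x + \<rho>\<^sup>2)
       \<le> V x * (norm (?w x + c))\<^sup>2 + \<beta> * (norm (?w x))\<^sup>2"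
      using V by eventually_elim (rule pt, auto)
  qed (use Vi wci qi w2 in auto)
  also have "\<dots> = q + \<beta> * b2" using qi w2 by (simp add: q_def b2_def)
  finally have "((2 * \<theta> - \<theta>\<^sup>2) - \<alpha> * (m - \<rho>)) * (\<rho> * n * (norm c)\<^sup>2) \<le> q + \<beta> * b2"
    by (simp add: algebra_simps power2_eq_square)
  moreover have "\<theta> * (\<rho> * n * (norm c)\<^sup>2) \<le> ((2 * \<theta> - \<theta>\<^sup>2) - \<alpha> * (m - \<rho>)) * (\<rho> * n * (norm c)\<^sup>2)"
    using \<alpha> \<rho>0 n by (intro mult_right_mono) auto
  ultimately have "\<theta> * (\<rho> * n * (norm c)\<^sup>2) \<le> q + \<beta> * b2" by simp
  moreover have "\<kappa> * (b2 + n * (norm c)\<^sup>2) = \<kappa> * b2 + \<theta> * (\<rho> * n * (norm c)\<^sup>2)"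
  proof -
    have "\<kappa> = \<theta> * \<rho>" by (simp add: \<kappa>_def \<theta>_def)
    then show ?thesis by (simp add: algebra_simps)
  qed
  ultimately have "\<kappa> * (b2 + n * (norm c)\<^sup>2) \<le> q + \<tau> / 2 * b2"
    by (simp only: \<beta>_def left_diff_distrib)
  then show ?thesis unfolding A q_def[symmetric] b2_def[symmetric] \<kappa>_def .
qed

lemma pi_sq_le_12: "pi\<^sup>2 \<le> 12"
proof -
  have "pi * pi \<le> 3.2 * 3.2" using pi_approx by (intro mult_mono) auto
  then show ?thesis by (simp add: power2_eq_square)
qed

text \<open>
  With \<open>\<tau> = \<pi>\<^sup>2 / R\<^sup>2\<close> the variance term of \<open>weighted_mean_bound\<close> is at most \<open>\<pi>\<^sup>2 / 12\<close> times the
  gradient term by \<open>poincare_box\<close>, and \<open>\<pi>\<^sup>2 \<le> 12\<close>. Hence a Poincare inequality with a constant up to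
  twice the optimal one would suffice.
\<close>

lemma form_bound_box:
  fixes u :: "real ^ 'n \<Rightarrow> complex" and g :: "'n \<Rightarrow> real ^ 'n \<Rightarrow> complex" and V :: "real ^ 'n \<Rightarrow> real"
  assumes [measurable]: "u \<in> borel_measurable borel" "\<And>i. g i \<in> borel_measurable borel" "V \<in> borel_measurable
      borel"
    and u: "integrable lborel (\<lambda>x. (norm (u x))\<^sup>2)" and g: "\<And>i. integrable lborel (\<lambda>x. (norm (g i x))\<^sup>2)"
    and wp: "\<And>i \<phi>. test_function \<phi> \<Longrightarrow> (LINT x|lborel. partial i \<phi> x *\<^sub>R u x)
        = - (LINT x|lborel. \<phi> x *\<^sub>R g i x)"
    and R: "R > 0" and ab: "\<And>i. b $ i - a $ i = R"
    and V: "AE x in lborel. x \<in> box a b \<longrightarrow> 0 \<le> V x \<and> V x \<le> m"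
  defines "\<rho> \<equiv> (LINT x|lborel. indicator (box a b) x * V x) / R ^ CARD('n)"
  shows "pi\<^sup>2 / (pi\<^sup>2 + 2 * R\<^sup>2 * m) * \<rho> * (LINT x|lborel. indicator (box a b) x * (norm (u x))\<^sup>2)
    \<le> (LINT x|lborel. indicator (box a b) x * (V x * (norm (u x))\<^sup>2))
      + (\<Sum>i\<in>UNIV. LINT x|lborel. indicator (box a b) x * (norm (g i x))\<^sup>2)"
proof -
  let ?Q = "box a b"
  let ?M = "restrict_space lborel ?Q"
  have ab': "a $ i < b $ i" for i using ab[of i] R by simp
  have N: "measure lborel ?Q = R ^ CARD('n)"
  proof -
    have "measure lborel ?Q = (\<Prod>b'\<in>Basis. (b - a) \<bullet> b')"
      using ab' by (subst measure_lborel_box) (auto simp: Basis_vec_real inner_axis less_imp_le)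
    also have "\<dots> = (\<Prod>b'\<in>(Basis :: (real ^ 'n) set). R)"
      by (intro prod.cong) (auto simp: Basis_vec_real inner_axis ab)
    finally show ?thesis by simp
  qed
  have sp: "space ?M = ?Q" by (simp add: space_restrict_space)
  have mN: "measure ?M (space ?M) = R ^ CARD('n)"
    unfolding sp by (subst measure_restrict_space) (auto simp: N)
  interpret finite_measure ?M
    by (rule finite_measureI) (use emeasure_lborel_box_finite[of a b] in \<open>simp add: sp
        emeasure_restrict_space\<close>)
  have int: "(LINT x|?M. f x) = (LINT x|lborel. indicator ?Q x *\<^sub>R f x)"
    for f :: "real ^ 'n \<Rightarrow> 'z::{banach, second_countable_topology}"
    by (subst integral_restrict_space) auto
  have rm: "f \<in> borel_measurable ?M" if "f \<in> borel_measurable borel"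
      for f :: "real ^ 'n \<Rightarrow> 'z::topological_space"
    using that by (intro measurable_restrict_space1) simp
  have ui: "integrable ?M (\<lambda>x. (norm (u x))\<^sup>2)"
    using integrable_mult_indicator[OF _ u, of ?Q]
        by (subst integrable_restrict_space) (auto simp: set_integrable_def)
  have "AE x in ?M. 0 \<le> V x \<and> V x \<le> m"
    using V by (subst AE_restrict_space_iff) auto
  from weighted_mean_bound[OF rm rm this ui, of "pi\<^sup>2 / R\<^sup>2"] R
  have "pi\<^sup>2 / R\<^sup>2 * \<rho> / (pi\<^sup>2 / R\<^sup>2 + 2 * m) * (LINT x|lborel. indicator ?Q x * (norm (u x))\<^sup>2)
    \<le> (LINT x|lborel. indicator ?Q x * (V x * (norm (u x))\<^sup>2)) + pi\<^sup>2 / R\<^sup>2 / 2 *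
    (LINT x|lborel. indicator ?Q x * (norm (u x
        - (LINT x|lborel. indicator ?Q x *\<^sub>R u x) /\<^sub>R measure lborel ?Q))\<^sup>2)"
    unfolding mN int \<rho>_def N by simp
  also have "\<dots> \<le> (LINT x|lborel. indicator ?Q x * (V x * (norm (u x))\<^sup>2)) + pi\<^sup>2 / R\<^sup>2 / 2 *
      (R\<^sup>2 / 6 * (\<Sum>i\<in>UNIV. LINT x|lborel. indicator ?Q x * (norm (g i x))\<^sup>2))"
    by (intro add_left_mono mult_left_mono poincare_box[OF _ _ u g wp R ab]) simp_all
  also have "\<dots> = (LINT x|lborel. indicator ?Q x * (V x * (norm (u x))\<^sup>2)) +
      pi\<^sup>2 / 12 * (\<Sum>i\<in>UNIV. LINT x|lborel. indicator ?Q x * (norm (g i x))\<^sup>2)"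
    using R by simp
  also have "\<dots> \<le> (LINT x|lborel. indicator ?Q x * (V x * (norm (u x))\<^sup>2)) +
      1 * (\<Sum>i\<in>UNIV. LINT x|lborel. indicator ?Q x * (norm (g i x))\<^sup>2)"
    using pi_sq_le_12 by (intro add_left_mono mult_right_mono) (auto intro!: sum_nonneg)
  also have "pi\<^sup>2 / R\<^sup>2 * \<rho> / (pi\<^sup>2 / R\<^sup>2 + 2 * m) = pi\<^sup>2 / (pi\<^sup>2 + 2 * R\<^sup>2 * m) * \<rho>"
  proof -
    have "pi\<^sup>2 / R\<^sup>2 * \<rho> / (pi\<^sup>2 / R\<^sup>2 + 2 * m) = (R\<^sup>2 * (pi\<^sup>2 / R\<^sup>2 * \<rho>)) / (R\<^sup>2 * (pi\<^sup>2 / R\<^sup>2 + 2 * m))"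
      using R by (subst mult_divide_mult_cancel_left) auto
    then show ?thesis using R by (simp add: distrib_left mult_ac)
  qed
  finally show ?thesis by simp
qed

lemma cube_eq_box: "cube R y = box y (\<chi> i. y $ i + R)"
proof (intro set_eqI iffI)
  fix x assume "x \<in> box y (\<chi> i. y $ i + R)"
  then have "x - y \<in> {x. \<forall>i. 0 < x $ i \<and> x $ i < R}" by (auto simp: mem_box_cart algebra_simps)
  then show "x \<in> cube R y" unfolding cube_def by (intro image_eqI[of _ _ "x - y"]) auto
qed (auto simp: cube_def mem_box_cart)

lemma countable_scaled_lattice: "countable (scaled_lattice R :: (real ^ 'n) set)"
proof -
  have "{k :: real ^ 'n. \<forall>i. k $ i \<in> \<int>} \<subseteq> (\<lambda>f :: 'n \<Rightarrow> int. \<chi> i. of_int (f i)) ` UNIV"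
  proof
    fix k :: "real ^ 'n" assume "k \<in> {k. \<forall>i. k $ i \<in> \<int>}"
    then have "k = (\<chi> i. of_int \<lfloor>k $ i\<rfloor>)" by (auto simp: vec_eq_iff elim!: Ints_cases)
    then show "k \<in> (\<lambda>f :: 'n \<Rightarrow> int. \<chi> i. of_int (f i)) ` UNIV"
      by (intro image_eqI[of _ _ "\<lambda>i. \<lfloor>k $ i\<rfloor>"]) simp_all
  qed
  then have "countable {k :: real ^ 'n. \<forall>i. k $ i \<in> \<int>}"
    by (rule countable_subset) simp
  then show ?thesis unfolding scaled_lattice_def by simp
qed

lemma disjoint_cubes:
  assumes "R > 0"
  shows "disjoint_family_on (cube R) (scaled_lattice R)"
  unfolding disjoint_family_on_def
proof (intro ballI impI)
  fix y z :: "real ^ 'n" assume yz: "y \<in> scaled_lattice R" "z \<in> scaled_lattice R" "y \<noteq> z"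
  have fl: "y = (\<chi> i. R * of_int \<lfloor>x $ i / R\<rfloor>)" if y: "y \<in> scaled_lattice R" and x: "x \<in> cube R y"
      for x y :: "real ^ 'n"
  proof -
    obtain k where k: "y = R *\<^sub>R k" "\<And>i. k $ i \<in> \<int>" using y by (auto simp: scaled_lattice_def)
    have "k $ i = of_int \<lfloor>x $ i / R\<rfloor>" for i
    proof -
      obtain n where n: "k $ i = of_int n" using k(2)[of i] by (auto elim: Ints_cases)
      have "R * of_int n < x $ i" "x $ i < R * of_int n + R"
        using x by (auto simp: cube_eq_box mem_box_cart k(1) simp flip: n)
      then have "\<lfloor>x $ i / R\<rfloor> = n" using assms by (intro floor_unique) (auto simp: field_simps)
      then show ?thesis by (simp add: n)
    qed
    then show ?thesis by (simp add: vec_eq_iff k(1))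
  qed
  show "cube R y \<inter> cube R z = {}"
    using fl[OF yz(1)] fl[OF yz(2)] yz(3) by (metis disjoint_iff)
qed

lemma AE_in_cubes:
  assumes R: "R > 0"
  shows "AE x in (lborel :: (real ^ 'n) measure). x \<in> (\<Union>y\<in>scaled_lattice R. cube R y)"
proof -
  have "AE x in (lborel :: (real ^ 'n) measure). x $ i \<noteq> c" for i c
  proof -
    have "{x :: real ^ 'n. x $ i = c} \<in> null_sets lebesgue"
      using negligible_standard_hyperplane[of "axis i 1 :: real ^ 'n" c]
          by (simp add: negligible_iff_null_sets inner_axis Basis_real_def)
    then have "AE x in lebesgue. x \<notin> {x :: real ^ 'n. x $ i = c}" by (rule AE_not_in)
    then show ?thesis by (simp add: AE_completion_iff)
  qed
  then have "AE x in (lborel :: (real ^ 'n) measure). \<forall>i. \<forall>m::int. x $ i \<noteq> R * of_int m"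
    unfolding AE_all_countable by blast
  then show ?thesis
  proof eventually_elim
    case (elim x)
    let ?k = "\<chi> i. of_int \<lfloor>x $ i / R\<rfloor> :: real ^ 'n"
    have "x \<in> cube R (R *\<^sub>R ?k)"
      unfolding cube_eq_box mem_box_cart
    proof
      fix i
      have "of_int \<lfloor>x $ i / R\<rfloor> \<le> x $ i / R" "x $ i / R < of_int \<lfloor>x $ i / R\<rfloor> + 1" by linarith+
      then have "R * of_int \<lfloor>x $ i / R\<rfloor> \<le> R * (x $ i / R)" "R * (x $ i / R) < R * (of_int \<lfloor>x $ i / R\<rfloor> + 1)"
        using R by (auto intro: mult_left_mono mult_strict_left_mono simp del: times_divide_eq_right)
      then have "R * of_int \<lfloor>x $ i / R\<rfloor> \<le> x $ i" "x $ i < R * of_int \<lfloor>x $ i / R\<rfloor> + R"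
        using R by (simp_all add: distrib_left)
      moreover have "x $ i \<noteq> R * of_int \<lfloor>x $ i / R\<rfloor>" using elim by blast
      ultimately show "(R *\<^sub>R ?k) $ i < x $ i \<and> x $ i < (\<chi> i. (R *\<^sub>R ?k) $ i + R) $ i" by simp
    qed
    moreover have "R *\<^sub>R ?k \<in> scaled_lattice R" unfolding scaled_lattice_def by auto
    ultimately show ?case by blast
  qed
qed

text \<open>
  The lattice cubes are disjoint and cover almost everything, so integrals split into a sum over them.
\<close>

lemma nn_integral_cubes:
  fixes F :: "real ^ 'n \<Rightarrow> ennreal"
  assumes [measurable]: "F \<in> borel_measurable borel" and R: "R > 0"
  shows "(\<integral>\<^sup>+x. F x \<partial>lborel) = (\<integral>\<^sup>+y. (\<integral>\<^sup>+x. F x * indicator (cube R y) x \<partial>lborel) \<partial>count_space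
      (scaled_lattice R))"
proof -
  let ?M = "density lborel F"
  let ?U = "\<Union>y\<in>scaled_lattice R. cube R y"
  have [measurable]: "cube R y \<in> sets borel" for y by (simp add: cube_eq_box)
  have U: "?U \<in> sets borel"
    by (rule sets.countable_UN'[OF countable_scaled_lattice]) auto
  have "(\<integral>\<^sup>+x. F x \<partial>lborel) = (\<integral>\<^sup>+x. F x * indicator ?U x \<partial>lborel)"
    by (rule nn_integral_cong_AE) (use AE_in_cubes[OF R] in \<open>auto elim!: eventually_mono\<close>)
  also have "\<dots> = emeasure ?M ?U" using U by (subst emeasure_density) auto
  also have "\<dots> = (\<integral>\<^sup>+y. emeasure ?M (cube R y) \<partial>count_space (scaled_lattice R))"
    by (rule emeasure_UN_countable[OF _ countable_scaled_lattice disjoint_cubes[OF R]]) simp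
  finally show ?thesis by (simp add: emeasure_density)
qed

lemma form_bound_borel:
  fixes u :: "real ^ 'n \<Rightarrow> complex" and g :: "'n \<Rightarrow> real ^ 'n \<Rightarrow> complex" and V :: "real ^ 'n \<Rightarrow> real"
  assumes [measurable]: "u \<in> borel_measurable borel" "\<And>i. g i \<in> borel_measurable borel" "V \<in> borel_measurable
      borel"
    and u: "integrable lborel (\<lambda>x. (norm (u x))\<^sup>2)" and g: "\<And>i. integrable lborel (\<lambda>x. (norm (g i x))\<^sup>2)"
    and Vu: "integrable lborel (\<lambda>x. V x * (norm (u x))\<^sup>2)"
    and wp: "\<And>i \<phi>. test_function \<phi> \<Longrightarrow> (LINT x|lborel. partial i \<phi> x *\<^sub>R u x)
        = - (LINT x|lborel. \<phi> x *\<^sub>R g i x)"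
    and R: "R > 0" and V0: "AE x in lborel. 0 \<le> V x"
    and Vm: "\<And>y. y \<in> scaled_lattice R \<Longrightarrow> AE x in lborel. x \<in> cube R y \<longrightarrow> V x \<le> m y"
    and \<kappa>0: "0 \<le> \<kappa>"
    and \<kappa>: "\<And>y. y \<in> scaled_lattice R \<Longrightarrow> \<kappa> \<le> pi\<^sup>2 / (pi\<^sup>2 + 2 * R\<^sup>2 * m y) *
        ((LINT x|lborel. indicator (cube R y) x * V x) / R ^ CARD('n))"
  shows "\<kappa> * (LINT x|lborel. (norm (u x))\<^sup>2)
    \<le> (LINT x|lborel. V x * (norm (u x))\<^sup>2) + (\<Sum>i\<in>UNIV. LINT x|lborel. (norm (g i x))\<^sup>2)"
proof -
  let ?F = "\<lambda>x. \<kappa> * (norm (u x))\<^sup>2" and ?H = "\<lambda>x. V x * (norm (u x))\<^sup>2 + (\<Sum>i\<in>UNIV. (norm (g i x))\<^sup>2)"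
  have Fi: "integrable lborel ?F" and Hi: "integrable lborel ?H" using u Vu g by auto
  have H0: "AE x in lborel. 0 \<le> ?H x"
    using V0 by eventually_elim (auto intro!: add_nonneg_nonneg sum_nonneg)
  have Qi: "integrable lborel (\<lambda>x. indicator (cube R y) x * f x)" if "integrable lborel f"
      for f :: "real ^ 'n \<Rightarrow> real" and y
    using integrable_mult_indicator[OF _ that, of "cube R y"] by (simp add: cube_eq_box)
  have cube: "(\<integral>\<^sup>+x. ennreal (?F x) * indicator (cube R y) x \<partial>lborel)
      \<le> (\<integral>\<^sup>+x. ennreal (?H x) * indicator (cube R y) x \<partial>lborel)"
    if y: "y \<in> scaled_lattice R" for y
  proof -
    let ?Q = "cube R y"
    let ?A = "LINT x|lborel. indicator ?Q x * (norm (u x))\<^sup>2"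
    have nn: "(\<integral>\<^sup>+x. ennreal (f x) * indicator ?Q x \<partial>lborel) = ennreal (LINT x|lborel. indicator ?Q x * f x)"
      if "integrable lborel f" "AE x in lborel. 0 \<le> f x" for f :: "real ^ 'n \<Rightarrow> real"
    proof -
      have "(\<integral>\<^sup>+x. ennreal (f x) * indicator ?Q x \<partial>lborel) = (\<integral>\<^sup>+x. ennreal (indicator ?Q x * f x) \<partial>lborel)"
        by (intro nn_integral_cong) (auto split: split_indicator)
      also have "\<dots> = ennreal (LINT x|lborel. indicator ?Q x * f x)"
        using that(2) by (intro nn_integral_eq_integral Qi that(1)) (auto elim!: eventually_mono)
      finally show ?thesis .
    qed
    have "AE x in lborel. x \<in> box y (\<chi> i. y $ i + R) \<longrightarrow> 0 \<le> V x \<and> V x \<le> m y"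
      using V0 Vm[OF y] by eventually_elim (auto simp: cube_eq_box)
    from form_bound_box[OF assms(1-3) u g wp R _ this]
    have "pi\<^sup>2 / (pi\<^sup>2 + 2 * R\<^sup>2 * m y) * ((LINT x|lborel. indicator ?Q x * V x) / R ^ CARD('n)) * ?A
      \<le> (LINT x|lborel. indicator ?Q x * (V x * (norm (u x))\<^sup>2))
          + (\<Sum>i\<in>UNIV. LINT x|lborel. indicator ?Q x * (norm (g i x))\<^sup>2)"
      by (simp add: cube_eq_box)
    moreover have "\<kappa> * ?A \<le> pi\<^sup>2 / (pi\<^sup>2 + 2 * R\<^sup>2 * m y) * ((LINT x|lborel. indicator ?Q x * V x) / R ^
        CARD('n)) * ?A"
      by (intro mult_right_mono \<kappa>[OF y]) (auto intro!: integral_nonneg_AE)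
    moreover have "(LINT x|lborel. indicator ?Q x * ?F x) = \<kappa> * ?A"
      by (subst integral_mult_right_zero[symmetric]) (simp add: mult_ac)
    moreover have "(LINT x|lborel. indicator ?Q x * ?H x)
        = (LINT x|lborel. indicator ?Q x * (V x * (norm (u x))\<^sup>2))
            + (\<Sum>i\<in>UNIV. LINT x|lborel. indicator ?Q x * (norm (g i x))\<^sup>2)"
      unfolding distrib_left sum_distrib_left
        Bochner_Integration.integral_add[OF Qi[OF Vu] Bochner_Integration.integrable_sum[OF Qi[OF g]]]
        Bochner_Integration.integral_sum[OF Qi[OF g]] ..
    ultimately show ?thesis
      using nn[OF Fi] nn[OF Hi H0] \<kappa>0 by (simp add: ennreal_leI)
  qed
  have "ennreal (LINT x|lborel. ?F x) = (\<integral>\<^sup>+x. ennreal (?F x) \<partial>lborel)"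
    using \<kappa>0 by (intro nn_integral_eq_integral[symmetric] Fi) auto
  also have "\<dots> \<le> (\<integral>\<^sup>+x. ennreal (?H x) \<partial>lborel)"
    by (subst (1 2) nn_integral_cubes[OF _ R]) (auto intro!: nn_integral_mono cube)
  also have "\<dots> = ennreal (LINT x|lborel. ?H x)"
    by (intro nn_integral_eq_integral Hi H0)
  finally have "(LINT x|lborel. ?F x) \<le> (LINT x|lborel. ?H x)"
    by (rule ennreal_le_iff[THEN iffD1, rotated]) (rule integral_nonneg_AE[OF H0])
  then show ?thesis using Vu g by simp
qed

section \<open>Complete positive forms\<close>

lemma nonneg_quadratic:
  fixes A B C :: real
  assumes "\<And>t. 0 \<le> A + 2 * t * B + t\<^sup>2 * C"
  shows "B\<^sup>2 \<le> A * C"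
proof (cases "C = 0")
  case True
  have "B = 0"
  proof (rule ccontr)
    assume "B \<noteq> 0"
    then show False using assms[of "- (A + 1) / (2 * B)"] True by (simp add: field_simps)
  qed
  with True show ?thesis by simp
next
  case False
  have "C > 0"
  proof (rule ccontr)
    assume "\<not> C > 0"
    with False have C: "C < 0" by simp
    define t where "t = (\<bar>A\<bar> + 1 + 2 * \<bar>B\<bar>) / - C + 1"
    have t: "t \<ge> 1" using C by (simp add: t_def divide_nonneg_neg)
    have tC: "t * C = - (\<bar>A\<bar> + 1 + 2 * \<bar>B\<bar>) + C" using C by (simp add: t_def field_simps)
    have "A + 2 * t * B + t\<^sup>2 * C = A + t * (2 * B + t * C)" by (simp add: power2_eq_square algebra_simps)
    also have "\<dots> \<le> A + t * (- (\<bar>A\<bar> + 1))" using tC t C by (intro add_left_mono mult_left_mono) auto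
    also have "\<dots> \<le> A + 1 * (- (\<bar>A\<bar> + 1))" using t by (intro add_left_mono mult_right_mono_neg) auto
    also have "\<dots> < 0" by simp
    finally show False using assms[of t] by simp
  qed
  then show ?thesis using assms[of "- B / C"] by (simp add: power2_eq_square field_simps)
qed

text \<open>
  A positive semidefinite Hermitian form on a set \<open>D\<close> closed under the linear combinations
  \<open>comb u c v\<close>, to be read as \<open>u + c v\<close>. Vector space laws for \<open>comb\<close> are not required: elements are only ever
  distinguished through the form, so functions that agree almost everywhere need not be identified.
\<close>

locale pos_form =
  fixes D :: "'a set" and comb :: "'a \<Rightarrow> complex \<Rightarrow> 'a \<Rightarrow> 'a" and q :: "'a \<Rightarrow> 'a \<Rightarrow> complex"
  assumes comb_D: "u \<in> D \<Longrightarrow> v \<in> D \<Longrightarrow> comb u c v \<in> D"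
    and q_left: "u \<in> D \<Longrightarrow> v \<in> D \<Longrightarrow> w \<in> D \<Longrightarrow> q (comb u c v) w = q u w + c * q v w"
    and q_sym: "u \<in> D \<Longrightarrow> v \<in> D \<Longrightarrow> q v u = cnj (q u v)"
    and q_pos: "u \<in> D \<Longrightarrow> 0 \<le> Re (q u u)"
begin

lemma q_right: "u \<in> D \<Longrightarrow> v \<in> D \<Longrightarrow> w \<in> D \<Longrightarrow> q w (comb u c v) = q w u + cnj c * q w v"
  using q_left[of u v w c] q_sym[of "comb u c v" w] q_sym[of u w] q_sym[of v w] comb_D[of u v c]
  by simp

lemma q_comb: "u \<in> D \<Longrightarrow> v \<in> D \<Longrightarrow>
    Re (q (comb u (complex_of_real t) v) (comb u (complex_of_real t) v))
        = Re (q u u) + 2 * t * Re (q u v) + t\<^sup>2 * Re (q v v)"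
  using comb_D[of u v "complex_of_real t"] q_sym[of u v]
  by (simp add: q_left q_right power2_eq_square algebra_simps)

lemma cauchy_schwarz: 
  assumes "u \<in> D" "v \<in> D" shows "(Re (q u v))\<^sup>2 \<le> Re (q u u) * Re (q v v)"
proof (rule nonneg_quadratic)
  fix t show "0 \<le> Re (q u u) + 2 * t * Re (q u v) + t\<^sup>2 * Re (q v v)"
    using q_pos[OF comb_D[OF assms, of "complex_of_real t"]] q_comb[OF assms, of t] by simp
qed

end

text \<open>
  In addition, \<open>D\<close> is nonempty and sequences that are Cauchy for the seminorm of the form converge.
\<close>

locale complete_form = pos_form +
  assumes nonempty: "D \<noteq> {}"
    and complete: "\<And>X :: nat \<Rightarrow> 'a. (\<And>n. X n \<in> D) \<Longrightarrow>
      (\<And>e. e > 0 \<Longrightarrow> \<exists>N. \<forall>i\<ge>N. \<forall>j\<ge>N. Re (q (comb (X i) (-1) (X j)) (comb (X i) (-1) (X j))) < e) \<Longrightarrow>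
      \<exists>L\<in>D. (\<lambda>n. Re (q (comb (X n) (-1) L) (comb (X n) (-1) L))) \<longlonglongrightarrow> 0"
begin

text \<open>
  The representation theorem of Riesz for conjugate-linear functionals. A minimizing sequence of
  \<open>J v = q v v - 2 Re (l v)\<close> is Cauchy by the parallelogram law (\<open>par\<close>), and the first variation of \<open>J\<close>
  vanishes at its limit.
\<close>

lemma riesz:
  assumes l: "\<And>u v c. u \<in> D \<Longrightarrow> v \<in> D \<Longrightarrow> l (comb u c v) = l u + cnj c * l v"
    and bdd: "\<And>v. v \<in> D \<Longrightarrow> (Re (l v))\<^sup>2 \<le> K * Re (q v v)"
  shows "\<exists>u\<in>D. \<forall>v\<in>D. q u v = l v"
proof -
  define J where "J v = Re (q v v) - 2 * Re (l v)" for v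
  have Jlow: "- \<bar>K\<bar> \<le> J v" if v: "v \<in> D" for v
  proof -
    let ?x = "Re (q v v)"
    have "(Re (l v))\<^sup>2 \<le> \<bar>K\<bar> * ?x"
      using bdd[OF v] q_pos[OF v] by (meson abs_ge_self mult_right_mono order_trans)
    also have "\<dots> \<le> ((\<bar>K\<bar> + ?x) / 2)\<^sup>2"
      using zero_le_power2[of "\<bar>K\<bar> - ?x"] by (simp add: power2_eq_square field_simps)
    finally have "\<bar>Re (l v)\<bar> \<le> (\<bar>K\<bar> + ?x) / 2"
      using q_pos[OF v] by (simp add: abs_le_square_iff[symmetric])
    then show ?thesis unfolding J_def by simp
  qed
  define i where "i = (INF v\<in>D. J v)"
  have bdd_J: "bdd_below (J ` D)" using Jlow by (auto intro!: bdd_belowI2)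
  have i_le: "i \<le> J v" if "v \<in> D" for v unfolding i_def by (rule cINF_lower[OF bdd_J that])
  have "\<exists>v\<in>D. J v < i + 1 / (real n + 1)" for n
    using cINF_less_iff[OF nonempty bdd_J, of "i + 1 / (real n + 1)"] unfolding i_def by simp
  then obtain X where X: "\<And>n. X n \<in> D" "\<And>n. J (X n) < i + 1 / (real n + 1)" by metis
  have J_comb: "J (comb u (complex_of_real t) v) = J u + 2 * t * (Re (q u v) - Re (l v)) + t\<^sup>2 * Re (q v v)"
    if "u \<in> D" "v \<in> D" for u v t
    using that by (simp add: J_def q_comb l algebra_simps)
  have par: "Re (q (comb x (-1) y) (comb x (-1) y)) \<le> 2 * (J x - i) + 2 * (J y - i)" if xy: "x \<in> D" "y \<in> D"
      for x y
  proof -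
    define d where "d = comb x (-1) y"
    have d: "d \<in> D" unfolding d_def using xy comb_D by simp
    have "i \<le> J (comb y (complex_of_real (1/2)) d)" by (rule i_le[OF comb_D[OF xy(2) d]])
    also have "\<dots> = J y + (Re (q y d) - Re (l d)) + Re (q d d) / 4"
      by (subst J_comb[OF xy(2) d]) (simp add: power2_eq_square)
    finally have 1: "i \<le> J y + (Re (q y d) - Re (l d)) + Re (q d d) / 4" .
    have 2: "Re (q y d) = Re (q y x) - Re (q y y)"
      unfolding d_def using q_right[OF xy xy(2), of "-1"] by simp
    have 3: "Re (l d) = Re (l x) - Re (l y)" unfolding d_def using l[OF xy, of "-1"] by simp
    have 4: "Re (q d d) = Re (q x x) - 2 * Re (q x y) + Re (q y y)"
      unfolding d_def using q_comb[OF xy, of "-1"] by simp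
    have 5: "Re (q x y) = Re (q y x)" using q_sym[OF xy] by simp
    have "Re (q d d) \<le> 2 * (J x - i) + 2 * (J y - i)"
      using 1 2 3 4 5 unfolding J_def by argo
    then show ?thesis by (simp only: d_def)
  qed
  have "\<exists>L\<in>D. (\<lambda>n. Re (q (comb (X n) (-1) L) (comb (X n) (-1) L))) \<longlonglongrightarrow> 0"
  proof (rule complete[OF X(1)])
    fix e :: real assume e: "e > 0"
    obtain N where "inverse (real (Suc N)) < e / 4"
      using reals_Archimedean[of "e / 4"] e by auto
    then have N: "1 / (real N + 1) < e / 4" by (simp add: inverse_eq_divide add.commute)
    have "Re (q (comb (X i) (-1) (X j)) (comb (X i) (-1) (X j))) < e" if "i \<ge> N" "j \<ge> N" for i j
    proof -
      have *: "J (X k) - (INF v\<in>D. J v) < e / 4" if "k \<ge> N" for k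
      proof -
        have "1 / (real k + 1) \<le> 1 / (real N + 1)" using that by (simp add: frac_le)
        then show ?thesis using X(2)[of k] N unfolding i_def by simp
      qed
      show ?thesis using par[OF X(1)[of i] X(1)[of j]] *[OF that(1)] *[OF that(2)] unfolding i_def by simp
    qed
    then show "\<exists>N. \<forall>i\<ge>N. \<forall>j\<ge>N. Re (q (comb (X i) (-1) (X j)) (comb (X i) (-1) (X j))) < e" by blast
  qed
  then obtain L where L: "L \<in> D" "(\<lambda>n. Re (q (comb (X n) (-1) L) (comb (X n) (-1) L))) \<longlonglongrightarrow> 0" by blast
  have re: "Re (q L w) = Re (l w)" if w: "w \<in> D" for w
  proof -
    have "(\<lambda>n. Re (q (X n) w)) \<longlonglongrightarrow> Re (q L w)"
    proof (rule LIM_zero_cancel, rule tendsto_rabs_zero_cancel)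
      have "(\<lambda>n. sqrt (Re (q (comb (X n) (-1) L) (comb (X n) (-1) L)) * Re (q w w))) \<longlonglongrightarrow> sqrt (0 * Re (q w w))"
        by (intro tendsto_intros L)
      then have lim: "(\<lambda>n. sqrt (Re (q (comb (X n) (-1) L) (comb (X n) (-1) L)) * Re (q w w))) \<longlonglongrightarrow> 0" by simp
      have b: "\<bar>Re (q (X n) w) - Re (q L w)\<bar> \<le> sqrt (Re (q (comb (X n) (-1) L) (comb (X n) (-1) L)) * Re (q w
          w))" for n
        using cauchy_schwarz[OF comb_D[OF X(1)[of n] L(1), of "-1"] w] q_left[OF X(1)[of n] L(1) w, of "-1"]
        by (intro real_le_rsqrt) simp
      show "(\<lambda>n. \<bar>Re (q (X n) w) - Re (q L w)\<bar>) \<longlonglongrightarrow> 0"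
        by (rule tendsto_sandwich[OF _ _ tendsto_const lim]) (use b in auto)
    qed
    then have lim: "(\<lambda>n. 1 / (real n + 1) + 2 * t * (Re (q (X n) w) - Re (l w)) + t\<^sup>2 * Re (q w w))
        \<longlonglongrightarrow> 0 + 2 * t * (Re (q L w) - Re (l w)) + t\<^sup>2 * Re (q w w)" for t
      by (intro tendsto_add tendsto_mult tendsto_diff tendsto_const LIMSEQ_inverse_real_of_nat[unfolded
          inverse_eq_divide of_nat_Suc add.commute[of 1]])
    have "0 \<le> 0 + 2 * t * (Re (q L w) - Re (l w)) + t\<^sup>2 * Re (q w w)" for t
    proof (rule LIMSEQ_le_const[OF lim], intro exI allI impI)
      fix n
      show "0 \<le> 1 / (real n + 1) + 2 * t * (Re (q (X n) w) - Re (l w)) + t\<^sup>2 * Re (q w w)"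
        using i_le[OF comb_D[OF X(1)[of n] w, of "complex_of_real t"]] J_comb[OF X(1)[of n] w, of t] X(2)[of
            n] by simp
    qed
    from nonneg_quadratic[OF this] show ?thesis by simp
  qed
  have "q L v = l v" if v: "v \<in> D" for v
  proof (rule complex_eqI)
    show "Re (q L v) = Re (l v)" by (rule re[OF v])
    \<comment> \<open>Since \<open>v + (\<i> - 1) v = \<i> v\<close>, the real parts at this vector give the imaginary parts at \<open>v\<close>.\<close>
    have "Re (q L (comb v (\<i> - 1) v)) = Re (l (comb v (\<i> - 1) v))" by (rule re[OF comb_D[OF v v]])
    then show "Im (q L v) = Im (l v)"
      unfolding q_right[OF v v L(1)] l[OF v v] by (simp add: re[OF v] algebra_simps)
  qed
  with L(1) show ?thesis by blast
qed

end

lemma complete_form_equiv: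
  assumes "complete_form D comb p" "pos_form D comb q"
    and le: "\<And>u. u \<in> D \<Longrightarrow> Re (p u u) \<le> B * Re (q u u)" "\<And>u. u \<in> D \<Longrightarrow> Re (q u u) \<le> C * Re (p u u)"
  shows "complete_form D comb q"
proof -
  interpret p: complete_form D comb p by fact
  interpret q: pos_form D comb q by fact
  show ?thesis
  proof
    show "D \<noteq> {}" by (rule p.nonempty)
    fix X :: "nat \<Rightarrow> 'a" assume X: "\<And>n. X n \<in> D"
      and cauchy: "\<And>e. e > 0 \<Longrightarrow> \<exists>N. \<forall>i\<ge>N. \<forall>j\<ge>N. Re (q (comb (X i) (-1) (X j)) (comb (X i) (-1) (X j))) < e"
    have le1: "Re (p u u) \<le> (\<bar>B\<bar> + 1) * Re (q u u)" if "u \<in> D" for u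
      using le(1)[OF that] q.q_pos[OF that] by (smt (verit) mult_right_mono)
    have "\<exists>L\<in>D. (\<lambda>n. Re (p (comb (X n) (-1) L) (comb (X n) (-1) L))) \<longlonglongrightarrow> 0"
    proof (rule p.complete[OF X])
      fix e :: real assume "e > 0"
      then have "e / (\<bar>B\<bar> + 1) > 0" by (intro divide_pos_pos) auto
      from cauchy[OF this] obtain N where
        N: "\<And>i j. i \<ge> N \<Longrightarrow> j \<ge> N \<Longrightarrow> Re (q (comb (X i) (-1) (X j)) (comb (X i) (-1) (X j))) < e / (\<bar>B\<bar> + 1)"
            by blast
      have "Re (p (comb (X i) (-1) (X j)) (comb (X i) (-1) (X j))) < e" if "i \<ge> N" "j \<ge> N" for i j
      proof -
        have "(\<bar>B\<bar> + 1) * Re (q (comb (X i) (-1) (X j)) (comb (X i) (-1) (X j))) < (\<bar>B\<bar> + 1) * (e / (\<bar>B\<bar>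
            + 1))"
          by (intro mult_strict_left_mono N[OF that]) auto
        also have "\<dots> = e" using abs_ge_zero[of B] by (simp add: add_nonneg_eq_0_iff)
        finally show ?thesis using le1[OF p.comb_D[OF X X, of i "-1" j]] by simp
      qed
      then show "\<exists>N. \<forall>i\<ge>N. \<forall>j\<ge>N. Re (p (comb (X i) (-1) (X j)) (comb (X i) (-1) (X j))) < e" by blast
    qed
    then obtain L where L: "L \<in> D" "(\<lambda>n. Re (p (comb (X n) (-1) L) (comb (X n) (-1) L))) \<longlonglongrightarrow> 0" by blast
    have "(\<lambda>n. Re (q (comb (X n) (-1) L) (comb (X n) (-1) L))) \<longlonglongrightarrow> 0"
    proof (rule tendsto_sandwich[OF _ _ tendsto_const])
      show "(\<lambda>n. C * Re (p (comb (X n) (-1) L) (comb (X n) (-1) L))) \<longlonglongrightarrow> 0"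
        using tendsto_mult_left[OF L(2), of C] by simp
    qed (use le(2) q.q_pos p.comb_D X L(1) in \<open>auto intro!: always_eventually\<close>)
    with L(1) show "\<exists>L\<in>D. (\<lambda>n. Re (q (comb (X n) (-1) L) (comb (X n) (-1) L))) \<longlonglongrightarrow> 0" by blast
  qed
qed

text \<open>
  Weak solvability of \<open>(A - z) u = l\<close> for complex \<open>z = x + \<i> y\<close> to the left of a lower bound of the
  form \<open>a\<close> of \<open>A\<close> relative to \<open>m\<close>. The form \<open>q = a - x m\<close> of \<open>T = A - x\<close> is positive and complete,
  and \<open>riesz\<close> gives the solution operator \<open>S = T\<^sup>-\<^sup>1\<close>. The form \<open>r\<close> of \<open>T + y\<^sup>2 S\<close> is equivalent to
  \<open>q\<close>, so \<open>(T + y\<^sup>2 S) w = l\<close> has a solution as well. Then \<open>u = w + \<i> y S w\<close> satisfies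
  \<open>(T - \<i> y) u = l\<close>.
\<close>

lemma weak_resolvent:
  assumes am: "complete_form D comb (\<lambda>u v. a u v + m u v)" and a: "pos_form D comb a"
      and m: "pos_form D comb m"
    and low: "\<And>u. u \<in> D \<Longrightarrow> \<kappa> * Re (m u u) \<le> Re (a u u)"
    and z: "Re z < \<kappa>"
    and l: "\<And>u v c. u \<in> D \<Longrightarrow> v \<in> D \<Longrightarrow> l (comb u c v) = l u + cnj c * l v"
    and bdd: "\<And>v. v \<in> D \<Longrightarrow> (Re (l v))\<^sup>2 \<le> K * Re (m v v)"
    and K: "0 \<le> K"
  shows "\<exists>u\<in>D. \<forall>v\<in>D. a u v - z * m u v = l v"
proof -
  interpret am: complete_form D comb "\<lambda>u v. a u v + m u v" by fact
  interpret a: pos_form D comb a by fact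
  interpret m: pos_form D comb m by fact
  define x y c where "x = Re z" and "y = Im z" and "c = \<kappa> - x"
  have c: "c > 0" using z by (simp add: c_def x_def)
  define q where "q u v = a u v - complex_of_real x * m u v" for u v
  have qm: "c * Re (m u u) \<le> Re (q u u)" if "u \<in> D" for u
    using low[OF that] by (simp add: q_def c_def algebra_simps)
  have posq: "pos_form D comb q"
  proof
    fix u assume u: "u \<in> D"
    show "0 \<le> Re (q u u)" using qm[OF u] m.q_pos[OF u] c by (meson mult_nonneg_nonneg less_imp_le order_trans)
  next
    fix u v w :: 'a and d assume D: "u \<in> D" "v \<in> D"
    show "comb u d v \<in> D" by (rule a.comb_D[OF D])
    show "q v u = cnj (q u v)" using a.q_sym[OF D] m.q_sym[OF D] by (simp add: q_def)
    assume w: "w \<in> D"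
    show "q (comb u d v) w = q u w + d * q v w"
      using a.q_left[OF D w] m.q_left[OF D w] by (simp add: q_def algebra_simps)
  qed
  have "complete_form D comb q"
  proof (rule complete_form_equiv[OF am posq])
    fix u assume u: "u \<in> D"
    let ?a = "Re (a u u)" and ?m = "Re (m u u)"
    have m0: "0 \<le> ?m" and a0: "0 \<le> ?a" by (rule m.q_pos[OF u], rule a.q_pos[OF u])
    have q: "Re (q u u) = ?a - x * ?m" by (simp add: q_def)
    have mq: "?m \<le> Re (q u u) / c" using qm[OF u] c by (simp add: field_simps)
    have "?a + ?m = Re (q u u) + (x + 1) * ?m" by (simp add: q algebra_simps)
    also have "\<dots> \<le> Re (q u u) + (\<bar>x\<bar> + 1) * (Re (q u u) / c)"
      using mq m0 by (intro add_left_mono mult_mono) auto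
    finally show "Re (a u u + m u u) \<le> (1 + (\<bar>x\<bar> + 1) / c) * Re (q u u)" by (simp add: algebra_simps)
    have "- x * ?m \<le> \<bar>x\<bar> * ?m" using m0 by (intro mult_right_mono) auto
    moreover have "0 \<le> \<bar>x\<bar> * ?a" using a0 by simp
    ultimately show "Re (q u u) \<le> (1 + \<bar>x\<bar>) * Re (a u u + m u u)"
      using m0 by (simp add: q algebra_simps)
  qed
  then interpret q: complete_form D comb q .
  have mq: "(Re (m u v))\<^sup>2 \<le> (Re (m u u) / c) * Re (q v v)" if "u \<in> D" "v \<in> D" for u v
  proof -
    have "(Re (m u v))\<^sup>2 \<le> Re (m u u) * Re (m v v)" by (rule m.cauchy_schwarz[OF that])
    also have "\<dots> \<le> Re (m u u) * (Re (q v v) / c)"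
      using qm[OF that(2)] c m.q_pos[OF that(1)] by (intro mult_left_mono) (simp_all add: field_simps)
    finally show ?thesis by simp
  qed
  have "\<exists>w\<in>D. \<forall>v\<in>D. q w v = m u v" if "u \<in> D" for u
    by (rule q.riesz[where K="Re (m u u) / c"]) (use that mq m.q_right in auto)
  then obtain S where S: "\<And>u. u \<in> D \<Longrightarrow> S u \<in> D" "\<And>u v. u \<in> D \<Longrightarrow> v \<in> D \<Longrightarrow> q (S u) v = m u v"
    by metis
  have S_shift: "m (S u) v = m u (S v)" if "u \<in> D" "v \<in> D" for u v
  proof -
    have "m (S u) v = cnj (m v (S u))" using m.q_sym[of v "S u"] S that by simp
    also have "\<dots> = cnj (q (S v) (S u))" using S that by simp
    also have "\<dots> = q (S u) (S v)" using q.q_sym[of "S v" "S u"] S that by simp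
    also have "\<dots> = m u (S v)" using S that by simp
    finally show ?thesis .
  qed
  have S_bd: "Re (m (S u) u) \<le> Re (m u u) / c" "0 \<le> Re (m (S u) u)" if u: "u \<in> D" for u
  proof -
    let ?t = "Re (q (S u) (S u))"
    have t: "Re (m (S u) u) = ?t" using S_shift[OF u u] S(2)[OF u S(1)[OF u]] by simp
    have t0: "0 \<le> ?t" by (rule q.q_pos[OF S(1)[OF u]])
    then show "0 \<le> Re (m (S u) u)" by (simp add: t)
    have "?t * ?t \<le> (Re (m u u) / c) * ?t"
      using mq[OF u S(1)[OF u]] S(2)[OF u S(1)[OF u]] by (simp add: power2_eq_square)
    moreover have "0 \<le> Re (m u u) / c" using m.q_pos[OF u] c by simp
    ultimately show "Re (m (S u) u) \<le> Re (m u u) / c"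
      unfolding t using t0 mult_right_le_imp_le[of ?t ?t "Re (m u u) / c"] by (cases "?t = 0") simp_all
  qed
  define r where "r u v = q u v + complex_of_real (y\<^sup>2) * m (S u) v" for u v
  have r0: "Re (r u u) = Re (q u u) + y\<^sup>2 * Re (m (S u) u)" for u by (simp add: r_def)
  have posr: "pos_form D comb r"
  proof
    fix u v w :: 'a and d assume D: "u \<in> D" "v \<in> D"
    show "comb u d v \<in> D" by (rule a.comb_D[OF D])
    show "r v u = cnj (r u v)"
      using q.q_sym[OF D] m.q_sym[OF S(1)[OF D(1)] D(2)] S_shift[OF D(2,1)] by (simp add: r_def)
    show "0 \<le> Re (r u u)" unfolding r0 using q.q_pos[OF D(1)] S_bd(2)[OF D(1)] by simp
    assume w: "w \<in> D"
    have "m (S (comb u d v)) w = m (S u) w + d * m (S v) w"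
      using S_shift[OF a.comb_D[OF D] w] S_shift[OF D(1) w] S_shift[OF D(2) w] m.q_left[OF D S(1)[OF w]]
          by simp
    then show "r (comb u d v) w = r u w + d * r v w"
      using q.q_left[OF D w] by (simp add: r_def algebra_simps)
  qed
  have "complete_form D comb r"
  proof (rule complete_form_equiv[OF q.complete_form_axioms posr])
    fix u assume u: "u \<in> D"
    have y: "0 \<le> y\<^sup>2" by simp
    show "Re (q u u) \<le> 1 * Re (r u u)" unfolding r0 using mult_nonneg_nonneg[OF y S_bd(2)[OF u]] by simp
    have "Re (m (S u) u) \<le> Re (q u u) / c / c"
      using S_bd(1)[OF u] qm[OF u] c by (simp add: field_simps) (smt (verit, best) mult.commute
          mult_left_mono)
    from mult_left_mono[OF this y]
    show "Re (r u u) \<le> (1 + y\<^sup>2 / c / c) * Re (q u u)" unfolding r0 by (simp add: algebra_simps)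
  qed
  then interpret r: complete_form D comb r .
  have "\<exists>w\<in>D. \<forall>v\<in>D. r w v = l v"
  proof (rule r.riesz[where K="K / c"])
    fix v assume v: "v \<in> D"
    have "(Re (l v))\<^sup>2 \<le> K * Re (m v v)" by (rule bdd[OF v])
    also have "\<dots> \<le> K * (Re (r v v) / c)"
    proof (intro mult_left_mono K)
      have "c * Re (m v v) \<le> Re (r v v)" unfolding r0
        using qm[OF v] mult_nonneg_nonneg[OF zero_le_power2 S_bd(2)[OF v]] by (rule add_increasing2[rotated])
      then show "Re (m v v) \<le> Re (r v v) / c" using c by (simp add: field_simps)
    qed
    finally show "(Re (l v))\<^sup>2 \<le> K / c * Re (r v v)" by simp
  qed (rule l)
  then obtain w where w: "w \<in> D" "\<And>v. v \<in> D \<Longrightarrow> r w v = l v" by blast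
  let ?u = "comb w (\<i> * complex_of_real y) (S w)"
  have Sw: "S w \<in> D" by (rule S(1)[OF w(1)])
  have z_eq: "z = complex_of_real x + \<i> * complex_of_real y" by (simp add: x_def y_def complex_eq)
  have "a ?u v - z * m ?u v = l v" if v: "v \<in> D" for v
  proof -
    have qa: "a u v = q u v + complex_of_real x * m u v" for u by (simp add: q_def)
    have "a ?u v - z * m ?u v = q w v + \<i> * complex_of_real y * q (S w) v
        - \<i> * complex_of_real y * (m w v + \<i> * complex_of_real y * m (S w) v)"
      unfolding a.q_left[OF w(1) Sw v] m.q_left[OF w(1) Sw v] unfolding qa z_eq by (simp add: algebra_simps)
    also have "\<dots> = r w v" unfolding S(2)[OF w(1) v] r_def by (simp add: algebra_simps power2_eq_square)
    finally show ?thesis using w(2)[OF v] by simp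
  qed
  then show ?thesis using a.comb_D[OF w(1) Sw] by blast
qed

section \<open>The Hilbert space of square integrable functions and weak derivatives\<close>

text \<open>
  Completeness of \<open>L\<^sup>2\<close>, together with almost everywhere convergence along a sequence \<open>r\<close> of indices.
\<close>

lemma L2_complete:
  fixes F :: "nat \<Rightarrow> 'a \<Rightarrow> 'b::{real_inner, banach, second_countable_topology}"
  assumes meas [measurable]: "\<And>n. F n \<in> borel_measurable M"
    and F2: "\<And>n. integrable M (\<lambda>x. (norm (F n x))\<^sup>2)"
    and cauchy: "\<And>e. e > 0 \<Longrightarrow> \<exists>N. \<forall>i\<ge>N. \<forall>j\<ge>N. (LINT x|M. (norm (F i x - F j x))\<^sup>2) < e"
  obtains G r where "G \<in> borel_measurable M" "integrable M (\<lambda>x. (norm (G x))\<^sup>2)"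
    "(\<lambda>n. LINT x|M. (norm (F n x - G x))\<^sup>2) \<longlonglongrightarrow> 0"
    "AE x in M. (\<lambda>k. F (r k) x) \<longlonglongrightarrow> G x"
proof -
  let ?I = "\<lambda>i j. LINT x|M. (norm (F i x - F j x))\<^sup>2"
  have int: "integrable M (\<lambda>x. (norm (F i x - F j x))\<^sup>2)" for i j
    by (rule integrable_norm_diff_sq(1)[OF meas meas F2 F2])
  have nnI: "(\<integral>\<^sup>+x. ennreal ((norm (F i x - F j x))\<^sup>2) \<partial>M) = ennreal (?I i j)" for i j
    by (rule nn_integral_eq_integral[OF int]) simp
  have "\<exists>N. \<forall>i\<ge>N. \<forall>j\<ge>N. ?I i j < (1/4) ^ k" for k by (rule cauchy) simp
  then obtain N where N: "\<And>k i j. i \<ge> N k \<Longrightarrow> j \<ge> N k \<Longrightarrow> ?I i j < (1/4) ^ k" by metis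
  \<comment> \<open>The maximum of the first bounds \<open>N l\<close> is replaced by their sum; adding \<open>k\<close> makes \<open>r k \<ge> k\<close>.\<close>
  define r where "r k = (\<Sum>l\<le>k. N l) + k" for k
  have rN: "r k \<ge> N k" for k
    unfolding r_def using member_le_sum[of k "{..k}" N] by simp
  have rSuc: "r (Suc k) \<ge> r k" for k by (simp add: r_def)
  have rk: "r k \<ge> k" for k by (simp add: r_def)
  let ?d = "\<lambda>k x. norm (F (r (Suc k)) x - F (r k) x)"
  have dk: "?I (r (Suc k)) (r k) < (1/4) ^ k" for k
    using rN[of k] rSuc[of k] by (intro N) auto
  have "(\<integral>\<^sup>+x. (\<Sum>k. ennreal (2 ^ k * (?d k x)\<^sup>2)) \<partial>M) = (\<Sum>k. \<integral>\<^sup>+x. ennreal (2 ^ k * (?d k x)\<^sup>2) \<partial>M)"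
    by (rule nn_integral_suminf) simp
  also have "\<dots> = (\<Sum>k. ennreal (2 ^ k * ?I (r (Suc k)) (r k)))"
    by (simp add: ennreal_mult nn_integral_cmult nnI)
  also have "\<dots> \<le> (\<Sum>k. ennreal ((1/2) ^ k))"
  proof (intro suminf_le allI summableI ennreal_leI)
    fix k
    have "2 ^ k * ?I (r (Suc k)) (r k) \<le> 2 ^ k * (1/4) ^ k" using dk[of k] by (intro mult_left_mono) auto
    also have "\<dots> = (1/2 :: real) ^ k" by (simp add: power_mult_distrib[symmetric])
    finally show "2 ^ k * ?I (r (Suc k)) (r k) \<le> (1/2) ^ k" .
  qed
  also have "\<dots> < \<infinity>" by (subst suminf_ennreal2) (auto intro: summable_geometric)
  finally have "(\<integral>\<^sup>+x. (\<Sum>k. ennreal (2 ^ k * (?d k x)\<^sup>2)) \<partial>M) \<noteq> \<infinity>" by simp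
  then have "AE x in M. (\<Sum>k. ennreal (2 ^ k * (?d k x)\<^sup>2)) \<noteq> \<infinity>"
    by (rule nn_integral_PInf_AE[rotated]) measurable
  then have conv: "AE x in M. convergent (\<lambda>k. F (r k) x)"
  proof eventually_elim
    case (elim x)
    have s: "summable (\<lambda>k. 2 ^ k * (?d k x)\<^sup>2)"
      by (rule summable_suminf_not_top) (use elim in auto)
    have "summable (\<lambda>k. norm (F (r (Suc k)) x - F (r k) x))"
    proof (rule summable_comparison_test'[of _ 0])
      show "summable (\<lambda>k. (1/2) ^ k + 2 ^ k * (?d k x)\<^sup>2)"
        by (intro summable_add s summable_geometric) simp
      fix k :: nat
      let ?y = "?d k x"
      \<comment> \<open>The elementary inequality \<open>2 y \<le> (1/2)^k + 2^k y\<^sup>2\<close>.\<close>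
      have "0 \<le> (1/2) ^ k * (1 - 2 ^ k * ?y)\<^sup>2" by simp
      also have "\<dots> = (1/2) ^ k - 2 * ((1/2) ^ k * 2 ^ k) * ?y + ((1/2) ^ k * 2 ^ k) * 2 ^ k * ?y\<^sup>2"
        by (simp add: power2_diff power2_eq_square algebra_simps)
      also have "(1/2) ^ k * 2 ^ k = (1::real)" by (simp add: power_mult_distrib[symmetric])
      finally have "0 \<le> (1/2) ^ k - 2 * ?y + 2 ^ k * ?y\<^sup>2" by simp
      moreover have "0 \<le> ?y" by simp
      ultimately show "norm ?y \<le> (1/2) ^ k + 2 ^ k * ?y\<^sup>2"
        unfolding real_norm_def abs_norm_cancel by argo
    qed
    then have "summable (\<lambda>k. F (r (Suc k)) x - F (r k) x)" by (rule summable_norm_cancel)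
    then have "convergent (\<lambda>n. \<Sum>k<n. F (r (Suc k)) x - F (r k) x)" by (simp add: summable_iff_convergent)
    then have "convergent (\<lambda>n. F (r n) x - F (r 0) x)"
      by (simp only: sum_lessThan_telescope[of "\<lambda>n. F (r n) x"])
    then have "convergent (\<lambda>n. (F (r n) x - F (r 0) x) + F (r 0) x)"
      by (intro convergent_add convergent_const)
    then show ?case by simp
  qed
  define G where "G x = lim (\<lambda>k. F (r k) x)" for x
  have G [measurable]: "G \<in> borel_measurable M" unfolding G_def[abs_def] by measurable
  have lim: "AE x in M. (\<lambda>k. F (r k) x) \<longlonglongrightarrow> G x"
    using conv by eventually_elim (simp add: G_def convergent_LIMSEQ_iff)
  have fatou: "(\<integral>\<^sup>+x. ennreal ((norm (F n x - G x))\<^sup>2) \<partial>M) \<le> ennreal e"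
    if e: "\<And>i j. i \<ge> K \<Longrightarrow> j \<ge> K \<Longrightarrow> ?I i j < e" and n: "n \<ge> K" for n e K
  proof -
    have "(\<integral>\<^sup>+x. ennreal ((norm (F n x - G x))\<^sup>2) \<partial>M)
        = (\<integral>\<^sup>+x. liminf (\<lambda>k. ennreal ((norm (F n x - F (r k) x))\<^sup>2)) \<partial>M)"
    proof (rule nn_integral_cong_AE)
      show "AE x in M. ennreal ((norm (F n x - G x))\<^sup>2) = liminf (\<lambda>k. ennreal ((norm (F n x - F (r k) x))\<^sup>2))"
        using lim
      proof eventually_elim
        case (elim x)
        have "(\<lambda>k. ennreal ((norm (F n x - F (r k) x))\<^sup>2)) \<longlonglongrightarrow> ennreal ((norm (F n x - G x))\<^sup>2)"
          by (intro tendsto_ennrealI tendsto_intros elim)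
        then show ?case by (intro lim_imp_Liminf[symmetric]) auto
      qed
    qed
    also have "\<dots> \<le> liminf (\<lambda>k. \<integral>\<^sup>+x. ennreal ((norm (F n x - F (r k) x))\<^sup>2) \<partial>M)"
      by (rule nn_integral_liminf) measurable
    also have "\<dots> \<le> ennreal e"
    proof (rule Liminf_le[OF trivial_limit_sequentially])
      show "\<forall>\<^sub>F k in sequentially. (\<integral>\<^sup>+x. ennreal ((norm (F n x - F (r k) x))\<^sup>2) \<partial>M) \<le> ennreal e"
        unfolding nnI
      proof (rule eventually_sequentiallyI[of K])
        fix k assume "K \<le> k"
        then have "r k \<ge> K" using rk[of k] by simp
        from e[OF n this] show "ennreal (?I n (r k)) \<le> ennreal e" by (intro ennreal_leI) simp
      qed
    qed
    finally show ?thesis .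
  qed
  have intG: "integrable M (\<lambda>x. (norm (F n x - G x))\<^sup>2)" if n: "n \<ge> N 0" for n
  proof (rule integrableI_bounded)
    have "(\<integral>\<^sup>+x. ennreal ((norm (F n x - G x))\<^sup>2) \<partial>M) \<le> ennreal ((1/4) ^ 0)"
      by (rule fatou[OF N n])
    also have "\<dots> < \<infinity>" by simp
    finally show "(\<integral>\<^sup>+x. ennreal (norm ((norm (F n x - G x))\<^sup>2)) \<partial>M) < \<infinity>" by simp
  qed measurable
  have G2: "integrable M (\<lambda>x. (norm (G x))\<^sup>2)"
  proof -
    have "integrable M (\<lambda>x. (norm (F (N 0) x - (F (N 0) x - G x)))\<^sup>2)"
      by (rule integrable_norm_diff_sq(1)[OF _ _ F2 intG]) simp_all
    then show ?thesis by simp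
  qed
  have "(\<lambda>n. LINT x|M. (norm (F n x - G x))\<^sup>2) \<longlonglongrightarrow> 0"
  proof (rule LIMSEQ_I)
    fix e :: real assume "e > 0"
    then have "e / 2 > 0" by simp
    from cauchy[OF this] obtain K where K: "\<And>i j. i \<ge> K \<Longrightarrow> j \<ge> K \<Longrightarrow> ?I i j < e / 2" by blast
    have "norm ((LINT x|M. (norm (F n x - G x))\<^sup>2) - 0) < e" if n: "n \<ge> K" for n
    proof -
      have i: "integrable M (\<lambda>x. (norm (F n x - G x))\<^sup>2)"
          by (rule integrable_norm_diff_sq(1)[OF meas G F2 G2])
      have "ennreal (LINT x|M. (norm (F n x - G x))\<^sup>2) = (\<integral>\<^sup>+x. ennreal ((norm (F n x - G x))\<^sup>2) \<partial>M)"
        by (rule nn_integral_eq_integral[OF i, symmetric]) simp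
      also have "\<dots> \<le> ennreal (e / 2)" by (rule fatou[OF K n])
      finally have "(LINT x|M. (norm (F n x - G x))\<^sup>2) \<le> e / 2" using \<open>e > 0\<close>
          by (subst (asm) ennreal_le_iff) auto
      moreover have "0 \<le> (LINT x|M. (norm (F n x - G x))\<^sup>2)" by simp
      ultimately show ?thesis using \<open>e > 0\<close> by simp
    qed
    then show "\<exists>K. \<forall>n\<ge>K. norm ((LINT x|M. (norm (F n x - G x))\<^sup>2) - 0) < e" by blast
  qed
  from that[OF G G2 this lim] show ?thesis .
qed

lemma borel_measurable_cnj [measurable (raw)]:
  "f \<in> borel_measurable M \<Longrightarrow> (\<lambda>x. cnj (f x)) \<in> borel_measurable M"
  by (rule measurable_compose[of f _ borel]) (auto intro!: borel_measurable_continuous_onI continuous_intros)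

text \<open>
  The pointwise linear combination \<open>u + c v\<close>.
\<close>

definition comb :: "('a \<Rightarrow> complex) \<Rightarrow> complex \<Rightarrow> ('a \<Rightarrow> complex) \<Rightarrow> 'a \<Rightarrow> complex" where
  "comb u c v x = u x + c * v x"

lemma L2D:
  assumes "f \<in> L2"
  shows "f \<in> borel_measurable lebesgue" "integrable lebesgue (\<lambda>x. (norm (f x))\<^sup>2)"
  using assms by (auto simp: L2_def)

lemma norm_mult_le_squares: "norm (x * cnj y) \<le> (norm x)\<^sup>2 + (norm y)\<^sup>2"
proof -
  have "norm (x * cnj y) = norm x * norm y" by (simp add: norm_mult)
  also have "\<dots> \<le> (norm x)\<^sup>2 + (norm y)\<^sup>2"
    using sum_squares_bound[of "norm x" "norm y"] mult_nonneg_nonneg[OF norm_ge_zero[of x] norm_ge_zero[of y]]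
    by linarith
  finally show ?thesis .
qed

lemma L2_inner_integrable:
  assumes "f \<in> L2" "g \<in> L2"
  shows "integrable lebesgue (\<lambda>x. f x * cnj (g x))"
proof (rule Bochner_Integration.integrable_bound)
  show "integrable lebesgue (\<lambda>x. (norm (f x))\<^sup>2 + (norm (g x))\<^sup>2)"
    using assms by (auto simp: L2_def)
  show "(\<lambda>x. f x * cnj (g x)) \<in> borel_measurable lebesgue"
    using assms by (auto simp: L2_def intro!: borel_measurable_times borel_measurable_cnj)
  show "AE x in lebesgue. norm (f x * cnj (g x)) \<le> norm ((norm (f x))\<^sup>2 + (norm (g x))\<^sup>2)"
    unfolding real_norm_def by (intro always_eventually allI order_trans[OF norm_mult_le_squares abs_ge_self])
qed

lemma L2_comb: "f \<in> L2 \<Longrightarrow> g \<in> L2 \<Longrightarrow> comb f c g \<in> L2"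
proof -
  assume fg: "f \<in> L2" "g \<in> L2"
  have m: "comb f c g \<in> borel_measurable lebesgue"
    unfolding comb_def[abs_def] using fg by (auto simp: L2_def)
  have "integrable lebesgue (\<lambda>x. (norm (comb f c g x))\<^sup>2)"
  proof (rule Bochner_Integration.integrable_bound)
    show "integrable lebesgue (\<lambda>x. 2 * (norm (f x))\<^sup>2 + 2 * ((norm c)\<^sup>2 * (norm (g x))\<^sup>2))"
      using fg by (auto simp: L2_def)
    have "(norm (a + c * b))\<^sup>2 \<le> 2 * (norm a)\<^sup>2 + 2 * ((norm c)\<^sup>2 * (norm b)\<^sup>2)" for a b
    proof -
      have "(norm (a + c * b))\<^sup>2 \<le> (norm a + norm c * norm b)\<^sup>2"
        using norm_triangle_ineq[of a "c * b"] by (intro power_mono) (auto simp: norm_mult)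
      also have "\<dots> \<le> 2 * (norm a)\<^sup>2 + 2 * (norm c * norm b)\<^sup>2"
        using sum_squares_bound[of "norm a" "norm c * norm b"] by (simp add: power2_sum)
      finally show ?thesis by (simp add: power_mult_distrib)
    qed
    then show "AE x in lebesgue. norm ((norm (comb f c g x))\<^sup>2)
        \<le> norm (2 * (norm (f x))\<^sup>2 + 2 * ((norm c)\<^sup>2 * (norm (g x))\<^sup>2))"
      by (intro always_eventually allI) (simp add: comb_def)
  qed (use m in measurable)
  with m show ?thesis by (simp add: L2_def)
qed

lemma L2_inner_left:
  assumes "f \<in> L2" "g \<in> L2" "h \<in> L2"
  shows "L2_inner (comb f c g) h = L2_inner f h + c * L2_inner g h"
  using L2_inner_integrable[OF assms(1,3)] L2_inner_integrable[OF assms(2,3)]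
  by (simp add: L2_inner_def comb_def distrib_right mult.assoc)

lemma L2_inner_sym: "L2_inner g f = cnj (L2_inner f g)"
proof -
  have "cnj (L2_inner f g) = (LINT x|lebesgue. cnj (f x * cnj (g x)))"
    unfolding L2_inner_def by (rule Bochner_Integration.integral_cnj[symmetric])
  then show ?thesis unfolding L2_inner_def by (simp add: mult.commute)
qed

lemma L2_inner_self: "L2_inner f f = complex_of_real (LINT x|lebesgue. (norm (f x))\<^sup>2)"
proof -
  have "z * cnj z = complex_of_real ((norm z)\<^sup>2)" for z by (rule complex_norm_square[symmetric])
  then show ?thesis unfolding L2_inner_def by (simp del: of_real_power)
qed

lemma L2_inner_cong_AE:
  assumes "AE x in lebesgue. f x = f' x" "f \<in> L2" "f' \<in> L2" "g \<in> L2"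
  shows "L2_inner f g = L2_inner f' g"
  unfolding L2_inner_def
  by (rule integral_cong_AE) (use assms in \<open>auto simp: L2_def elim!: eventually_mono intro!:
      borel_measurable_times borel_measurable_cnj\<close>)

lemma L2_cauchy_schwarz:
  assumes "f \<in> L2" "g \<in> L2"
  shows "(norm (L2_inner f g))\<^sup>2 \<le> (LINT x|lebesgue. (norm (f x))\<^sup>2) * (LINT x|lebesgue. (norm (g x))\<^sup>2)"
proof -
  note i = L2_inner_integrable[OF assms]
  have i': "integrable lebesgue (\<lambda>x. norm (f x) * norm (g x))"
    using integrable_norm[OF i] by (simp add: norm_mult)
  have "norm (L2_inner f g) \<le> (LINT x|lebesgue. norm (f x * cnj (g x)))"
    unfolding L2_inner_def by (rule integral_norm_bound)
  then have "norm (L2_inner f g) \<le> (LINT x|lebesgue. norm (f x) * norm (g x))"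
    by (simp add: norm_mult)
  then have "(norm (L2_inner f g))\<^sup>2 \<le> (LINT x|lebesgue. norm (f x) * norm (g x))\<^sup>2"
    by (rule power_mono) simp
  also have "\<dots> \<le> (LINT x|lebesgue. (norm (f x))\<^sup>2) * (LINT x|lebesgue. (norm (g x))\<^sup>2)"
  proof (rule nonneg_quadratic)
    fix t
    have "0 \<le> (LINT x|lebesgue. (norm (f x) + t * norm (g x))\<^sup>2)" by simp
    also have "(\<lambda>x. (norm (f x) + t * norm (g x))\<^sup>2)
        = (\<lambda>x. (norm (f x))\<^sup>2 + 2 * t * (norm (f x) * norm (g x)) + t\<^sup>2 * (norm (g x))\<^sup>2)"
      by (simp add: fun_eq_iff power2_sum power_mult_distrib algebra_simps)
    also have "(LINT x|lebesgue. (norm (f x))\<^sup>2 + 2 * t * (norm (f x) * norm (g x)) + t\<^sup>2 * (norm (g x))\<^sup>2)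
      = (LINT x|lebesgue. (norm (f x))\<^sup>2) + 2 * t * (LINT x|lebesgue. norm (f x) * norm (g x))
          + t\<^sup>2 * (LINT x|lebesgue. (norm (g x))\<^sup>2)"
      using i' L2D[OF assms(1)] L2D[OF assms(2)] by simp
    finally show "0 \<le> (LINT x|lebesgue. (norm (f x))\<^sup>2) + 2 * t * (LINT x|lebesgue. norm (f x) * norm (g x))
        + t\<^sup>2 * (LINT x|lebesgue. (norm (g x))\<^sup>2)" .
  qed
  finally show ?thesis .
qed

text \<open>
  Lebesgue measurable functions are replaced by Borel measurable representatives wherever Fubini's
  theorem is used, since the completed measure is not a product measure.
\<close>

lemma lebesgue_borel_rep:
  fixes f :: "'a::euclidean_space \<Rightarrow> complex"
  assumes "f \<in> borel_measurable lebesgue"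
  obtains f' where "f' \<in> borel_measurable borel" "AE x in lborel. f x = f' x"
proof -
  have "(\<lambda>x. Re (f x)) \<in> borel_measurable lebesgue" "(\<lambda>x. Im (f x)) \<in> borel_measurable lebesgue"
    using assms by auto
  from completion_ex_borel_measurable_real[OF this(1)] completion_ex_borel_measurable_real[OF this(2)]
  obtain p q where pq: "p \<in> borel_measurable lborel" "AE x in lborel. Re (f x) = p x"
      "q \<in> borel_measurable lborel" "AE x in lborel. Im (f x) = q x" by blast
  show ?thesis
  proof (rule that)
    show "(\<lambda>x. Complex (p x) (q x)) \<in> borel_measurable borel"
      using pq unfolding Complex_eq by auto
    show "AE x in lborel. f x = Complex (p x) (q x)"
      using pq(2,4) by eventually_elim (simp add: complex_eq_iff)
  qed
qed

lemma lebesgue_rep_integral: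
  fixes f :: "'a::euclidean_space \<Rightarrow> 'b::{banach, second_countable_topology}"
  assumes "f \<in> borel_measurable lebesgue" "f' \<in> borel_measurable borel" "AE x in lborel. f x = f' x"
  shows "(LINT x|lebesgue. f x) = (LINT x|lborel. f' x)" "integrable lebesgue f \<longleftrightarrow> integrable lborel f'"
proof -
  have ae: "AE x in lebesgue. f x = f' x" using assms(3) by (simp add: AE_completion_iff)
  have m: "f' \<in> borel_measurable lborel" using assms(2) by simp
  have m': "f' \<in> borel_measurable lebesgue" using m by (rule measurable_completion)
  show "(LINT x|lebesgue. f x) = (LINT x|lborel. f' x)"
    using integral_cong_AE[OF assms(1) m' ae] integral_completion[OF m] by simp
  show "integrable lebesgue f \<longleftrightarrow> integrable lborel f'"
    using integrable_cong_AE[OF assms(1) m' ae] integrable_completion[OF m] by simp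
qed

lemma test_function_L2:
  assumes "test_function (\<phi> :: real ^ 'n \<Rightarrow> real)"
  shows "(\<lambda>x. complex_of_real (\<phi> x)) \<in> L2" "(\<lambda>x. complex_of_real (partial i \<phi> x)) \<in> L2"
proof -
  obtain C a b where C: "C > 0" and b: "\<And>x. \<bar>\<phi> x\<bar> \<le> C * indicator (cbox a b) x"
      "\<And>x. \<bar>partial i \<phi> x\<bar> \<le> C * indicator (cbox a b) x"
    using test_function_bound[OF assms] by metis
  have *: "(\<lambda>x. complex_of_real (\<psi> x)) \<in> L2"
    if \<psi>: "\<psi> \<in> borel_measurable borel" "\<And>x. \<bar>\<psi> x\<bar> \<le> C * indicator (cbox a b) x" for \<psi> :: "real ^ 'n \<Rightarrow> real"
  proof -
    have m: "\<psi> \<in> borel_measurable lebesgue" using \<psi>(1) by (intro measurable_completion) simp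
    have "integrable lebesgue (\<lambda>x. (\<psi> x)\<^sup>2)"
    proof (rule Bochner_Integration.integrable_bound)
      have "integrable lborel (\<lambda>x. C\<^sup>2 * indicator (cbox a b) x :: real)"
        using emeasure_lborel_cbox_finite[of a b]
            by (intro integrable_mult_right) (simp add: integrable_indicator_iff)
      then show "integrable lebesgue (\<lambda>x. C\<^sup>2 * indicator (cbox a b) x :: real)"
        by (subst integrable_completion) auto
      show "AE x in lebesgue. norm ((\<psi> x)\<^sup>2) \<le> norm (C\<^sup>2 * indicator (cbox a b) x :: real)"
      proof (intro always_eventually allI)
        fix x
        have "\<bar>\<psi> x\<bar>\<^sup>2 \<le> (C * indicator (cbox a b) x)\<^sup>2" by (rule power_mono[OF \<psi>(2)]) simp
        then show "norm ((\<psi> x)\<^sup>2) \<le> norm (C\<^sup>2 * indicator (cbox a b) x :: real)"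
          by (auto split: split_indicator)
      qed
    qed (use m in auto)
    with m show ?thesis by (auto simp: L2_def)
  qed
  show "(\<lambda>x. complex_of_real (\<phi> x)) \<in> L2" "(\<lambda>x. complex_of_real (partial i \<phi> x)) \<in> L2"
    by (rule *; use test_function_cont[OF assms] b in simp)+
qed

lemma has_weak_partial_inner:
  "has_weak_partial i u g \<longleftrightarrow> (\<forall>\<phi>. test_function \<phi> \<longrightarrow>
      L2_inner u (\<lambda>x. complex_of_real (partial i \<phi> x)) = - L2_inner g (\<lambda>x. complex_of_real (\<phi> x)))"
  by (simp add: has_weak_partial_def L2_inner_def scaleR_conv_of_real mult.commute)

lemma has_weak_partial_comb:
  assumes "u \<in> L2" "g \<in> L2" "v \<in> L2" "h \<in> L2" "has_weak_partial i u g" "has_weak_partial i v h"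
  shows "has_weak_partial i (comb u c v) (comb g c h)"
  using assms(5,6) unfolding has_weak_partial_inner
  by (auto simp: L2_inner_left assms(1-4) test_function_L2)

lemma has_weak_partial_unique:
  assumes g: "g \<in> L2" and h: "h \<in> L2" and wg: "has_weak_partial i u g" and wh: "has_weak_partial i u h"
  shows "AE x in lebesgue. g x = h x"
proof -
  let ?d = "comb g (-1) h"
  have d: "?d \<in> L2" by (rule L2_comb[OF g h])
  obtain d' where d': "d' \<in> borel_measurable borel" "AE x in lborel. ?d x = d' x"
    using lebesgue_borel_rep L2D(1)[OF d] by metis
  have "integrable lborel (\<lambda>x. (norm (d' x))\<^sup>2)"
  proof -
    have "AE x in lborel. (norm (?d x))\<^sup>2 = (norm (d' x))\<^sup>2" using d'(2) by eventually_elim simp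
    then show ?thesis using lebesgue_rep_integral(2)[of "\<lambda>x. (norm (?d x))\<^sup>2" "\<lambda>x. (norm (d' x))\<^sup>2"] L2D[OF d]
        d'(1) by auto
  qed
  then have "integrable lborel (\<lambda>x. indicator (box a b) x *\<^sub>R d' x)" for a b
    by (intro L2_loc_integrable d'(1)) auto
  moreover have "(LINT x|lborel. \<phi> x *\<^sub>R d' x) = 0" if \<phi>: "test_function \<phi>" for \<phi>
  proof -
    have m: "\<phi> \<in> borel_measurable lebesgue" using test_function_cont(3)[OF \<phi>]
        by (intro measurable_completion) simp
    have "(LINT x|lborel. \<phi> x *\<^sub>R d' x) = (LINT x|lebesgue. \<phi> x *\<^sub>R ?d x)"
      by (rule lebesgue_rep_integral(1)[symmetric])
        (use m d'(1) test_function_cont(3)[OF \<phi>] L2D(1)[OF d] d'(2) in \<open>auto elim!: eventually_mono\<close>)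
    also have "\<dots> = L2_inner ?d (\<lambda>x. complex_of_real (\<phi> x))"
      by (simp add: L2_inner_def scaleR_conv_of_real mult.commute)
    also have "\<dots> = L2_inner g (\<lambda>x. complex_of_real (\<phi> x)) - L2_inner h (\<lambda>x. complex_of_real (\<phi> x))"
      by (subst L2_inner_left[OF g h test_function_L2(1)[OF \<phi>]]) simp
    also have "\<dots> = 0"
      using wg wh \<phi> unfolding has_weak_partial_inner by (metis diff_self neg_equal_iff_equal)
    finally show ?thesis .
  qed
  ultimately have "AE x in lborel. d' x = 0" by (rule fundamental_lemma)
  with d'(2) have "AE x in lborel. g x = h x" by eventually_elim (simp add: comb_def)
  then show ?thesis by (simp add: AE_completion_iff)
qed

lemma weak_partial:
  assumes "u \<in> W12"
  shows "weak_partial i u \<in> L2" "has_weak_partial i u (weak_partial i u)"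
proof -
  have "\<exists>g. g \<in> L2 \<and> has_weak_partial i u g" using assms by (auto simp: W12_def)
  from someI_ex[OF this] show "weak_partial i u \<in> L2" "has_weak_partial i u (weak_partial i u)"
    by (simp_all add: weak_partial_def)
qed

lemma weak_partial_eqI:
  assumes "u \<in> W12" "g \<in> L2" "has_weak_partial i u g"
  shows "AE x in lebesgue. weak_partial i u x = g x"
  by (rule has_weak_partial_unique[OF weak_partial(1)[OF assms(1)] assms(2) weak_partial(2)[OF assms(1)]
      assms(3)])

lemma W12_L2: "u \<in> W12 \<Longrightarrow> u \<in> L2"
  by (simp add: W12_def)

lemma W12_comb:
  assumes "u \<in> W12" "v \<in> W12"
  shows "comb u c v \<in> W12"
    and "AE x in lebesgue. weak_partial i (comb u c v) x = comb (weak_partial i u) c (weak_partial i v) x"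
proof -
  note L = W12_L2[OF assms(1)] W12_L2[OF assms(2)] weak_partial[OF assms(1)] weak_partial[OF assms(2)]
  have h: "has_weak_partial i (comb u c v) (comb (weak_partial i u) c (weak_partial i v))" for i
    by (rule has_weak_partial_comb) (use L in auto)
  show W: "comb u c v \<in> W12"
    unfolding W12_def using h L2_comb L by blast
  show "AE x in lebesgue. weak_partial i (comb u c v) x = comb (weak_partial i u) c (weak_partial i v) x"
    by (rule weak_partial_eqI[OF W L2_comb[OF L(3,5)] h])
qed

section \<open>The form domain and the resolvent set\<close>

text \<open>
  The function \<open>V\<^sup>1\<^sup>/\<^sup>2 u\<close>, which makes the potential part of the form an inner product in \<open>L\<^sup>2\<close>.
  The absolute value is harmless as \<open>V \<ge> 0\<close> almost everywhere.
\<close>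

definition weighted :: "(real ^ 'n \<Rightarrow> real) \<Rightarrow> (real ^ 'n \<Rightarrow> complex) \<Rightarrow> real ^ 'n \<Rightarrow> complex" where
  "weighted V u x = complex_of_real (sqrt \<bar>V x\<bar>) * u x"

lemma weighted_comb: "weighted V (comb u c v) = comb (weighted V u) c (weighted V v)"
  by (simp add: weighted_def comb_def fun_eq_iff algebra_simps)

lemma weighted_sq: "(norm (weighted V u x))\<^sup>2 = \<bar>V x\<bar> * (norm (u x))\<^sup>2"
  by (simp add: weighted_def norm_mult power_mult_distrib)

lemma pos_form_L2:
  assumes "\<And>u v c. u \<in> D \<Longrightarrow> v \<in> D \<Longrightarrow> comb u c v \<in> D"
    and T: "\<And>u. u \<in> D \<Longrightarrow> T u \<in> L2"
    and lin: "\<And>u v c. u \<in> D \<Longrightarrow> v \<in> D \<Longrightarrow> AE x in lebesgue. T (comb u c v) x = comb (T u) c (T v) x"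
  shows "pos_form D comb (\<lambda>u v. L2_inner (T u) (T v))"
proof
  fix u v w c assume D: "u \<in> D" "v \<in> D"
  show "comb u c v \<in> D" by (rule assms(1)[OF D])
  show "L2_inner (T v) (T u) = cnj (L2_inner (T u) (T v))" by (rule L2_inner_sym)
  show "0 \<le> Re (L2_inner (T u) (T u))" by (simp add: L2_inner_self)
  assume w: "w \<in> D"
  have "L2_inner (T (comb u c v)) (T w) = L2_inner (comb (T u) c (T v)) (T w)"
    by (rule L2_inner_cong_AE[OF lin[OF D] T[OF assms(1)[OF D]] L2_comb[OF T[OF D(1)] T[OF D(2)]] T[OF w]])
  then show "L2_inner (T (comb u c v)) (T w) = L2_inner (T u) (T w) + c * L2_inner (T v) (T w)"
    using L2_inner_left[OF T[OF D(1)] T[OF D(2)] T[OF w]] by simp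
qed

lemma pos_form_add:
  assumes "pos_form D cb p" "pos_form D cb q"
  shows "pos_form D cb (\<lambda>u v. p u v + q u v)"
proof -
  interpret p: pos_form D cb p by fact
  interpret q: pos_form D cb q by fact
  show ?thesis
  proof
    fix u v w c assume D: "u \<in> D" "v \<in> D"
    show "cb u c v \<in> D" by (rule p.comb_D[OF D])
    show "p v u + q v u = cnj (p u v + q u v)" using p.q_sym[OF D] q.q_sym[OF D] by simp
    show "0 \<le> Re (p u u + q u u)" using p.q_pos[OF D(1)] q.q_pos[OF D(1)] by simp
    assume w: "w \<in> D"
    show "p (cb u c v) w + q (cb u c v) w = p u w + q u w + c * (p v w + q v w)"
      using p.q_left[OF D w] q.q_left[OF D w] by (simp add: algebra_simps)
  qed
qed

lemma pos_form_sum: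
  assumes "finite I" "\<And>i. i \<in> I \<Longrightarrow> pos_form D cb (p i)" "\<And>u v c. u \<in> D \<Longrightarrow> v \<in> D \<Longrightarrow> cb u c v \<in> D"
  shows "pos_form D cb (\<lambda>u v. \<Sum>i\<in>I. p i u v)"
  using assms(1,2)
proof (induction I rule: finite_induct)
  case empty
  then show ?case using assms(3) by unfold_locales auto
next
  case (insert i I)
  then have "pos_form D cb (\<lambda>u v. p i u v + (\<Sum>i\<in>I. p i u v))" by (intro pos_form_add) auto
  with insert show ?case by simp
qed

lemma L2_inner_tendsto:
  assumes f: "\<And>n. f n \<in> L2" and g: "g \<in> L2" and h: "h \<in> L2"
    and lim: "(\<lambda>n. LINT x|lebesgue. (norm (f n x - g x))\<^sup>2) \<longlonglongrightarrow> 0"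
  shows "(\<lambda>n. L2_inner (f n) h) \<longlonglongrightarrow> L2_inner g h"
proof (rule LIM_zero_cancel, rule tendsto_norm_zero_cancel)
  let ?H = "LINT x|lebesgue. (norm (h x))\<^sup>2"
  have "(\<lambda>n. sqrt ((LINT x|lebesgue. (norm (f n x - g x))\<^sup>2) * ?H)) \<longlonglongrightarrow> sqrt (0 * ?H)"
    by (intro tendsto_intros lim)
  then have l: "(\<lambda>n. sqrt ((LINT x|lebesgue. (norm (f n x - g x))\<^sup>2) * ?H)) \<longlonglongrightarrow> 0" by simp
  have b: "norm (L2_inner (f n) h - L2_inner g h) \<le> sqrt ((LINT x|lebesgue. (norm (f n x - g x))\<^sup>2) * ?H)"
      for n
  proof (rule real_le_rsqrt)
    have "L2_inner (f n) h - L2_inner g h = L2_inner (comb (f n) (-1) g) h"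
      by (simp add: L2_inner_left[OF f g h])
    then show "(norm (L2_inner (f n) h - L2_inner g h))\<^sup>2 \<le> (LINT x|lebesgue. (norm (f n x - g x))\<^sup>2) * ?H"
      using L2_cauchy_schwarz[OF L2_comb[OF f g] h, of n "-1"] by (simp add: comb_def)
  qed
  show "(\<lambda>n. norm (L2_inner (f n) h - L2_inner g h)) \<longlonglongrightarrow> 0"
    by (rule tendsto_sandwich[OF _ _ tendsto_const l]) (use b in auto)
qed

context
  fixes V :: "real ^ 'n \<Rightarrow> real"
  assumes V_meas: "V \<in> borel_measurable lebesgue"
    and V_nonneg: "AE x in lebesgue. 0 \<le> V x"
begin

lemma weighted_measurable:
  assumes "u \<in> borel_measurable lebesgue"
  shows "weighted V u \<in> borel_measurable lebesgue"
  unfolding weighted_def[abs_def] using V_meas assms by measurable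

lemma form_domain_iff: "u \<in> form_domain V \<longleftrightarrow> u \<in> W12 \<and> weighted V u \<in> L2"
proof -
  have "integrable lebesgue (\<lambda>x. V x * (norm (u x))\<^sup>2) \<longleftrightarrow> integrable lebesgue (\<lambda>x. (norm (weighted V u x))\<^sup>2)"
    if u: "u \<in> W12"
  proof (rule integrable_cong_AE)
    have m: "u \<in> borel_measurable lebesgue" using L2D[OF W12_L2[OF u]] by simp
    show "(\<lambda>x. V x * (norm (u x))\<^sup>2) \<in> borel_measurable lebesgue" using V_meas m by measurable
    show "(\<lambda>x. (norm (weighted V u x))\<^sup>2) \<in> borel_measurable lebesgue"
      using weighted_measurable[OF m] by measurable
    show "AE x in lebesgue. V x * (norm (u x))\<^sup>2 = (norm (weighted V u x))\<^sup>2"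
      using V_nonneg by eventually_elim (simp add: weighted_sq)
  qed
  then show ?thesis
    using weighted_measurable L2D(1)[OF W12_L2] by (auto simp: form_domain_def L2_def)
qed

lemma form_domainD:
  assumes "u \<in> form_domain V"
  shows "u \<in> W12" "u \<in> L2" "weighted V u \<in> L2" "weak_partial i u \<in> L2"
  using assms W12_L2 weak_partial(1) by (auto simp: form_domain_iff)

lemma form_domain_comb: "u \<in> form_domain V \<Longrightarrow> v \<in> form_domain V \<Longrightarrow> comb u c v \<in> form_domain V"
  by (simp add: form_domain_iff W12_comb weighted_comb L2_comb)

lemma schroedinger_form_weighted:
  assumes "u \<in> form_domain V" "v \<in> form_domain V"
  shows "schroedinger_form V u v =
    (\<Sum>i\<in>UNIV. L2_inner (weak_partial i u) (weak_partial i v)) + L2_inner (weighted V u) (weighted V v)"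
proof -
  have m: "u \<in> borel_measurable lebesgue" "v \<in> borel_measurable lebesgue"
    using L2D(1) form_domainD(2) assms by blast+
  have "(LINT x|lebesgue. complex_of_real (V x) * (u x * cnj (v x))) = L2_inner (weighted V u) (weighted V v)"
    unfolding L2_inner_def
  proof (rule integral_cong_AE)
    show "(\<lambda>x. complex_of_real (V x) * (u x * cnj (v x))) \<in> borel_measurable lebesgue"
      using V_meas m by measurable
    show "(\<lambda>x. weighted V u x * cnj (weighted V v x)) \<in> borel_measurable lebesgue"
      using weighted_measurable[OF m(1)] weighted_measurable[OF m(2)] by measurable
    show "AE x in lebesgue. complex_of_real (V x) * (u x * cnj (v x)) = weighted V u x * cnj (weighted V v x)"
      using V_nonneg
    proof eventually_elim
      case (elim x)
      have "weighted V u x * cnj (weighted V v x)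
          = complex_of_real (sqrt (V x) * sqrt (V x)) * (u x * cnj (v x))"
        by (simp only: weighted_def complex_cnj_mult complex_cnj_complex_of_real of_real_mult abs_of_nonneg[OF
            elim] mult_ac)
      also have "sqrt (V x) * sqrt (V x) = V x" using elim by simp
      finally show ?case ..
    qed
  qed
  then show ?thesis by (simp add: schroedinger_form_def)
qed

lemma pos_form_inner: "pos_form (form_domain V) comb L2_inner"
  by (rule pos_form_L2[where T="\<lambda>u. u"]) (auto simp: form_domain_comb form_domainD)

lemma pos_form_cong:
  assumes "pos_form D cb p" "\<And>u v. u \<in> D \<Longrightarrow> v \<in> D \<Longrightarrow> q u v = p u v"
  shows "pos_form D cb q"
proof -
  interpret p: pos_form D cb p by fact
  show ?thesis
  proof
    fix u v w c assume D: "u \<in> D" "v \<in> D"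
    show cb: "cb u c v \<in> D" by (rule p.comb_D[OF D])
    show "q v u = cnj (q u v)" unfolding assms(2)[OF D] assms(2)[OF D(2,1)] by (rule p.q_sym[OF D])
    show "0 \<le> Re (q u u)" unfolding assms(2)[OF D(1) D(1)] by (rule p.q_pos[OF D(1)])
    assume w: "w \<in> D"
    show "q (cb u c v) w = q u w + c * q v w"
      unfolding assms(2)[OF cb w] assms(2)[OF D(1) w] assms(2)[OF D(2) w] by (rule p.q_left[OF D w])
  qed
qed

lemma pos_form_schroedinger: "pos_form (form_domain V) comb (schroedinger_form V)"
proof (rule pos_form_cong[OF _ schroedinger_form_weighted])
  show "pos_form (form_domain V) comb (\<lambda>u v.
      (\<Sum>i\<in>UNIV. L2_inner (weak_partial i u) (weak_partial i v)) + L2_inner (weighted V u) (weighted V v))"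
  proof (intro pos_form_add pos_form_sum)
    show "pos_form (form_domain V) comb (\<lambda>u v. L2_inner (weak_partial i u) (weak_partial i v))" for i
      by (rule pos_form_L2) (auto simp: form_domain_comb form_domainD W12_comb(2))
    show "pos_form (form_domain V) comb (\<lambda>u v. L2_inner (weighted V u) (weighted V v))"
      by (rule pos_form_L2) (auto simp: form_domain_comb form_domainD weighted_comb)
  qed (auto simp: form_domain_comb)
qed

text \<open>
  The triple \<open>(u, \<nabla>u, V\<^sup>1\<^sup>/\<^sup>2 u)\<close>, whose \<open>L\<^sup>2\<close> norm is the form norm of \<open>u\<close>. Thus a Cauchy sequence
  for the form norm is a single Cauchy sequence in an \<open>L\<^sup>2\<close> space of vector-valued functions.
\<close>

definition graph_map :: "(real ^ 'n \<Rightarrow> complex) \<Rightarrow> real ^ 'n \<Rightarrow> complex \<times> (complex ^ 'n) \<times> complex" where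
  "graph_map u x = (u x, (\<chi> i. weak_partial i u x), weighted V u x)"

lemma norm_triple_sq:
  fixes y :: "complex ^ 'n"
  shows "(norm (x, y, z))\<^sup>2 = (norm x)\<^sup>2 + (\<Sum>i\<in>UNIV. (norm (y $ i))\<^sup>2) + (norm z)\<^sup>2"
proof -
  have "(norm y)\<^sup>2 = (\<Sum>i\<in>UNIV. (norm (y $ i))\<^sup>2)"
    by (simp add: norm_vec_def L2_set_def sum_nonneg)
  then show ?thesis by (simp add: norm_Pair sum_nonneg)
qed

lemma graph_map_L2:
  assumes u: "u \<in> form_domain V"
  shows "graph_map u \<in> borel_measurable lebesgue"
    and "integrable lebesgue (\<lambda>x. (norm (graph_map u x))\<^sup>2)"
    and "(LINT x|lebesgue. (norm (graph_map u x))\<^sup>2) = Re (schroedinger_form V u u + L2_inner u u)"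
proof -
  note L = form_domainD[OF u]
  have "(\<lambda>x. \<chi> i. weak_partial i u x) \<in> borel_measurable lebesgue"
    unfolding borel_measurable_euclidean_space[of "\<lambda>x. \<chi> i. weak_partial i u x"]
    using L2D(1)[OF L(4)] by (auto simp: Basis_vec_def inner_axis)
  then show "graph_map u \<in> borel_measurable lebesgue"
    unfolding graph_map_def[abs_def] using L2D(1)[OF L(2)] L2D(1)[OF L(3)] by (intro borel_measurable_Pair)
  show "integrable lebesgue (\<lambda>x. (norm (graph_map u x))\<^sup>2)"
    "(LINT x|lebesgue. (norm (graph_map u x))\<^sup>2) = Re (schroedinger_form V u u + L2_inner u u)"
    unfolding graph_map_def norm_triple_sq schroedinger_form_weighted[OF u u] L2_inner_self
    using L2D(2)[OF L(2)] L2D(2)[OF L(3)] L2D(2)[OF L(4)] by simp_all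
qed

lemma graph_map_diff:
  assumes "u \<in> form_domain V" "v \<in> form_domain V"
  shows "AE x in lebesgue. graph_map (comb u (-1) v) x = graph_map u x - graph_map v x"
proof -
  have "AE x in lebesgue. \<forall>i. weak_partial i (comb u (-1) v) x
      = comb (weak_partial i u) (-1) (weak_partial i v) x"
    unfolding AE_all_countable using W12_comb(2)[OF form_domainD(1)[OF assms(1)] form_domainD(1)[OF assms(2)]]
        by blast
  then show ?thesis
  proof eventually_elim
    case (elim x)
    then show ?case by (simp add: graph_map_def weighted_comb vec_eq_iff) (simp add: comb_def)
  qed
qed

lemma graph_norm_diff:
  assumes "u \<in> form_domain V" "v \<in> form_domain V"
  shows "Re (schroedinger_form V (comb u (-1) v) (comb u (-1) v) + L2_inner (comb u (-1) v) (comb u (-1) v))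
    = (LINT x|lebesgue. (norm (graph_map u x - graph_map v x))\<^sup>2)"
proof -
  let ?d = "comb u (-1) v"
  have d: "?d \<in> form_domain V" by (rule form_domain_comb[OF assms])
  have [measurable]: "graph_map u \<in> borel_measurable lebesgue" "graph_map v \<in> borel_measurable lebesgue"
    "graph_map ?d \<in> borel_measurable lebesgue" using graph_map_L2(1) assms d by blast+
  have "(LINT x|lebesgue. (norm (graph_map ?d x))\<^sup>2)
      = (LINT x|lebesgue. (norm (graph_map u x - graph_map v x))\<^sup>2)"
    by (rule integral_cong_AE) (use graph_map_diff[OF assms] in \<open>auto elim!: eventually_mono\<close>)
  then show ?thesis using graph_map_L2(3)[OF d] by simp
qed

lemma zero_in_form_domain: "(\<lambda>_. 0) \<in> form_domain V"
proof -
  have z: "(\<lambda>_. 0) \<in> (L2 :: (real ^ 'n \<Rightarrow> complex) set)" by (simp add: L2_def)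
  have "has_weak_partial i (\<lambda>_. 0) (\<lambda>_. 0)" for i :: 'n by (simp add: has_weak_partial_def)
  with z show ?thesis by (auto simp: form_domain_iff W12_def weighted_def[abs_def])
qed

text \<open>
  The quadratic form is closed: the limit of the triples is again the triple of its first component,
  since weak derivatives pass to \<open>L\<^sup>2\<close> limits and the third component is identified along an almost
  everywhere convergent subsequence.
\<close>

lemma complete_schroedinger:
  "complete_form (form_domain V) comb (\<lambda>u v. schroedinger_form V u v + L2_inner u v)"
proof -
  interpret p: pos_form "form_domain V" comb "\<lambda>u v. schroedinger_form V u v + L2_inner u v"
    by (rule pos_form_add[OF pos_form_schroedinger pos_form_inner])
  show ?thesis
  proof
    show "form_domain V \<noteq> {}" using zero_in_form_domain by blast
    fix X :: "nat \<Rightarrow> real ^ 'n \<Rightarrow> complex" assume X: "\<And>n. X n \<in> form_domain V"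
    assume "\<And>e. e > 0 \<Longrightarrow> \<exists>N. \<forall>i\<ge>N. \<forall>j\<ge>N. Re (schroedinger_form V (comb (X i) (-1) (X j)) (comb (X i) (-1) (X
        j))
        + L2_inner (comb (X i) (-1) (X j)) (comb (X i) (-1) (X j))) < e"
    then have cauchy: "\<And>e. e > 0 \<Longrightarrow> \<exists>N. \<forall>i\<ge>N. \<forall>j\<ge>N. (LINT x|lebesgue. (norm (graph_map (X i) x
        - graph_map (X j) x))\<^sup>2) < e"
      unfolding graph_norm_diff[OF X X] .
    obtain G r where G [measurable]: "G \<in> borel_measurable lebesgue"
        and G2: "integrable lebesgue (\<lambda>x. (norm (G x))\<^sup>2)"
      and lim: "(\<lambda>n. LINT x|lebesgue. (norm (graph_map (X n) x - G x))\<^sup>2) \<longlonglongrightarrow> 0"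
      and ptw: "AE x in lebesgue. (\<lambda>k. graph_map (X (r k)) x) \<longlonglongrightarrow> G x"
      by (rule L2_complete[of "\<lambda>n. graph_map (X n)" lebesgue])
        (use graph_map_L2(1,2)[OF X] cauchy in auto)
    define L where "L x = fst (G x)" for x
    define g where "g i x = fst (snd (G x)) $ i" for i x
    define W where "W x = snd (snd (G x))" for x
    have Gx: "G x = (L x, (\<chi> i. g i x), W x)" for x by (simp add: L_def g_def W_def)
    have proj: "p \<circ> G \<in> L2"
      if p: "continuous_on UNIV p" "\<And>z. norm (p z) \<le> norm z"
          for p :: "complex \<times> (complex ^ 'n) \<times> complex \<Rightarrow> complex"
    proof -
      have m: "p \<circ> G \<in> borel_measurable lebesgue"
        using measurable_comp[OF G borel_measurable_continuous_onI[OF p(1)]] .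
      have "integrable lebesgue (\<lambda>x. (norm ((p \<circ> G) x))\<^sup>2)"
      proof (rule Bochner_Integration.integrable_bound[OF G2])
        show "(\<lambda>x. (norm ((p \<circ> G) x))\<^sup>2) \<in> borel_measurable lebesgue" using m by measurable
        show "AE x in lebesgue. norm ((norm ((p \<circ> G) x))\<^sup>2) \<le> norm ((norm (G x))\<^sup>2)"
          using p(2) by (intro always_eventually allI) (simp add: power_mono)
      qed
      with m show ?thesis by (simp add: L2_def)
    qed
    let ?p1 = "\<lambda>z :: complex \<times> (complex ^ 'n) \<times> complex. fst z"
    let ?p2 = "\<lambda>i (z :: complex \<times> (complex ^ 'n) \<times> complex). fst (snd z) $ i"
    let ?p3 = "\<lambda>z :: complex \<times> (complex ^ 'n) \<times> complex. snd (snd z)"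
    have c: "continuous_on UNIV ?p1" "continuous_on UNIV (?p2 i)" "continuous_on UNIV ?p3" for i
      by (intro continuous_intros)+
    have n1: "norm (?p1 z) \<le> norm z" for z
      using norm_fst_le[of "fst z" "snd z"] by simp
    have n23: "norm (fst (snd z)) \<le> norm z" "norm (?p3 z) \<le> norm z"
        for z :: "complex \<times> (complex ^ 'n) \<times> complex"
      using norm_snd_le[of "snd z" "fst z"] norm_fst_le[of "fst (snd z)" "snd (snd z)"]
        norm_snd_le[of "snd (snd z)" "fst (snd z)"] by simp_all
    have n2: "norm (?p2 i z) \<le> norm z" for i z
      using Finite_Cartesian_Product.norm_nth_le[of "fst (snd z)" i] n23(1)[of z] by simp
    have L: "L \<in> L2"
      using proj[OF c(1) n1] by (simp add: L_def[abs_def] o_def)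
    have gL: "g i \<in> L2" for i
      using proj[OF c(2) n2, of i] by (simp add: g_def[abs_def] o_def)
    have comp_lim: "(\<lambda>n. LINT x|lebesgue. (norm (p (graph_map (X n) x) - p (G x)))\<^sup>2) \<longlonglongrightarrow> 0"
      if p: "continuous_on UNIV p" "\<And>z. norm (p z) \<le> norm z" "\<And>y z. p y - p z = p (y - z)"
      for p :: "complex \<times> (complex ^ 'n) \<times> complex \<Rightarrow> complex"
    proof (rule tendsto_sandwich[OF _ _ tendsto_const lim])
      have "(LINT x|lebesgue. (norm (p (graph_map (X n) x) - p (G x)))\<^sup>2)
          \<le> (LINT x|lebesgue. (norm (graph_map (X n) x - G x))\<^sup>2)" for n
      proof (rule integral_mono')
        show "integrable lebesgue (\<lambda>x. (norm (graph_map (X n) x - G x))\<^sup>2)"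
          by (rule integrable_norm_diff_sq(1)[OF graph_map_L2(1)[OF X] G graph_map_L2(2)[OF X] G2])
      qed (auto simp: p(3) intro!: power_mono p(2))
      then show "\<forall>\<^sub>F n in sequentially. (LINT x|lebesgue. (norm (p (graph_map (X n) x) - p (G x)))\<^sup>2)
          \<le> (LINT x|lebesgue. (norm (graph_map (X n) x - G x))\<^sup>2)" by simp
    qed simp
    have limX: "(\<lambda>n. LINT x|lebesgue. (norm (X n x - L x))\<^sup>2) \<longlonglongrightarrow> 0"
      using comp_lim[OF c(1) n1] by (simp add: graph_map_def L_def)
    have limg: "(\<lambda>n. LINT x|lebesgue. (norm (weak_partial i (X n) x - g i x))\<^sup>2) \<longlonglongrightarrow> 0" for i
      using comp_lim[OF c(2) n2, of i] by (simp add: graph_map_def g_def)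
    have wp: "has_weak_partial i L (g i)" for i
      unfolding has_weak_partial_inner
    proof (intro allI impI)
      fix \<phi> :: "real ^ 'n \<Rightarrow> real" assume \<phi>: "test_function \<phi>"
      let ?p = "\<lambda>x. complex_of_real (\<phi> x)" and ?dp = "\<lambda>x. complex_of_real (partial i \<phi> x)"
      have 1: "(\<lambda>n. L2_inner (X n) ?dp) \<longlonglongrightarrow> L2_inner L ?dp"
        by (rule L2_inner_tendsto[OF form_domainD(2)[OF X] L test_function_L2(2)[OF \<phi>] limX])
      have "(\<lambda>n. - L2_inner (weak_partial i (X n)) ?p) \<longlonglongrightarrow> - L2_inner (g i) ?p"
        by (intro tendsto_minus L2_inner_tendsto[OF form_domainD(4)[OF X] gL test_function_L2(1)[OF \<phi>] limg])
      moreover have "L2_inner (X n) ?dp = - L2_inner (weak_partial i (X n)) ?p" for n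
        using weak_partial(2)[OF form_domainD(1)[OF X], of i n] \<phi> unfolding has_weak_partial_inner by blast
      ultimately show "L2_inner L ?dp = - L2_inner (g i) ?p" using LIMSEQ_unique[OF 1] by simp
    qed
    have LW: "L \<in> W12" using L gL wp by (auto simp: W12_def)
    have WL: "AE x in lebesgue. W x = weighted V L x"
      using ptw
    proof eventually_elim
      case (elim x)
      have "(\<lambda>k. fst (graph_map (X (r k)) x)) \<longlonglongrightarrow> L x" "(\<lambda>k. snd (snd (graph_map (X (r k)) x))) \<longlonglongrightarrow> W x"
        unfolding L_def W_def by (intro tendsto_intros elim)+
      then have 1: "(\<lambda>k. X (r k) x) \<longlonglongrightarrow> L x" and 2: "(\<lambda>k. weighted V (X (r k)) x) \<longlonglongrightarrow> W x"
        by (simp_all add: graph_map_def)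
      have "(\<lambda>k. weighted V (X (r k)) x) \<longlonglongrightarrow> weighted V L x"
        unfolding weighted_def by (intro tendsto_intros 1)
      with 2 show ?case by (rule LIMSEQ_unique)
    qed
    have WL2: "W \<in> L2"
      using proj[OF c(3) n23(2)] by (simp add: W_def[abs_def] o_def)
    have "weighted V L \<in> L2"
    proof -
      have m: "weighted V L \<in> borel_measurable lebesgue" by (rule weighted_measurable[OF L2D(1)[OF L]])
      have "integrable lebesgue (\<lambda>x. (norm (weighted V L x))\<^sup>2)"
        by (rule integrable_cong_AE_imp[OF L2D(2)[OF WL2]]) (use m WL in \<open>auto elim!: eventually_mono\<close>)
      with m show ?thesis by (simp add: L2_def)
    qed
    with LW have LD: "L \<in> form_domain V" by (simp add: form_domain_iff)
    have "AE x in lebesgue. \<forall>i. weak_partial i L x = g i x"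
      unfolding AE_all_countable using weak_partial_eqI[OF LW gL wp] by blast
    with WL have GL: "AE x in lebesgue. graph_map L x = G x"
      by eventually_elim (simp add: graph_map_def Gx vec_eq_iff)
    have "(LINT x|lebesgue. (norm (graph_map (X n) x - graph_map L x))\<^sup>2)
        = (LINT x|lebesgue. (norm (graph_map (X n) x - G x))\<^sup>2)" for n
    proof (rule integral_cong_AE)
      have [measurable]: "graph_map (X n) \<in> borel_measurable lebesgue" "graph_map L \<in> borel_measurable
          lebesgue"
        using graph_map_L2(1) X LD by blast+
      show "(\<lambda>x. (norm (graph_map (X n) x - graph_map L x))\<^sup>2) \<in> borel_measurable lebesgue"
        "(\<lambda>x. (norm (graph_map (X n) x - G x))\<^sup>2) \<in> borel_measurable lebesgue" by measurable
      show "AE x in lebesgue. (norm (graph_map (X n) x - graph_map L x))\<^sup>2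
          = (norm (graph_map (X n) x - G x))\<^sup>2"
        using GL by eventually_elim simp
    qed
    then have "(\<lambda>n. LINT x|lebesgue. (norm (graph_map (X n) x - graph_map L x))\<^sup>2) \<longlonglongrightarrow> 0"
      using lim by simp
    with LD show "\<exists>L\<in>form_domain V. (\<lambda>n. Re (schroedinger_form V (comb (X n) (-1) L) (comb (X n) (-1) L)
        + L2_inner (comb (X n) (-1) L) (comb (X n) (-1) L))) \<longlonglongrightarrow> 0"
      unfolding graph_norm_diff[OF X LD, symmetric] by (intro bexI[of _ L])
  qed
qed

text \<open>
  The half-plane to the left of a lower bound of the form belongs to the resolvent set. Testing the
  equation with \<open>u\<close> itself gives \<open>(\<kappa> - Re z) \<parallel>u\<parallel> \<le> \<parallel>(A - z) u\<parallel>\<close>, hence injectivity and the bound for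
  the inverse; surjectivity is \<open>weak_resolvent\<close>.
\<close>

lemma resolvent_below_bound:
  assumes low: "\<And>u. u \<in> form_domain V \<Longrightarrow> \<kappa> * Re (L2_inner u u) \<le> Re (schroedinger_form V u u)"
    and z: "Re z < \<kappa>"
  shows "z \<in> resolvent_set (schroedinger_op V)"
proof -
  let ?A = "schroedinger_op V"
  have est: "(\<kappa> - Re z) * L2_norm u \<le> L2_norm (\<lambda>x. f x - z * u x)" if A: "(u, f) \<in> ?A" for u f
  proof -
    have u: "u \<in> form_domain V" and f: "f \<in> L2" and eq: "schroedinger_form V u u = L2_inner f u"
      using A unfolding schroedinger_op_def mem_Collect_eq prod.case by blast+
    note uL = form_domainD(2)[OF u]
    have h: "comb f (- z) u = (\<lambda>x. f x - z * u x)" by (simp add: comb_def fun_eq_iff)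
    let ?h = "\<lambda>x. f x - z * u x"
    have hL: "?h \<in> L2" using L2_comb[OF f uL, of "- z"] by (simp only: h)
    have n: "Re (L2_inner w w) = (L2_norm w)\<^sup>2" for w
      by (simp add: L2_inner_self L2_norm_def)
    have n0: "0 \<le> L2_norm w" for w by (simp add: L2_norm_def)
    have im: "Im (L2_inner u u) = 0" by (simp add: L2_inner_self)
    have "L2_inner ?h u = schroedinger_form V u u - z * L2_inner u u"
      using L2_inner_left[OF f uL uL, of "- z"] unfolding h eq by simp
    then have "Re (L2_inner ?h u) = Re (schroedinger_form V u u) - Re z * (L2_norm u)\<^sup>2"
      by (simp add: n im)
    then have "(\<kappa> - Re z) * (L2_norm u)\<^sup>2 \<le> Re (L2_inner ?h u)"
      using low[OF u] by (simp add: n algebra_simps)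
    also have "\<dots> \<le> norm (L2_inner ?h u)" by (rule complex_Re_le_cmod)
    also have "\<dots> \<le> L2_norm ?h * L2_norm u"
      unfolding L2_norm_def real_sqrt_mult[symmetric]
          by (rule real_le_rsqrt) (rule L2_cauchy_schwarz[OF hL uL])
    finally have "((\<kappa> - Re z) * L2_norm u) * L2_norm u \<le> L2_norm ?h * L2_norm u"
      by (simp add: power2_eq_square mult.assoc)
    then show ?thesis
      using n0[of u] n0[of ?h] by (cases "L2_norm u = 0") (auto intro: mult_right_le_imp_le)
  qed
  show ?thesis
    unfolding resolvent_set_def mem_Collect_eq
  proof (intro conjI)
    show "\<forall>(u, f)\<in>?A. (AE x in lebesgue. f x - z * u x = 0) \<longrightarrow> (AE x in lebesgue. u x = 0)"
    proof (intro ballI, unfold split_paired_all prod.case, rule impI)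
      fix u f assume A: "(u, f) \<in> ?A" and 0: "AE x in lebesgue. f x - z * u x = 0"
      have uL: "u \<in> L2" using A form_domainD(2) unfolding schroedinger_op_def mem_Collect_eq prod.case
          by blast
      have "L2_norm (\<lambda>x. f x - z * u x) = 0"
      proof -
        have "(LINT x|lebesgue. (norm (f x - z * u x))\<^sup>2) = 0"
          by (rule integral_eq_zero_AE) (use 0 in \<open>auto elim!: eventually_mono\<close>)
        then show ?thesis by (simp add: L2_norm_def)
      qed
      with est[OF A] z have "L2_norm u \<le> 0" by (simp add: mult_le_0_iff)
      then have "(LINT x|lebesgue. (norm (u x))\<^sup>2) = 0"
        unfolding L2_norm_def by (simp add: order_antisym integral_nonneg_AE)
      then show "AE x in lebesgue. u x = 0"
        using integral_nonneg_eq_0_iff_AE[OF L2D(2)[OF uL]] by simp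
    qed
    show "\<forall>g\<in>L2. \<exists>(u, f)\<in>?A. AE x in lebesgue. f x - z * u x = g x"
    proof
      fix g :: "real ^ 'n \<Rightarrow> complex" assume g: "g \<in> L2"
      have "\<exists>u\<in>form_domain V. \<forall>v\<in>form_domain V. schroedinger_form V u v - z * L2_inner u v = L2_inner g v"
      proof (rule weak_resolvent[OF complete_schroedinger pos_form_schroedinger pos_form_inner low z])
        show "L2_inner g (comb u c v) = L2_inner g u + cnj c * L2_inner g v"
          if "u \<in> form_domain V" "v \<in> form_domain V" for u v c
          using L2_inner_left[OF form_domainD(2)[OF that(1)] form_domainD(2)[OF that(2)] g, of c]
          by (simp add: L2_inner_sym[of g])
        show "0 \<le> (LINT x|lebesgue. (norm (g x))\<^sup>2)" by simp
        show "(Re (L2_inner g v))\<^sup>2 \<le> (LINT x|lebesgue. (norm (g x))\<^sup>2) * Re (L2_inner v v)"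
          if v: "v \<in> form_domain V" for v
        proof -
          have "(Re (L2_inner g v))\<^sup>2 \<le> (norm (L2_inner g v))\<^sup>2"
            using abs_Re_le_cmod by (simp add: abs_le_square_iff[symmetric])
          also have "\<dots> \<le> (LINT x|lebesgue. (norm (g x))\<^sup>2) * Re (L2_inner v v)"
            using L2_cauchy_schwarz[OF g form_domainD(2)[OF v]] by (simp add: L2_inner_self)
          finally show ?thesis .
        qed
      qed
      then obtain u where u: "u \<in> form_domain V"
        and eq: "\<And>v. v \<in> form_domain V \<Longrightarrow> schroedinger_form V u v - z * L2_inner u v = L2_inner g v" by blast
      let ?f = "comb g z u"
      have f: "?f \<in> L2" by (rule L2_comb[OF g form_domainD(2)[OF u]])
      have "schroedinger_form V u v = L2_inner ?f v" if v: "v \<in> form_domain V" for v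
        using eq[OF v] L2_inner_left[OF g form_domainD(2)[OF u] form_domainD(2)[OF v], of z]
            by (simp add: algebra_simps)
      then have "(u, ?f) \<in> ?A" using u f by (simp add: schroedinger_op_def)
      moreover have "AE x in lebesgue. ?f x - z * u x = g x" by (simp add: comb_def)
      ultimately show "\<exists>(u, f)\<in>?A. AE x in lebesgue. f x - z * u x = g x" by blast
    qed
    show "\<exists>C. \<forall>(u, f)\<in>?A. L2_norm u \<le> C * L2_norm (\<lambda>x. f x - z * u x)"
    proof (rule exI[of _ "1 / (\<kappa> - Re z)"], intro ballI, unfold split_paired_all prod.case)
      fix u f assume "(u, f) \<in> ?A"
      from est[OF this] show "L2_norm u \<le> (1 / (\<kappa> - Re z)) * L2_norm (\<lambda>x. f x - z * u x)"
        using z by (simp add: field_simps)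
    qed
  qed
qed

end

section \<open>The lower bound of the spectrum\<close>

text \<open>
  The lower bound \<open>form_bound_borel\<close> for the form itself, through Borel representatives of \<open>u\<close>, of its weak
  partial derivatives and of \<open>V\<close>.
\<close>

lemma form_bound:
  fixes V :: "real ^ 'n \<Rightarrow> real"
  assumes V_meas: "V \<in> borel_measurable lebesgue" and V0: "AE x in lebesgue. 0 \<le> V x"
    and R: "R > 0" and \<kappa>0: "0 \<le> \<kappa>"
    and m: "\<And>y. y \<in> scaled_lattice R \<Longrightarrow> AE x in lebesgue. x \<in> cube R y \<longrightarrow> V x \<le> m y"
    and \<kappa>: "\<And>y. y \<in> scaled_lattice R \<Longrightarrow> \<kappa> \<le> pi\<^sup>2 / (pi\<^sup>2 + 2 * R\<^sup>2 * m y) * cube_average R V y"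
    and u: "u \<in> form_domain V"
  shows "\<kappa> * Re (L2_inner u u) \<le> Re (schroedinger_form V u u)"
proof -
  have uW: "u \<in> W12" and Vu: "integrable lebesgue (\<lambda>x. V x * (norm (u x))\<^sup>2)"
    using u by (auto simp: form_domain_def)
  note um = L2D(1)[OF W12_L2[OF uW]]
  note gL = weak_partial(1)[OF uW]
  obtain u' where u': "u' \<in> borel_measurable borel" "AE x in lborel. u x = u' x"
    by (rule lebesgue_borel_rep[OF um])
  have "\<exists>g. g \<in> borel_measurable borel \<and> (AE x in lborel. weak_partial i u x = g x)" for i
    using lebesgue_borel_rep[OF L2D(1)[OF gL[of i]]] by metis
  then obtain g where g: "\<And>i. g i \<in> borel_measurable borel" "\<And>i. AE x in lborel. weak_partial i u x = g i x"
      by metis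
  obtain V' where V': "V' \<in> borel_measurable borel" "AE x in lborel. V x = V' x"
    using completion_ex_borel_measurable_real[OF V_meas] by auto
  have sq: "(LINT x|lebesgue. (norm (f x))\<^sup>2) = (LINT x|lborel. (norm (f' x))\<^sup>2)"
    "integrable lebesgue (\<lambda>x. (norm (f x))\<^sup>2) \<longleftrightarrow> integrable lborel (\<lambda>x. (norm (f' x))\<^sup>2)"
    if f: "f \<in> borel_measurable lebesgue" "f' \<in> borel_measurable borel" "AE x in lborel. f x = f' x"
    for f f' :: "real ^ 'n \<Rightarrow> complex"
  proof -
    have "AE x in lborel. (norm (f x))\<^sup>2 = (norm (f' x))\<^sup>2" using f(3) by eventually_elim simp
    note r = lebesgue_rep_integral[OF _ _ this]
    note [measurable] = f(1,2)
    show "(LINT x|lebesgue. (norm (f x))\<^sup>2) = (LINT x|lborel. (norm (f' x))\<^sup>2)"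
      by (intro r(1)) measurable
    show "integrable lebesgue (\<lambda>x. (norm (f x))\<^sup>2) \<longleftrightarrow> integrable lborel (\<lambda>x. (norm (f' x))\<^sup>2)"
      by (intro r(2)) measurable
  qed
  have Vu': "(LINT x|lebesgue. V x * (norm (u x))\<^sup>2) = (LINT x|lborel. V' x * (norm (u' x))\<^sup>2)"
    "integrable lborel (\<lambda>x. V' x * (norm (u' x))\<^sup>2)"
  proof -
    have "AE x in lborel. V x * (norm (u x))\<^sup>2 = V' x * (norm (u' x))\<^sup>2"
      using V'(2) u'(2) by eventually_elim simp
    note r = lebesgue_rep_integral[OF _ _ this]
    note [measurable] = V_meas um V'(1) u'(1)
    show "(LINT x|lebesgue. V x * (norm (u x))\<^sup>2) = (LINT x|lborel. V' x * (norm (u' x))\<^sup>2)"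
      by (intro r(1)) measurable
    have "integrable lebesgue (\<lambda>x. V x * (norm (u x))\<^sup>2) \<longleftrightarrow> integrable lborel (\<lambda>x. V' x * (norm (u' x))\<^sup>2)"
      by (intro r(2)) measurable
    with Vu show "integrable lborel (\<lambda>x. V' x * (norm (u' x))\<^sup>2)" by simp
  qed
  have test: "(LINT x|lebesgue. \<psi> x *\<^sub>R f x) = (LINT x|lborel. \<psi> x *\<^sub>R f' x)"
    if f: "f \<in> borel_measurable lebesgue" "f' \<in> borel_measurable borel" "AE x in lborel. f x = f' x"
      and \<psi>: "\<psi> \<in> borel_measurable borel" for f f' :: "real ^ 'n \<Rightarrow> complex" and \<psi> :: "real ^ 'n \<Rightarrow> real"
  proof (rule lebesgue_rep_integral(1))
    have "\<psi> \<in> borel_measurable lebesgue" using \<psi> by (intro measurable_completion) simp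
    then show "(\<lambda>x. \<psi> x *\<^sub>R f x) \<in> borel_measurable lebesgue" using f by measurable
    show "(\<lambda>x. \<psi> x *\<^sub>R f' x) \<in> borel_measurable borel" using \<psi> f by measurable
    show "AE x in lborel. \<psi> x *\<^sub>R f x = \<psi> x *\<^sub>R f' x" using f(3) by eventually_elim simp
  qed
  have avg: "(LINT x|lborel. indicator (cube R y) x * V' x) / R ^ CARD('n) = cube_average R V y" for y
  proof -
    have [measurable]: "cube R y \<in> sets borel" by (simp add: cube_eq_box)
    have "(LINT x|lebesgue. indicator (cube R y) x *\<^sub>R V x)
        = (LINT x|lborel. indicator (cube R y) x *\<^sub>R V' x)"
    proof (rule lebesgue_rep_integral(1))
      have "cube R y \<in> sets lebesgue" by simp
      then show "(\<lambda>x. indicator (cube R y) x *\<^sub>R V x) \<in> borel_measurable lebesgue" using V_meas by measurable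
      show "(\<lambda>x. indicator (cube R y) x *\<^sub>R V' x) \<in> borel_measurable borel" using V'(1) by measurable
      show "AE x in lborel. indicator (cube R y) x *\<^sub>R V x = indicator (cube R y) x *\<^sub>R V' x"
        using V'(2) by eventually_elim simp
    qed
    then show ?thesis by (simp add: cube_average_def set_lebesgue_integral_def)
  qed
  have "\<kappa> * (LINT x|lborel. (norm (u' x))\<^sup>2)
    \<le> (LINT x|lborel. V' x * (norm (u' x))\<^sup>2) + (\<Sum>i\<in>UNIV. LINT x|lborel. (norm (g i x))\<^sup>2)"
  proof (rule form_bound_borel[OF u'(1) g(1) V'(1) _ _ Vu'(2) _ R _ _ \<kappa>0])
    show "integrable lborel (\<lambda>x. (norm (u' x))\<^sup>2)" using sq(2)[OF um u'] L2D(2)[OF W12_L2[OF uW]] by simp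
    show "integrable lborel (\<lambda>x. (norm (g i x))\<^sup>2)" for i
      using sq(2)[OF L2D(1)[OF gL] g] L2D(2)[OF gL] by blast
    show "(LINT x|lborel. partial i \<phi> x *\<^sub>R u' x) = - (LINT x|lborel. \<phi> x *\<^sub>R g i x)"
      if \<phi>: "test_function \<phi>" for i \<phi>
      using weak_partial(2)[OF uW, of i] \<phi> test[OF um u' test_function_cont(4)[OF \<phi>, of i]]
        test[OF L2D(1)[OF gL] g test_function_cont(3)[OF \<phi>], of i]
      unfolding has_weak_partial_def by metis
    show "AE x in lborel. 0 \<le> V' x"
      using V0 V'(2) unfolding AE_completion_iff by eventually_elim simp
    show "AE x in lborel. x \<in> cube R y \<longrightarrow> V' x \<le> m y" if "y \<in> scaled_lattice R" for y
      using m[OF that] V'(2) unfolding AE_completion_iff by eventually_elim simp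
    show "\<kappa> \<le> pi\<^sup>2 / (pi\<^sup>2 + 2 * R\<^sup>2 * m y) * ((LINT x|lborel. indicator (cube R y) x * V' x) / R ^ CARD('n))"
      if "y \<in> scaled_lattice R" for y
      using \<kappa>[OF that] by (simp only: avg)
  qed
  moreover have "Re (L2_inner u u) = (LINT x|lborel. (norm (u' x))\<^sup>2)"
    by (simp add: L2_inner_self sq(1)[OF um u'])
  moreover have "Re (schroedinger_form V u u) =
      (LINT x|lborel. V' x * (norm (u' x))\<^sup>2) + (\<Sum>i\<in>UNIV. LINT x|lborel. (norm (g i x))\<^sup>2)"
  proof -
    have "(LINT x|lebesgue. (\<Sum>i\<in>UNIV. (norm (weak_partial i u x))\<^sup>2))
        = (\<Sum>i\<in>UNIV. LINT x|lebesgue. (norm (weak_partial i u x))\<^sup>2)"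
      by (rule Bochner_Integration.integral_sum) (rule L2D(2)[OF gL])
    also have "\<dots> = (\<Sum>i\<in>UNIV. LINT x|lborel. (norm (g i x))\<^sup>2)"
      by (intro sum.cong refl sq(1)[OF L2D(1)[OF gL] g])
    finally show ?thesis unfolding schroedinger_form_diag[OF u] by (simp add: Vu')
  qed
  ultimately show ?thesis by simp
qed

lemma Linf_norm_nonneg: "0 \<le> Linf_norm S V"
  by (simp add: Linf_norm_def)

lemma Linf_norm_AE:
  assumes S: "S \<in> sets lebesgue"
  shows "AE x in lebesgue. x \<in> S \<longrightarrow> ereal \<bar>V x\<bar> \<le> Linf_norm S V"
proof -
  have "AE x in restrict_space lebesgue S. ennreal \<bar>V x\<bar>
      \<le> esssup (restrict_space lebesgue S) (\<lambda>x. ennreal \<bar>V x\<bar>)"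
    by (rule esssup_AE)
  then have "AE x in lebesgue. x \<in> S \<longrightarrow> ennreal \<bar>V x\<bar> \<le> esssup (restrict_space lebesgue S) (\<lambda>x. ennreal \<bar>V x\<bar>)"
    using S by (subst (asm) AE_restrict_space_iff) auto
  then show ?thesis
  proof eventually_elim
    case (elim x)
    show ?case
    proof
      assume "x \<in> S"
      with elim have "enn2ereal (ennreal \<bar>V x\<bar>) \<le> Linf_norm S V"
        unfolding Linf_norm_def less_eq_ennreal.rep_eq by simp
      then show "ereal \<bar>V x\<bar> \<le> Linf_norm S V" by (simp add: enn2ereal_ennreal)
    qed
  qed
qed

lemma Linf_norm_mono:
  assumes V: "V \<in> borel_measurable lebesgue" and S: "S \<in> sets lebesgue" and T: "T \<in> sets lebesgue"
      and ST: "S \<subseteq> T"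
  shows "Linf_norm S V \<le> Linf_norm T V"
proof -
  let ?c = "esssup (restrict_space lebesgue T) (\<lambda>x. ennreal \<bar>V x\<bar>)"
  have "esssup (restrict_space lebesgue S) (\<lambda>x. ennreal \<bar>V x\<bar>) \<le> ?c"
  proof (rule esssup_I)
    show "(\<lambda>x. ennreal \<bar>V x\<bar>) \<in> borel_measurable (restrict_space lebesgue S)"
      using V by (intro measurable_restrict_space1) measurable
    have "AE x in restrict_space lebesgue T. ennreal \<bar>V x\<bar> \<le> ?c" by (rule esssup_AE)
    then have "AE x in lebesgue. x \<in> T \<longrightarrow> ennreal \<bar>V x\<bar> \<le> ?c"
      using T by (subst (asm) AE_restrict_space_iff) auto
    then have "AE x in lebesgue. x \<in> S \<longrightarrow> ennreal \<bar>V x\<bar> \<le> ?c"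
      by eventually_elim (use ST in auto)
    then show "AE x in restrict_space lebesgue S. ennreal \<bar>V x\<bar> \<le> ?c"
      using S by (subst AE_restrict_space_iff) auto
  qed
  then show ?thesis by (simp add: Linf_norm_def less_eq_ennreal.rep_eq)
qed

lemma Linf_norm_cube_finite:
  assumes "V \<in> Linf_loc"
  obtains m where "Linf_norm (cube R y) V = ereal m" "0 \<le> m"
proof -
  let ?K = "cbox y (\<chi> i. y $ i + R)"
  have "Linf_norm (cube R y) V \<le> Linf_norm ?K V"
  proof (rule Linf_norm_mono)
    show "V \<in> borel_measurable lebesgue" using assms by (simp add: Linf_loc_def)
    show "cube R y \<subseteq> ?K" by (simp add: cube_eq_box box_subset_cbox)
  qed (simp_all add: cube_eq_box)
  also have "\<dots> < \<infinity>" using assms by (simp add: Linf_loc_def)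
  finally show ?thesis
    using that Linf_norm_nonneg[of "cube R y" V] by (cases "Linf_norm (cube R y) V") auto
qed

lemma cube_average_nonneg:
  assumes "AE x in lebesgue. 0 \<le> V x" "R > 0"
  shows "0 \<le> cube_average R V y"
proof -
  have "0 \<le> (LINT x:cube R y|lebesgue. V x)"
    unfolding set_lebesgue_integral_def
    by (rule integral_nonneg_AE) (use assms(1) in \<open>auto elim!: eventually_mono\<close>)
  then show ?thesis using assms(2) by (simp add: cube_average_def)
qed

theorem corollary4p2:
  fixes V :: "real ^ 'n \<Rightarrow> real"
  assumes V_loc: "V \<in> Linf_loc"
    and V_nonneg: "AE x in lebesgue. 0 \<le> V x"
  shows "inf_spectrum (schroedinger_op V) \<ge>
      (SUP R\<in>{0<..}. INF y\<in>scaled_lattice R.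
         ereal (pi\<^sup>2) / (ereal (pi\<^sup>2) + ereal (2 * R\<^sup>2) * Linf_norm (cube R y) V)
           * ereal (cube_average R V y))
    \<and> (\<forall>R \<rho>. R > 0 \<longrightarrow> \<rho> > 0 \<longrightarrow> thick R \<rho> V \<longrightarrow>
         inf_spectrum (schroedinger_op V) \<ge>
           ereal (pi\<^sup>2 * \<rho>) / (ereal (pi\<^sup>2) + ereal (2 * R\<^sup>2) * Linf_norm UNIV V))"
proof -
  have V_meas: "V \<in> borel_measurable lebesgue" using V_loc by (simp add: Linf_loc_def)
  \<comment> \<open>The term of the estimate for the cube \<open>C_R(y)\<close>; it is finite, as \<open>V\<close> is bounded on every cube.\<close>
  define t where "t R y = ereal (pi\<^sup>2) / (ereal (pi\<^sup>2) + ereal (2 * R\<^sup>2) * Linf_norm (cube R y) V)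
           * ereal (cube_average R V y)" for R and y :: "real ^ 'n"
  have "\<exists>m. Linf_norm (cube R y) V = ereal m \<and> 0 \<le> m" for R and y :: "real ^ 'n"
    by (rule Linf_norm_cube_finite[OF V_loc, of R y]) blast
  then obtain m where m: "\<And>R y :: real ^ 'n. Linf_norm (cube R y) V = ereal (m R y)"
    and m0: "\<And>R y :: real ^ 'n. 0 \<le> m R y" by metis
  have pi2: "pi\<^sup>2 > 0" by simp
  have den: "pi\<^sup>2 + 2 * R\<^sup>2 * m R y > 0" for R y
    using pi2 m0[of R y] by (intro add_pos_nonneg) auto
  have t: "t R y = ereal (pi\<^sup>2 / (pi\<^sup>2 + 2 * R\<^sup>2 * m R y) * cube_average R V y)" for R y
    using den[of R y] by (simp add: t_def m)
  have t0: "0 \<le> t R y" if "R > 0" for R y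
    unfolding t using cube_average_nonneg[OF V_nonneg that, of y] den[of R y]
    by (simp add: less_imp_le)
  have cube_le: "AE x in lebesgue. x \<in> cube R y \<longrightarrow> V x \<le> m R y" for R and y :: "real ^ 'n"
    using Linf_norm_AE[of "cube R y" V] unfolding m by (rule eventually_mono) (auto simp: cube_eq_box)
  have zero: "0 \<in> (scaled_lattice R :: (real ^ 'n) set)" for R
    unfolding scaled_lattice_def by (rule image_eqI[of _ _ 0]) auto
  have first: "(SUP R\<in>{0<..}. INF y\<in>scaled_lattice R. t R y) \<le> inf_spectrum (schroedinger_op V)"
    unfolding inf_spectrum_def
  proof (rule INF_greatest)
    fix z assume z: "z \<in> spectrum (schroedinger_op V)"
    show "(SUP R\<in>{0<..}. INF y\<in>scaled_lattice R. t R y) \<le> ereal (Re z)"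
    proof (rule ccontr)
      assume "\<not> ?thesis"
      then obtain R where R: "R > 0" and zR: "ereal (Re z) < (INF y\<in>scaled_lattice R. t R y)"
        by (auto simp: not_le less_SUP_iff)
      let ?i = "INF y\<in>scaled_lattice R. t R y"
      have "?i \<le> t R 0" by (rule INF_lower[OF zero])
      moreover have "0 \<le> ?i" by (rule INF_greatest) (rule t0[OF R])
      ultimately obtain \<kappa> where \<kappa>: "?i = ereal \<kappa>" "0 \<le> \<kappa>"
        unfolding t by (cases ?i) (auto simp: t)
      have "\<kappa> \<le> pi\<^sup>2 / (pi\<^sup>2 + 2 * R\<^sup>2 * m R y) * cube_average R V y" if "y \<in> scaled_lattice R" for y
      proof -
        have "ereal \<kappa> \<le> t R y" using INF_lower[OF that, of "t R"] by (simp only: \<kappa>)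
        then show ?thesis by (simp add: t)
      qed
      then have "\<kappa> * Re (L2_inner u u) \<le> Re (schroedinger_form V u u)" if "u \<in> form_domain V" for u
        by (intro form_bound[OF V_meas V_nonneg R \<kappa>(2) cube_le _ that])
      then have "z \<in> resolvent_set (schroedinger_op V)"
        by (rule resolvent_below_bound[OF V_meas V_nonneg]) (use zR \<kappa> in auto)
      with z show False by (simp add: spectrum_def)
    qed
  qed
  moreover have "ereal (pi\<^sup>2 * \<rho>) / (ereal (pi\<^sup>2) + ereal (2 * R\<^sup>2) * Linf_norm UNIV V)
      \<le> inf_spectrum (schroedinger_op V)" if R: "R > 0" and \<rho>: "\<rho> > 0" and thick: "thick R \<rho> V" for R \<rho>
  proof -
    have "ereal (pi\<^sup>2 * \<rho>) / (ereal (pi\<^sup>2) + ereal (2 * R\<^sup>2) * Linf_norm UNIV V) \<le> t R y" for y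
    proof (cases "Linf_norm UNIV V")
      case (real M)
      have "cube R y \<in> sets lebesgue" by (simp add: cube_eq_box)
      then have le: "m R y \<le> M"
        using Linf_norm_mono[OF V_meas, of "cube R y" UNIV] by (simp add: m real)
      then have M: "pi\<^sup>2 + 2 * R\<^sup>2 * m R y \<le> pi\<^sup>2 + 2 * R\<^sup>2 * M" by (intro add_left_mono mult_left_mono) auto
      have "pi\<^sup>2 * \<rho> / (pi\<^sup>2 + 2 * R\<^sup>2 * M) = pi\<^sup>2 / (pi\<^sup>2 + 2 * R\<^sup>2 * M) * \<rho>" by simp
      also have "\<dots> \<le> pi\<^sup>2 / (pi\<^sup>2 + 2 * R\<^sup>2 * m R y) * cube_average R V y"
        using M den[of R y] thick \<rho> by (intro mult_mono divide_left_mono) (auto simp: thick_def)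
      finally show ?thesis using den[of R y] M by (simp add: t real)
    next
      \<comment> \<open>For unbounded \<open>V\<close> the left-hand side is \<open>0\<close>.\<close>
      case PInf
      then show ?thesis using t0[OF R, of y] R by simp
    next
      case MInf
      then show ?thesis using Linf_norm_nonneg[of UNIV V] by simp
    qed
    then have "ereal (pi\<^sup>2 * \<rho>) / (ereal (pi\<^sup>2) + ereal (2 * R\<^sup>2) * Linf_norm UNIV V)
        \<le> (INF y\<in>scaled_lattice R. t R y)"
      by (intro INF_greatest)
    also have "\<dots> \<le> (SUP R\<in>{0<..}. INF y\<in>scaled_lattice R. t R y)"
      using R by (intro SUP_upper) simp
    also note first
    finally show ?thesis .
  qed
  ultimately show ?thesis unfolding t_def by blast
qed

end
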